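(* Let $n \geq 2$ and, for $j = 1,\dots,n$, let $\Omega_j \subset \mathbb{R}^{d_j}$ with $d_j \in \mathbb{N}$ be open, and let $\mathcal{H}_j$ be a closed subspace of $H^1(\Omega_j)$ that is dense in $L^2(\Omega_j)$. Put $\Omega = \Omega_1 \times \dots \times \Omega_n \subset \mathbb{R}^d$ with $d = d_1 + \dots + d_n$. Let $\Delta_j$ be the Laplacian on $\Omega_j$ with form domain $\mathcal{H}_j$, and let $T$ be the self-adjoint operator on $L^2(\Omega)$ associated with $\mathcal{H}_1,\dots,\mathcal{H}_n$ (both as defined in the context). Suppose that for $j = 1,\dots,n$ we have $\operatorname{Dom}(\Delta_j) \subset H^2(\Omega_j)$ with \[ \sum_{|\alpha|=2} \frac{1}{\alpha!} \langle \partial^\alpha u , \partial^\alpha v \rangle_{L^2(\Omega_j)} = \frac{1}{2} \langle \Delta_j u , \Delta_j v \rangle_{L^2(\Omega_j)} \] for all $u,v \in \operatorname{Dom}(\Delta_j)$, where the sum is over multiindices $\alpha \in \mathbb{N}_0^{d_j}$. Then also $\operatorname{Dom}(T) \subset H^2(\Omega)$ with \[ \sum_{|\alpha|=2} \frac{1}{\alpha!} \langle \partial^\alpha f , \partial^\alpha g \rangle_{L^2(\Omega)} = \frac{1}{2} \langle Tf, Tg \rangle_{L^2(\Omega)} \] for all $f,g \in \operatorname{Dom}(T)$, where the sum is over multiindices $\alpha \in \mathbb{N}_0^{d}$.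
   Context: All function spaces consist of complex-valued functions, and inner products are linear in the first argument. $H^1$ and $H^2$ are the $L^2$-based Sobolev spaces of first and second order (all weak partial derivatives up to order 1, respectively 2, in $L^2$). For each $j$, $-\Delta_j$ is the unique nonnegative self-adjoint operator on $L^2(\Omega_j)$ satisfying $\operatorname{Dom}(\Delta_j) \subset \mathcal{H}_j$ and $\sum_{k=1}^{d_j} \langle \partial_k u, \partial_k v\rangle_{L^2(\Omega_j)} = \langle (-\Delta_j) u, v\rangle_{L^2(\Omega_j)}$ for all $u \in \operatorname{Dom}(\Delta_j)$ and $v \in \mathcal{H}_j$. For $f_j \in \mathcal{H}_j$, the elementary tensor $\bigotimes_{j=1}^n f_j \in H^1(\Omega)$ is the function $(x_1,\dots,x_n) \mapsto \prod_{j=1}^n f_j(x_j)$, $x_j \in \Omega_j$. Let $\mathcal{K} = \operatorname{span}_{\mathbb{C}}\{ \bigotimes_{j=1}^n f_j : f_j \in \mathcal{H}_j \} \subset H^1(\Omega)$, and define $\mathcal{H} = \bigotimes_{j=1}^n \mathcal{H}_j$ to be the closure of $\mathcal{K}$ in $H^1(\Omega)$ (with respect to the $H^1(\Omega)$-norm). The form $\mathfrak{t}[f,g] = \sum_{k=1}^d \langle \partial_k f, \partial_k g \rangle_{L^2(\Omega)}$, $f,g \in \mathcal{H}$, is closed, nonnegative, and densely defined on $L^2(\Omega)$. $T$ denotes the unique nonnegative self-adjoint operator on $L^2(\Omega)$ with $\operatorname{Dom}(T) \subset \mathcal{H}$ and $\mathfrak{t}[f,g] = \langle Tf, g\rangle_{L^2(\Omega)}$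 for all $f \in \operatorname{Dom}(T)$, $g \in \mathcal{H}$. For a multiindex $\alpha$, $|\alpha|$ is the sum of its entries, $\alpha!$ the product of the factorials of its entries, and $\partial^\alpha$ the corresponding weak derivative. *)

theory Defs
  imports "HOL-Analysis.Analysis" "HOL-Library.Function_Algebras"
begin

text \<open>
  The dimensions vary with an index inside the statement, so a point of \<open>\<real>\<^sup>d\<close> is a function in
  \<open>{..<d} \<rightarrow>\<^sub>E UNIV\<close>; this is the carrier of both \<open>eucl d\<close> and \<open>Pi\<^sub>M {..<d} (\<lambda>_. lborel)\<close>.
  Coordinates, and likewise the factors of a product, are numbered from 0.

  Elements of \<open>L\<^sup>2\<close> and of Sobolev spaces are represented by functions. Only their values on
  \<open>\<Omega>\<close> matter, and equality in these spaces is equality almost everywhere on \<open>\<Omega>\<close>.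
\<close>

type_synonym point = "nat \<Rightarrow> real"
type_synonym cfun = "point \<Rightarrow> complex"

abbreviation eucl :: "nat \<Rightarrow> point topology" where
  "eucl d \<equiv> product_topology (\<lambda>_. euclideanreal) {..<d}"

definition leb_on :: "nat \<Rightarrow> point set \<Rightarrow> point measure" where
  "leb_on d \<Omega> = restrict_space (Pi\<^sub>M {..<d} (\<lambda>_. lborel)) \<Omega>"

definition csmult :: "complex \<Rightarrow> cfun \<Rightarrow> cfun" where
  "csmult c f = (\<lambda>x. c * f x)"

abbreviation csubspace :: "cfun set \<Rightarrow> bool" where
  "csubspace \<equiv> module.subspace csmult"

abbreviation cspan :: "cfun set \<Rightarrow> cfun set" where
  "cspan \<equiv> module.span csmult"


section \<open>The space \<open>L\<^sup>2\<close>\<close>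

definition L2 :: "nat \<Rightarrow> point set \<Rightarrow> cfun set" where
  "L2 d \<Omega> = {f \<in> borel_measurable (leb_on d \<Omega>). integrable (leb_on d \<Omega>) (\<lambda>x. (cmod (f x))\<^sup>2)}"

definition L2_inner :: "nat \<Rightarrow> point set \<Rightarrow> cfun \<Rightarrow> cfun \<Rightarrow> complex" where
  "L2_inner d \<Omega> f g = (\<integral>x. f x * cnj (g x) \<partial>leb_on d \<Omega>)"

definition L2_norm :: "nat \<Rightarrow> point set \<Rightarrow> cfun \<Rightarrow> real" where
  "L2_norm d \<Omega> f = sqrt (\<integral>x. (cmod (f x))\<^sup>2 \<partial>leb_on d \<Omega>)"

definition L2_dense :: "nat \<Rightarrow> point set \<Rightarrow> cfun set \<Rightarrow> bool" where
  "L2_dense d \<Omega> V \<longleftrightarrow>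
     V \<subseteq> L2 d \<Omega> \<and> (\<forall>f\<in>L2 d \<Omega>. \<forall>\<epsilon>>0. \<exists>g\<in>V. L2_norm d \<Omega> (f - g) < \<epsilon>)"


section \<open>Multiindices, test functions and weak derivatives\<close>

definition multiindices :: "nat \<Rightarrow> (nat \<Rightarrow> nat) set" where
  "multiindices d = {\<alpha>. \<forall>i\<ge>d. \<alpha> i = 0}"

definition mi_order :: "nat \<Rightarrow> (nat \<Rightarrow> nat) \<Rightarrow> nat" where
  "mi_order d \<alpha> = (\<Sum>i<d. \<alpha> i)"

definition mi_fact :: "nat \<Rightarrow> (nat \<Rightarrow> nat) \<Rightarrow> nat" where
  "mi_fact d \<alpha> = (\<Prod>i<d. fact (\<alpha> i))"

definition mi_unit :: "nat \<Rightarrow> nat \<Rightarrow> nat" where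
  "mi_unit k = (\<lambda>i. if i = k then 1 else 0)"

text \<open>Classical partial derivatives; they are meaningful for the smooth functions below.\<close>

definition partial_deriv :: "nat \<Rightarrow> cfun \<Rightarrow> cfun" where
  "partial_deriv k \<phi> = (\<lambda>x. vector_derivative (\<lambda>t. \<phi> (x(k := t))) (at (x k)))"

definition multi_deriv :: "nat \<Rightarrow> (nat \<Rightarrow> nat) \<Rightarrow> cfun \<Rightarrow> cfun" where
  "multi_deriv d \<alpha> \<phi> = foldr (\<lambda>i. partial_deriv i ^^ \<alpha> i) [0..<d] \<phi>"

text \<open>All iterated partial derivatives, in any order, exist and are continuous on \<open>\<real>\<^sup>d\<close>.\<close>

definition smooth :: "nat \<Rightarrow> cfun \<Rightarrow> bool" where
  "smooth d \<phi> \<longleftrightarrow>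
     (\<forall>ks. set ks \<subseteq> {..<d} \<longrightarrow>
        continuous_map (eucl d) euclidean (foldr partial_deriv ks \<phi>) \<and>
        (\<forall>x\<in>topspace (eucl d). \<forall>k<d.
           (\<lambda>t. foldr partial_deriv ks \<phi> (x(k := t))) differentiable (at (x k))))"

definition test_functions :: "nat \<Rightarrow> point set \<Rightarrow> cfun set" where
  "test_functions d \<Omega> =
     {\<phi>. smooth d \<phi> \<and>
         (\<exists>K. compactin (eucl d) K \<and> K \<subseteq> \<Omega> \<and> (\<forall>x\<in>topspace (eucl d) - K. \<phi> x = 0))}"

text \<open>Only weak derivatives in \<open>L\<^sup>2\<close> of functions in \<open>L\<^sup>2\<close> are needed.\<close>

definition has_weak_deriv :: "nat \<Rightarrow> point set \<Rightarrow> (nat \<Rightarrow> nat) \<Rightarrow> cfun \<Rightarrow> cfun \<Rightarrow> bool" where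
  "has_weak_deriv d \<Omega> \<alpha> f g \<longleftrightarrow>
     f \<in> L2 d \<Omega> \<and> g \<in> L2 d \<Omega> \<and>
     (\<forall>\<phi>\<in>test_functions d \<Omega>.
        (\<integral>x. f x * multi_deriv d \<alpha> \<phi> x \<partial>leb_on d \<Omega>)
          = (-1) ^ mi_order d \<alpha> * (\<integral>x. g x * \<phi> x \<partial>leb_on d \<Omega>))"

text \<open>A representative of the weak derivative, which is unique up to null sets.\<close>

definition weak_deriv :: "nat \<Rightarrow> point set \<Rightarrow> (nat \<Rightarrow> nat) \<Rightarrow> cfun \<Rightarrow> cfun" where
  "weak_deriv d \<Omega> \<alpha> f = (SOME g. has_weak_deriv d \<Omega> \<alpha> f g)"


section \<open>Sobolev spaces\<close>

definition sobolev :: "nat \<Rightarrow> nat \<Rightarrow> point set \<Rightarrow> cfun set" where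
  "sobolev m d \<Omega> =
     {f \<in> L2 d \<Omega>. \<forall>\<alpha>\<in>multiindices d. mi_order d \<alpha> \<le> m \<longrightarrow> (\<exists>g. has_weak_deriv d \<Omega> \<alpha> f g)}"

definition dirichlet_form :: "nat \<Rightarrow> point set \<Rightarrow> cfun \<Rightarrow> cfun \<Rightarrow> complex" where
  "dirichlet_form d \<Omega> f g =
     (\<Sum>k<d. L2_inner d \<Omega> (weak_deriv d \<Omega> (mi_unit k) f) (weak_deriv d \<Omega> (mi_unit k) g))"

definition H1_norm :: "nat \<Rightarrow> point set \<Rightarrow> cfun \<Rightarrow> real" where
  "H1_norm d \<Omega> f =
     sqrt ((L2_norm d \<Omega> f)\<^sup>2 + (\<Sum>k<d. (L2_norm d \<Omega> (weak_deriv d \<Omega> (mi_unit k) f))\<^sup>2))"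

definition H1_closure :: "nat \<Rightarrow> point set \<Rightarrow> cfun set \<Rightarrow> cfun set" where
  "H1_closure d \<Omega> V = {f \<in> sobolev 1 d \<Omega>. \<forall>\<epsilon>>0. \<exists>g\<in>V. H1_norm d \<Omega> (f - g) < \<epsilon>}"

text \<open>Closedness forces such a subspace to be saturated under equality almost everywhere.\<close>

definition closed_H1_subspace :: "nat \<Rightarrow> point set \<Rightarrow> cfun set \<Rightarrow> bool" where
  "closed_H1_subspace d \<Omega> V \<longleftrightarrow>
     csubspace V \<and> V \<subseteq> sobolev 1 d \<Omega> \<and> H1_closure d \<Omega> V \<subseteq> V"


section \<open>Unbounded operators on \<open>L\<^sup>2\<close>\<close>

text \<open>
  An operator is given by its domain \<open>D\<close> and a map \<open>A\<close>, whose values outside \<open>D\<close> are irrelevant.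
\<close>

definition densely_defined_operator ::
    "nat \<Rightarrow> point set \<Rightarrow> cfun set \<Rightarrow> (cfun \<Rightarrow> cfun) \<Rightarrow> bool" where
  "densely_defined_operator d \<Omega> D A \<longleftrightarrow>
     csubspace D \<and> L2_dense d \<Omega> D \<and> (\<forall>f\<in>D. A f \<in> L2 d \<Omega>) \<and>
     (\<forall>f\<in>D. \<forall>g\<in>D. \<forall>a b.
        AE x in leb_on d \<Omega>. A (csmult a f + csmult b g) x = a * A f x + b * A g x)"

definition op_graph :: "nat \<Rightarrow> point set \<Rightarrow> cfun set \<Rightarrow> (cfun \<Rightarrow> cfun) \<Rightarrow> (cfun \<times> cfun) set" where
  "op_graph d \<Omega> D A = {(f, h). f \<in> D \<and> h \<in> L2 d \<Omega> \<and> (AE x in leb_on d \<Omega>. A f x = h x)}"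

definition adjoint_graph ::
    "nat \<Rightarrow> point set \<Rightarrow> cfun set \<Rightarrow> (cfun \<Rightarrow> cfun) \<Rightarrow> (cfun \<times> cfun) set" where
  "adjoint_graph d \<Omega> D A =
     {(f, h). f \<in> L2 d \<Omega> \<and> h \<in> L2 d \<Omega> \<and> (\<forall>u\<in>D. L2_inner d \<Omega> (A u) f = L2_inner d \<Omega> u h)}"

definition self_adjoint :: "nat \<Rightarrow> point set \<Rightarrow> cfun set \<Rightarrow> (cfun \<Rightarrow> cfun) \<Rightarrow> bool" where
  "self_adjoint d \<Omega> D A \<longleftrightarrow>
     densely_defined_operator d \<Omega> D A \<and> op_graph d \<Omega> D A = adjoint_graph d \<Omega> D A"

definition nonnegative :: "nat \<Rightarrow> point set \<Rightarrow> cfun set \<Rightarrow> (cfun \<Rightarrow> cfun) \<Rightarrow> bool" where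
  "nonnegative d \<Omega> D A \<longleftrightarrow>
     (\<forall>f\<in>D. Im (L2_inner d \<Omega> (A f) f) = 0 \<and> 0 \<le> Re (L2_inner d \<Omega> (A f) f))"

text \<open>
  The operator associated with the form \<open>dirichlet_form\<close> on the form domain \<open>V\<close>. For \<open>V\<close> closed
  in \<open>H\<^sup>1\<close> and dense in \<open>L\<^sup>2\<close>, it exists and is unique by the representation theorem for forms.
\<close>

definition form_operator ::
    "nat \<Rightarrow> point set \<Rightarrow> cfun set \<Rightarrow> cfun set \<Rightarrow> (cfun \<Rightarrow> cfun) \<Rightarrow> bool" where
  "form_operator d \<Omega> V D A \<longleftrightarrow>
     self_adjoint d \<Omega> D A \<and> nonnegative d \<Omega> D A \<and> D \<subseteq> V \<and>
     (\<forall>u\<in>D. \<forall>v\<in>V. dirichlet_form d \<Omega> u v = L2_inner d \<Omega> (A u) v)"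

definition laplacian ::
    "nat \<Rightarrow> point set \<Rightarrow> cfun set \<Rightarrow> cfun set \<Rightarrow> (cfun \<Rightarrow> cfun) \<Rightarrow> bool" where
  "laplacian d \<Omega> V D \<Delta> \<longleftrightarrow> form_operator d \<Omega> V D (\<lambda>u. - \<Delta> u)"


section \<open>Products\<close>

definition total_dim :: "nat \<Rightarrow> (nat \<Rightarrow> nat) \<Rightarrow> nat" where
  "total_dim n d = (\<Sum>j<n. d j)"

text \<open>
  The component \<open>x\<^sub>j \<in> \<real>\<^bsup>d j\<^esup>\<close> of \<open>x\<close>: the factors occupy consecutive blocks of coordinates.
\<close>

definition block :: "(nat \<Rightarrow> nat) \<Rightarrow> nat \<Rightarrow> point \<Rightarrow> point" where
  "block d j x = (\<lambda>i\<in>{..<d j}. x ((\<Sum>l<j. d l) + i))"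

definition product_domain :: "nat \<Rightarrow> (nat \<Rightarrow> nat) \<Rightarrow> (nat \<Rightarrow> point set) \<Rightarrow> point set" where
  "product_domain n d \<Omega> = {x \<in> topspace (eucl (total_dim n d)). \<forall>j<n. block d j x \<in> \<Omega> j}"

definition elem_tensor :: "nat \<Rightarrow> (nat \<Rightarrow> nat) \<Rightarrow> (nat \<Rightarrow> cfun) \<Rightarrow> cfun" where
  "elem_tensor n d f = (\<lambda>x. \<Prod>j<n. f j (block d j x))"

definition tensor_space ::
    "nat \<Rightarrow> (nat \<Rightarrow> nat) \<Rightarrow> (nat \<Rightarrow> point set) \<Rightarrow> (nat \<Rightarrow> cfun set) \<Rightarrow> cfun set" where
  "tensor_space n d \<Omega> H =
     H1_closure (total_dim n d) (product_domain n d \<Omega>)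
       (cspan {elem_tensor n d f | f. \<forall>j<n. f j \<in> H j})"

end

theory Submission
  imports Defs "HOL-Computational_Algebra.Polynomial"
begin

text \<open>
  Write \<open>A\<^sub>j = - \<Delta>\<^sub>j\<close>. On a tensor \<open>u\<close> of functions \<open>u\<^sub>j \<in> Dom A\<^sub>j\<close>, self-adjointness of \<open>T\<close> gives
  \<open>T u = \<Sum>\<^sub>j A\<^sub>j u\<close>. Second derivatives within one factor are handled by the hypothesis, mixed ones by
  \<open>\<Sum>\<^sub>k\<^sub>l \<langle>\<partial>\<^sub>k\<partial>\<^sub>l u, \<partial>\<^sub>k\<partial>\<^sub>l v\<rangle> = \<langle>A\<^sub>i u, A\<^sub>j v\<rangle>\<close> for \<open>i \<noteq> j\<close>, so the identity holds on the span of such tensors.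

  It remains to see that this span is a core, that is, that \<open>h = 0\<close> whenever \<open>h\<close> is orthogonal to all
  \<open>(T + 1) u\<close>. Put \<open>W = \<Prod>\<^sub>j (1 + A\<^sub>j) = \<Sum>\<^sub>S A\<^sub>S\<close>, where \<open>A\<^sub>S = \<Prod>\<^sub>j\<^sub>\<in>\<^sub>S A\<^sub>j\<close>. The range of \<open>W\<close> is dense because each
  \<open>1 + A\<^sub>j\<close> has dense range, and all \<open>\<langle>A\<^sub>S u, A\<^sub>R u\<rangle>\<close> are nonnegative, being sums of squares of norms of
  derivatives. As \<open>T + 1\<close> is the part of \<open>W\<close> with at most one factor \<open>A\<^sub>j\<close>, this yields
  \<open>\<parallel>u\<parallel>\<^sup>2 \<le> Re \<langle>(T + 1) u, W u\<rangle>\<close> and \<open>\<parallel>(T + 1) u\<parallel> \<le> \<parallel>W u\<parallel>\<close>. If \<open>W u\<^sub>m\<close> tends to \<open>h\<close>, then \<open>u\<^sub>m\<close> tends to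
  \<open>0\<close>, and \<open>\<langle>h, v\<rangle> = lim \<langle>W u\<^sub>m, v\<rangle> = lim \<langle>u\<^sub>m, W v\<rangle> = 0\<close> for all tensors \<open>v\<close> of elements of the domains.
\<close>

section \<open>The Hilbert space structure of \<open>L\<^sup>2\<close>\<close>

text \<open>The obstacle is that \<open>T + 1\<close> turns a tensor into a sum of tensors, so
  density of its range cannot be checked factor by factor. \<open>W\<close> is chosen because it
  sends a tensor to the single tensor of the functions \<open>(1 + A\<^sub>j) u\<^sub>j\<close>;
  density of its range is then a matter of each factor alone. The signs of
  \<open>\<langle>A\<^sub>S u, A\<^sub>R u\<rangle>\<close> are needed for linear combinations of
  tensors, where positivity factor by factor is not enough. What survives is the Gram structure: if
  \<open>S\<close> and \<open>R\<close> differ at \<open>j\<close>, the form identity replaces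
  \<open>\<langle>A\<^sub>j u\<^sub>j, v\<^sub>j\<rangle>\<close> by a sum over derivatives, and
  products of Gram matrices are again Gram matrices. That \<open>u\<^sub>m\<close> tends to
  \<open>0\<close> is the decisive use of orthogonality: it allows \<open>W u\<close> to be replaced
  by \<open>W u - h\<close> in the inner product with \<open>(T + 1) u\<close>, and the two bounds
  combine to \<open>\<parallel>u\<parallel>\<^sup>2 \<le> \<parallel>W u\<parallel> \<parallel>W u -
  h\<parallel>\<close>. A core suffices because the identity at \<open>f = g\<close> bounds every
  second derivative by \<open>T f\<close>. Approximation in the graph norm thus makes second
  derivatives Cauchy, and weak derivatives are closed under such limits.\<close>

interpretation cfun: module csmult
  by unfold_locales (auto simp: csmult_def fun_eq_iff algebra_simps)

lemma csmult_apply [simp]: "csmult c f x = c * f x"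
  by (simp add: csmult_def)

lemma sum_cfun_apply [simp]: "(sum f I :: cfun) x = (\<Sum>i\<in>I. f i x)"
  by (induction I rule: infinite_finite_induct) auto

lemma L2_measurable [measurable_dest]: "f \<in> L2 d \<Omega> \<Longrightarrow> f \<in> borel_measurable (leb_on d \<Omega>)"
  by (simp add: L2_def)

lemma L2_square_integrable: "f \<in> L2 d \<Omega> \<Longrightarrow> integrable (leb_on d \<Omega>) (\<lambda>x. (cmod (f x))\<^sup>2)"
  by (simp add: L2_def)

lemma cmod_mult_le_squares: "cmod (a * b) \<le> (cmod a)\<^sup>2 + (cmod b)\<^sup>2"
proof -
  have "0 \<le> (cmod a - cmod b)\<^sup>2" "0 \<le> (cmod a)\<^sup>2" "0 \<le> (cmod b)\<^sup>2" by auto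
  then show ?thesis unfolding power2_diff norm_mult by linarith
qed

lemma L2_integrable_mult:
  assumes "f \<in> L2 d \<Omega>" "g \<in> L2 d \<Omega>"
  shows "integrable (leb_on d \<Omega>) (\<lambda>x. f x * g x)"
proof (rule Bochner_Integration.integrable_bound)
  show "integrable (leb_on d \<Omega>) (\<lambda>x. (cmod (f x))\<^sup>2 + (cmod (g x))\<^sup>2)"
    using assms by (auto simp: L2_def)
  show "(\<lambda>x. f x * g x) \<in> borel_measurable (leb_on d \<Omega>)"
    using assms[THEN L2_measurable] by measurable
  show "AE x in leb_on d \<Omega>. norm (f x * g x) \<le> norm ((cmod (f x))\<^sup>2 + (cmod (g x))\<^sup>2)"
    using cmod_mult_le_squares by (auto simp: order_trans)
qed

lemma L2_cnj: "f \<in> L2 d \<Omega> \<Longrightarrow> (\<lambda>x. cnj (f x)) \<in> L2 d \<Omega>"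
  by (auto simp: L2_def intro!: borel_measurable_continuous_on[of cnj] continuous_intros)

lemma L2_integrable_inner:
  "f \<in> L2 d \<Omega> \<Longrightarrow> g \<in> L2 d \<Omega> \<Longrightarrow> integrable (leb_on d \<Omega>) (\<lambda>x. f x * cnj (g x))"
  using L2_integrable_mult[OF _ L2_cnj] .

lemma L2_bounded:
  assumes "g \<in> borel_measurable (leb_on d \<Omega>)" "f \<in> L2 d \<Omega>"
    and "\<And>x. x \<in> space (leb_on d \<Omega>) \<Longrightarrow> cmod (g x) \<le> cmod (f x)"
  shows "g \<in> L2 d \<Omega>"
  unfolding L2_def
proof safe
  show "integrable (leb_on d \<Omega>) (\<lambda>x. (cmod (g x))\<^sup>2)"
  proof (rule Bochner_Integration.integrable_bound[OF L2_square_integrable[OF assms(2)]])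
    show "AE x in leb_on d \<Omega>. norm ((cmod (g x))\<^sup>2) \<le> norm ((cmod (f x))\<^sup>2)"
      using assms(3) by (auto intro: power_mono)
  qed (use assms(1) in measurable)
qed fact

lemma L2_zero: "0 \<in> L2 d \<Omega>"
  unfolding L2_def zero_fun_def by simp

lemma L2_csmult: "f \<in> L2 d \<Omega> \<Longrightarrow> csmult c f \<in> L2 d \<Omega>"
  unfolding L2_def by (auto simp: norm_mult power_mult_distrib csmult_def)

lemma cmod_add_square_le: "(cmod (a + b))\<^sup>2 \<le> 2 * (cmod a)\<^sup>2 + 2 * (cmod b)\<^sup>2"
proof -
  have "(cmod (a + b))\<^sup>2 \<le> (cmod a + cmod b)\<^sup>2"
    by (intro power_mono norm_triangle_ineq) auto
  also have "\<dots> \<le> 2 * (cmod a)\<^sup>2 + 2 * (cmod b)\<^sup>2"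
    using sum_squares_ge_zero[of "cmod a - cmod b" 0] by (simp add: power2_eq_square algebra_simps)
  finally show ?thesis .
qed

lemma L2_add:
  assumes "f \<in> L2 d \<Omega>" "g \<in> L2 d \<Omega>"
  shows "f + g \<in> L2 d \<Omega>"
  unfolding L2_def
proof safe
  show m: "f + g \<in> borel_measurable (leb_on d \<Omega>)"
    using assms[THEN L2_measurable] unfolding plus_fun_def by measurable
  show "integrable (leb_on d \<Omega>) (\<lambda>x. (cmod ((f + g) x))\<^sup>2)"
  proof (rule Bochner_Integration.integrable_bound)
    show "integrable (leb_on d \<Omega>) (\<lambda>x. 2 * (cmod (f x))\<^sup>2 + 2 * (cmod (g x))\<^sup>2)"
      using assms by (auto simp: L2_def)
    show "AE x in leb_on d \<Omega>. norm ((cmod ((f + g) x))\<^sup>2)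
        \<le> norm (2 * (cmod (f x))\<^sup>2 + 2 * (cmod (g x))\<^sup>2)"
      using cmod_add_square_le by auto
  qed (use m in measurable)
qed

lemma diff_eq_csmult: "f - g = f + csmult (-1) (g :: cfun)"
  by (auto simp: fun_eq_iff)

lemma uminus_eq_csmult: "- g = csmult (-1) (g :: cfun)"
  by (auto simp: fun_eq_iff)

lemma L2_diff: "f \<in> L2 d \<Omega> \<Longrightarrow> g \<in> L2 d \<Omega> \<Longrightarrow> f - g \<in> L2 d \<Omega>"
  unfolding diff_eq_csmult by (intro L2_add L2_csmult)

lemma L2_uminus: "g \<in> L2 d \<Omega> \<Longrightarrow> - g \<in> L2 d \<Omega>"
  unfolding uminus_eq_csmult by (intro L2_csmult)

lemma L2_sum: "(\<And>i. i \<in> I \<Longrightarrow> f i \<in> L2 d \<Omega>) \<Longrightarrow> sum f I \<in> L2 d \<Omega>"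
  by (induction I rule: infinite_finite_induct) (auto intro: L2_zero L2_add)

lemmas L2_intros = L2_zero L2_csmult L2_add L2_diff L2_uminus L2_sum

lemma L2_inner_cong_AE:
  assumes "AE x in leb_on d \<Omega>. f x = f' x" "AE x in leb_on d \<Omega>. g x = g' x"
    and "f \<in> L2 d \<Omega>" "g \<in> L2 d \<Omega>" "f' \<in> L2 d \<Omega>" "g' \<in> L2 d \<Omega>"
  shows "L2_inner d \<Omega> f g = L2_inner d \<Omega> f' g'"
  unfolding L2_inner_def
proof (rule integral_cong_AE)
  show "AE x in leb_on d \<Omega>. f x * cnj (g x) = f' x * cnj (g' x)"
    using assms(1,2) by eventually_elim simp
qed (use assms in \<open>auto dest: L2_integrable_inner[THEN borel_measurable_integrable]\<close>)

lemma L2_norm_cong_AE: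
  assumes "AE x in leb_on d \<Omega>. f x = g x" "f \<in> L2 d \<Omega>" "g \<in> L2 d \<Omega>"
  shows "L2_norm d \<Omega> f = L2_norm d \<Omega> g"
proof -
  have "(\<integral>x. (cmod (f x))\<^sup>2 \<partial>leb_on d \<Omega>) = (\<integral>x. (cmod (g x))\<^sup>2 \<partial>leb_on d \<Omega>)"
    by (rule integral_cong_AE) (use assms in \<open>auto dest: L2_square_integrable\<close>)
  then show ?thesis by (simp add: L2_norm_def)
qed

lemma L2_inner_add_left:
  "f \<in> L2 d \<Omega> \<Longrightarrow> g \<in> L2 d \<Omega> \<Longrightarrow> h \<in> L2 d \<Omega> \<Longrightarrow>
    L2_inner d \<Omega> (f + g) h = L2_inner d \<Omega> f h + L2_inner d \<Omega> g h"
  unfolding L2_inner_def by (simp add: distrib_right L2_integrable_inner)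

lemma L2_inner_csmult_left: "L2_inner d \<Omega> (csmult c f) h = c * L2_inner d \<Omega> f h"
  unfolding L2_inner_def by (simp add: mult.assoc)

lemma L2_inner_commute: "L2_inner d \<Omega> g f = cnj (L2_inner d \<Omega> f g)"
  unfolding L2_inner_def
  by (subst Bochner_Integration.integral_cnj[of "leb_on d \<Omega>" "\<lambda>x. f x * cnj (g x)", symmetric]) (simp add: mult.commute)

lemma L2_inner_add_right:
  "f \<in> L2 d \<Omega> \<Longrightarrow> g \<in> L2 d \<Omega> \<Longrightarrow> h \<in> L2 d \<Omega> \<Longrightarrow>
    L2_inner d \<Omega> h (f + g) = L2_inner d \<Omega> h f + L2_inner d \<Omega> h g"
  unfolding L2_inner_def by (simp add: distrib_left L2_integrable_inner)

lemma L2_inner_csmult_right: "L2_inner d \<Omega> h (csmult c f) = cnj c * L2_inner d \<Omega> h f"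
  unfolding L2_inner_def by (simp add: mult_ac)

lemma L2_inner_diff_left:
  "f \<in> L2 d \<Omega> \<Longrightarrow> g \<in> L2 d \<Omega> \<Longrightarrow> h \<in> L2 d \<Omega> \<Longrightarrow>
    L2_inner d \<Omega> (f - g) h = L2_inner d \<Omega> f h - L2_inner d \<Omega> g h"
  by (simp only: diff_eq_csmult L2_inner_add_left L2_inner_csmult_left L2_intros) simp

lemma L2_inner_diff_right:
  "f \<in> L2 d \<Omega> \<Longrightarrow> g \<in> L2 d \<Omega> \<Longrightarrow> h \<in> L2 d \<Omega> \<Longrightarrow>
    L2_inner d \<Omega> h (f - g) = L2_inner d \<Omega> h f - L2_inner d \<Omega> h g"
  by (simp only: diff_eq_csmult L2_inner_add_right L2_inner_csmult_right L2_intros) simp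

lemma L2_inner_uminus_left: "L2_inner d \<Omega> (- f) g = - L2_inner d \<Omega> f g"
  by (simp only: uminus_eq_csmult L2_inner_csmult_left) simp

lemma L2_inner_uminus_right: "L2_inner d \<Omega> f (- g) = - L2_inner d \<Omega> f g"
  by (simp only: uminus_eq_csmult L2_inner_csmult_right) simp

lemma L2_inner_zero [simp]: "L2_inner d \<Omega> 0 f = 0" "L2_inner d \<Omega> f 0 = 0"
  by (simp_all add: L2_inner_def)

lemma L2_inner_sum_left:
  "(\<And>i. i \<in> I \<Longrightarrow> f i \<in> L2 d \<Omega>) \<Longrightarrow> h \<in> L2 d \<Omega> \<Longrightarrow>
    L2_inner d \<Omega> (sum f I) h = (\<Sum>i\<in>I. L2_inner d \<Omega> (f i) h)"
  by (induction I rule: infinite_finite_induct) (auto simp: L2_inner_add_left L2_sum)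

lemma L2_inner_sum_right:
  "(\<And>i. i \<in> I \<Longrightarrow> f i \<in> L2 d \<Omega>) \<Longrightarrow> h \<in> L2 d \<Omega> \<Longrightarrow>
    L2_inner d \<Omega> h (sum f I) = (\<Sum>i\<in>I. L2_inner d \<Omega> h (f i))"
  by (induction I rule: infinite_finite_induct) (auto simp: L2_inner_add_right L2_sum)

lemmas L2_inner_simps = L2_inner_add_left L2_inner_add_right L2_inner_diff_left L2_inner_diff_right
  L2_inner_csmult_left L2_inner_csmult_right L2_inner_uminus_left L2_inner_uminus_right

section \<open>The norm: Cauchy-Schwarz, triangle inequality, parallelogram law\<close>

lemma L2_norm_ge_0 [simp]: "0 \<le> L2_norm d \<Omega> f"
  by (simp add: L2_norm_def)

lemma L2_norm_square: "(L2_norm d \<Omega> f)\<^sup>2 = (\<integral>x. (cmod (f x))\<^sup>2 \<partial>leb_on d \<Omega>)"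
  by (simp add: L2_norm_def)

lemma L2_inner_self: "L2_inner d \<Omega> f f = of_real ((L2_norm d \<Omega> f)\<^sup>2)"
  unfolding L2_norm_square L2_inner_def
  by (simp only: complex_norm_square[symmetric] integral_complex_of_real)

lemma L2_norm_square_Re: "(L2_norm d \<Omega> f)\<^sup>2 = Re (L2_inner d \<Omega> f f)"
  by (simp add: L2_inner_self)

lemma L2_norm_csmult: "L2_norm d \<Omega> (csmult c f) = cmod c * L2_norm d \<Omega> f"
  by (simp add: L2_norm_def norm_mult power_mult_distrib real_sqrt_mult)

text \<open>One expansion serves four times: with the projection coefficient it gives
  Cauchy-Schwarz, with \<open>c = -1\<close> the norm of a sum, with \<open>c = 1\<close> one half
  of the parallelogram law, and with a small coefficient the orthogonality of the remainder at a
  nearest point.\<close>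

lemma L2_norm_square_diff_csmult:
  assumes "f \<in> L2 d \<Omega>" "g \<in> L2 d \<Omega>"
  shows "(L2_norm d \<Omega> (f - csmult c g))\<^sup>2
    = (L2_norm d \<Omega> f)\<^sup>2 - 2 * Re (cnj c * L2_inner d \<Omega> f g) + (cmod c)\<^sup>2 * (L2_norm d \<Omega> g)\<^sup>2"
proof -
  have "L2_inner d \<Omega> (f - csmult c g) (f - csmult c g)
      = L2_inner d \<Omega> f f - cnj c * L2_inner d \<Omega> f g - c * cnj (L2_inner d \<Omega> f g)
        + c * cnj c * L2_inner d \<Omega> g g"
    using assms L2_inner_commute[of d \<Omega> g f]
    by (simp add: L2_inner_simps L2_intros algebra_simps)
  from arg_cong[OF this, of Re] show ?thesis
    by (simp add: L2_inner_self complex_norm_square[symmetric] flip: of_real_mult)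
qed

lemma L2_norm_zero_AE:
  assumes "f \<in> L2 d \<Omega>" "L2_norm d \<Omega> f = 0"
  shows "AE x in leb_on d \<Omega>. f x = 0"
proof -
  have "(\<integral>x. (cmod (f x))\<^sup>2 \<partial>leb_on d \<Omega>) = 0"
    using assms(2) L2_norm_square[of d \<Omega> f] by simp
  then have "AE x in leb_on d \<Omega>. (cmod (f x))\<^sup>2 = 0"
    using integral_nonneg_eq_0_iff_AE[OF L2_square_integrable[OF assms(1)]] by simp
  then show ?thesis by simp
qed

lemma L2_norm_AE_zero:
  assumes "AE x in leb_on d \<Omega>. f x = 0"
  shows "L2_norm d \<Omega> f = 0"
proof -
  have "(\<integral>x. (cmod (f x))\<^sup>2 \<partial>leb_on d \<Omega>) = 0"
    by (rule integral_eq_zero_AE) (use assms in eventually_elim, simp)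
  then show ?thesis by (simp add: L2_norm_def)
qed

lemma L2_Cauchy_Schwarz:
  assumes "f \<in> L2 d \<Omega>" "g \<in> L2 d \<Omega>"
  shows "cmod (L2_inner d \<Omega> f g) \<le> L2_norm d \<Omega> f * L2_norm d \<Omega> g"
proof (cases "L2_norm d \<Omega> g = 0")
  case True
  then have "AE x in leb_on d \<Omega>. g x = 0" using L2_norm_zero_AE assms by auto
  then have "L2_inner d \<Omega> f g = 0"
    unfolding L2_inner_def by (intro integral_eq_zero_AE) (elim eventually_mono, simp)
  then show ?thesis using True by simp
next
  case False
  define N where "N = (L2_norm d \<Omega> g)\<^sup>2"
  define z where "z = L2_inner d \<Omega> f g"
  have N: "N > 0" using False by (simp add: N_def)
  \<comment> \<open>\<open>z / N\<close> is the coefficient of the orthogonal projection of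
    \<open>f\<close> onto the line through \<open>g\<close>, the value that minimises this
    norm.\<close>
  have "0 \<le> (L2_norm d \<Omega> (f - csmult (z / N) g))\<^sup>2" by simp
  also have "\<dots> = (L2_norm d \<Omega> f)\<^sup>2 - 2 * Re (cnj (z / N) * z) + (cmod (z / N))\<^sup>2 * N"
    by (simp only: N_def z_def L2_norm_square_diff_csmult[OF assms])
  also have "cnj (z / N) * z = complex_of_real ((cmod z)\<^sup>2 / N)"
    unfolding of_real_divide complex_norm_square by simp
  also have "(cmod (z / N))\<^sup>2 * N = (cmod z)\<^sup>2 / N"
    using N by (simp add: norm_divide power_divide power2_eq_square)
  finally have "(cmod z)\<^sup>2 / N \<le> (L2_norm d \<Omega> f)\<^sup>2"
    by (simp only: Re_complex_of_real)
  then have "(cmod z)\<^sup>2 \<le> (L2_norm d \<Omega> f * L2_norm d \<Omega> g)\<^sup>2"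
    using N by (simp add: divide_le_eq N_def power_mult_distrib)
  then show ?thesis unfolding z_def by (rule power2_le_imp_le) simp
qed

lemma L2_norm_square_add:
  assumes "f \<in> L2 d \<Omega>" "g \<in> L2 d \<Omega>"
  shows "(L2_norm d \<Omega> (f + g))\<^sup>2
    = (L2_norm d \<Omega> f)\<^sup>2 + 2 * Re (L2_inner d \<Omega> f g) + (L2_norm d \<Omega> g)\<^sup>2"
proof -
  have "f - csmult (-1) g = f + g" by (simp add: fun_eq_iff)
  with L2_norm_square_diff_csmult[OF assms, of "-1"] show ?thesis by simp
qed

lemma L2_triangle:
  assumes "f \<in> L2 d \<Omega>" "g \<in> L2 d \<Omega>"
  shows "L2_norm d \<Omega> (f + g) \<le> L2_norm d \<Omega> f + L2_norm d \<Omega> g"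
proof (rule power2_le_imp_le)
  have "Re (L2_inner d \<Omega> f g) \<le> L2_norm d \<Omega> f * L2_norm d \<Omega> g"
    using L2_Cauchy_Schwarz[OF assms] complex_Re_le_cmod order_trans by blast
  then show "(L2_norm d \<Omega> (f + g))\<^sup>2 \<le> (L2_norm d \<Omega> f + L2_norm d \<Omega> g)\<^sup>2"
    by (simp add: L2_norm_square_add[OF assms] power2_sum)
qed simp

lemma L2_norm_minus_commute: "L2_norm d \<Omega> (f - g) = L2_norm d \<Omega> (g - f)"
  by (simp add: L2_norm_def norm_minus_commute)

lemma L2_triangle_diff:
  assumes "f \<in> L2 d \<Omega>" "g \<in> L2 d \<Omega>" "h \<in> L2 d \<Omega>"
  shows "L2_norm d \<Omega> (f - g) \<le> L2_norm d \<Omega> (f - h) + L2_norm d \<Omega> (h - g)"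
  using L2_triangle[of "f - h" d \<Omega> "h - g"] assms by (simp add: L2_intros)

lemma L2_norm_diff_bound:
  assumes "f \<in> L2 d \<Omega>" "g \<in> L2 d \<Omega>"
  shows "\<bar>L2_norm d \<Omega> f - L2_norm d \<Omega> g\<bar> \<le> L2_norm d \<Omega> (f - g)"
  using L2_triangle[of "f - g" d \<Omega> g] L2_triangle[of "g - f" d \<Omega> f] L2_norm_minus_commute[of d \<Omega> f g]
    assms by (simp add: L2_intros)

lemma L2_parallelogram:
  assumes "f \<in> L2 d \<Omega>" "g \<in> L2 d \<Omega>"
  shows "(L2_norm d \<Omega> (f + g))\<^sup>2 + (L2_norm d \<Omega> (f - g))\<^sup>2
    = 2 * (L2_norm d \<Omega> f)\<^sup>2 + 2 * (L2_norm d \<Omega> g)\<^sup>2"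
  using L2_norm_square_diff_csmult[OF assms, of 1] L2_norm_square_add[OF assms]
  by (simp add: csmult_def)

lemma L2_inner_tendsto:
  assumes "\<And>n. f n \<in> L2 d \<Omega>" "\<And>n. g n \<in> L2 d \<Omega>" "f' \<in> L2 d \<Omega>" "g' \<in> L2 d \<Omega>"
    and f: "(\<lambda>n. L2_norm d \<Omega> (f n - f')) \<longlonglongrightarrow> 0" and g: "(\<lambda>n. L2_norm d \<Omega> (g n - g')) \<longlonglongrightarrow> 0"
  shows "(\<lambda>n. L2_inner d \<Omega> (f n) (g n)) \<longlonglongrightarrow> L2_inner d \<Omega> f' g'"
proof (rule LIM_zero_cancel, rule Lim_null_comparison)
  let ?N = "L2_norm d \<Omega>"
  show "\<forall>\<^sub>F n in sequentially. norm (L2_inner d \<Omega> (f n) (g n) - L2_inner d \<Omega> f' g')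
    \<le> ?N (f n - f') * ?N (g n - g') + ?N (f n - f') * ?N g' + ?N f' * ?N (g n - g')"
  proof (intro always_eventually allI)
    fix n
    have d: "f n - f' \<in> L2 d \<Omega>" "g n - g' \<in> L2 d \<Omega>"
      using L2_diff[OF assms(1,3)] L2_diff[OF assms(2,4)] by auto
    have "L2_inner d \<Omega> (f n) (g n) - L2_inner d \<Omega> f' g' = L2_inner d \<Omega> (f n - f') (g n - g')
      + L2_inner d \<Omega> (f n - f') g' + L2_inner d \<Omega> f' (g n - g')" (is "?l = ?a + ?b + ?c")
      by (simp only: L2_inner_diff_left L2_inner_diff_right assms d) simp
    then have "norm ?l \<le> norm ?a + norm ?b + norm ?c"
      using norm_triangle_ineq[of "?a + ?b" ?c] norm_triangle_ineq[of ?a ?b] by simp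
    then show "norm ?l
      \<le> ?N (f n - f') * ?N (g n - g') + ?N (f n - f') * ?N g' + ?N f' * ?N (g n - g')"
      using L2_Cauchy_Schwarz[OF d] L2_Cauchy_Schwarz[OF d(1) assms(4)] L2_Cauchy_Schwarz[OF assms(3) d(2)]
      by linarith
  qed
  show "(\<lambda>n. ?N (f n - f') * ?N (g n - g') + ?N (f n - f') * ?N g' + ?N f' * ?N (g n - g')) \<longlonglongrightarrow> 0"
    using tendsto_add[OF tendsto_add[OF tendsto_mult[OF f g] tendsto_mult[OF f tendsto_const]]
        tendsto_mult[OF tendsto_const g]] by simp
qed

section \<open>Completeness\<close>

lemma nn_integral_cmod_square:
  assumes "f \<in> L2 d \<Omega>"
  shows "(\<integral>\<^sup>+x. ennreal ((cmod (f x))\<^sup>2) \<partial>leb_on d \<Omega>) = ennreal ((L2_norm d \<Omega> f)\<^sup>2)"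
  unfolding L2_norm_square
  by (rule nn_integral_eq_integral[OF L2_square_integrable[OF assms]]) simp

text \<open>
  Weighting the squared increments by \<open>4\<^sup>k\<close> makes completeness of \<open>L\<^sup>2\<close> follow from monotone convergence of
  integrals of series, without Minkowski's inequality for infinite sums.
\<close>

lemma convergent_if_weighted_square_sum:
  fixes g :: "nat \<Rightarrow> complex"
  assumes fin: "(\<Sum>k. ennreal (4 ^ k * (cmod (g (Suc k) - g k))\<^sup>2)) \<noteq> \<infinity>"
  shows "convergent g"
proof -
  define S where "S = (\<Sum>k. ennreal (4 ^ k * (cmod (g (Suc k) - g k))\<^sup>2))"
  have S: "S = ennreal (enn2real S)"
    using fin unfolding S_def[symmetric] by (cases S rule: ennreal_cases) auto
  have bound: "4 ^ k * (cmod (g (Suc k) - g k))\<^sup>2 \<le> enn2real S" for k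
  proof -
    have "(\<Sum>k\<in>{k}. ennreal (4 ^ k * (cmod (g (Suc k) - g k))\<^sup>2)) \<le> S"
      unfolding S_def by (rule sum_le_suminf) auto
    then have "ennreal (4 ^ k * (cmod (g (Suc k) - g k))\<^sup>2) \<le> ennreal (enn2real S)"
      unfolding S[symmetric] by simp
    then show ?thesis by (subst (asm) ennreal_le_iff) auto
  qed
  have "summable (\<lambda>k. g (Suc k) - g k)"
  proof (rule summable_comparison_test')
    show "summable (\<lambda>k. sqrt (enn2real S) * (1 / 2) ^ k)"
      by (intro summable_mult summable_geometric) simp
    fix k :: nat
    have "2 ^ k * cmod (g (Suc k) - g k) = sqrt (4 ^ k * (cmod (g (Suc k) - g k))\<^sup>2)"
      by (simp add: real_sqrt_mult real_sqrt_power)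
    also have "\<dots> \<le> sqrt (enn2real S)" using bound by simp
    finally show "norm (g (Suc k) - g k) \<le> sqrt (enn2real S) * (1 / 2) ^ k"
      by (simp add: power_divide divide_simps mult_ac)
  qed
  then have "convergent (\<lambda>n. \<Sum>k<n. g (Suc k) - g k)"
    by (simp add: summable_iff_convergent)
  then have "convergent (\<lambda>n. g n - g 0)" by (simp add: sum_lessThan_telescope)
  then have "convergent (\<lambda>n. (g n - g 0) + g 0)" by (intro convergent_add convergent_const)
  then show ?thesis by simp
qed

lemma L2_complete:
  assumes F: "\<And>n. F n \<in> L2 d \<Omega>"
    and C: "\<And>e. e > 0 \<Longrightarrow> \<exists>N. \<forall>m\<ge>N. \<forall>n\<ge>N. L2_norm d \<Omega> (F m - F n) < e"
  obtains f where "f \<in> L2 d \<Omega>" "(\<lambda>n. L2_norm d \<Omega> (F n - f)) \<longlonglongrightarrow> 0"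
proof -
  let ?M = "leb_on d \<Omega>"
  have "\<forall>k. \<exists>N. \<forall>m\<ge>N. \<forall>n\<ge>N. L2_norm d \<Omega> (F m - F n) < (1 / 4) ^ k"
    using C by simp
  then obtain N where N: "\<And>k m n. m \<ge> N k \<Longrightarrow> n \<ge> N k \<Longrightarrow> L2_norm d \<Omega> (F m - F n) < (1 / 4) ^ k"
    by metis
  \<comment> \<open>The maximum over all earlier thresholds gives \<open>N k \<le> r m\<close>
    whenever \<open>k \<le> m\<close>, so all later terms of the subsequence stay within
    \<open>(1 / 4) ^ k\<close> of \<open>G k\<close>.\<close>
  define r where "r k = Max (N ` {..k})" for k
  have r: "N k \<le> r m" if "k \<le> m" for k m
    unfolding r_def using that by (intro Max_ge) auto
  define G where "G k = F (r k)" for k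
  have GL[simp]: "G k \<in> L2 d \<Omega>" for k using F by (simp add: G_def)
  have Gm [measurable]: "G k \<in> borel_measurable ?M" for k using L2_measurable[OF GL] .
  have [measurable]: "G m - G k \<in> borel_measurable ?M" for m k
    using L2_measurable[OF L2_diff[OF GL GL]] .
  have G: "L2_norm d \<Omega> (G m - G k) < (1 / 4) ^ k" if "k \<le> m" for k m
    unfolding G_def using that by (intro N r) auto
  have AE: "AE x in ?M. (\<Sum>k. ennreal (4 ^ k * (cmod ((G (Suc k) - G k) x))\<^sup>2)) \<noteq> \<infinity>"
  proof (rule nn_integral_PInf_AE)
    have "(\<integral>\<^sup>+x. (\<Sum>k. ennreal (4 ^ k * (cmod ((G (Suc k) - G k) x))\<^sup>2)) \<partial>?M)
      = (\<Sum>k. (\<integral>\<^sup>+x. ennreal (4 ^ k * (cmod ((G (Suc k) - G k) x))\<^sup>2) \<partial>?M))"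
      by (rule nn_integral_suminf) simp
    also have "\<dots> = (\<Sum>k. ennreal (4 ^ k * (L2_norm d \<Omega> (G (Suc k) - G k))\<^sup>2))"
    proof (rule arg_cong[where f = suminf], rule ext)
      fix k
      show "(\<integral>\<^sup>+x. ennreal (4 ^ k * (cmod ((G (Suc k) - G k) x))\<^sup>2) \<partial>?M)
        = ennreal (4 ^ k * (L2_norm d \<Omega> (G (Suc k) - G k))\<^sup>2)"
        using nn_integral_cmod_square[OF L2_diff[OF GL GL, of "Suc k" k]]
        unfolding ennreal_mult[OF zero_le_power[OF zero_le_numeral] zero_le_power2]
        by (subst nn_integral_cmult) simp_all
    qed
    \<comment> \<open>The rate \<open>(1 / 4) ^ k\<close> enters squared, so after multiplication by
      the weight \<open>4 ^ k\<close> a convergent geometric series is left.\<close>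
    also have "\<dots> \<le> (\<Sum>k. ennreal ((1 / 4) ^ k))"
    proof (intro suminf_le ennreal_leI)
      fix k
      have "(L2_norm d \<Omega> (G (Suc k) - G k))\<^sup>2 \<le> ((1 / 4) ^ k)\<^sup>2"
        by (rule power_mono[OF less_imp_le[OF G]]) auto
      then have "4 ^ k * (L2_norm d \<Omega> (G (Suc k) - G k))\<^sup>2 \<le> 4 ^ k * ((1 / 4) ^ k)\<^sup>2"
        by (intro mult_left_mono) auto
      also have "\<dots> = (1 / 4) ^ k"
        by (simp add: power2_eq_square flip: power_mult_distrib)
      finally show "4 ^ k * (L2_norm d \<Omega> (G (Suc k) - G k))\<^sup>2 \<le> (1 / 4) ^ k" .
    qed auto
    also have "\<dots> = ennreal (\<Sum>k. (1 / 4) ^ k)"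
      by (rule suminf_ennreal2) (auto intro: summable_geometric)
    finally show "(\<integral>\<^sup>+x. (\<Sum>k. ennreal (4 ^ k * (cmod ((G (Suc k) - G k) x))\<^sup>2)) \<partial>?M) \<noteq> \<infinity>"
      by (auto simp: top_unique)
    have "(\<lambda>x. ennreal (4 ^ k * (cmod ((G (Suc k) - G k) x))\<^sup>2)) \<in> borel_measurable ?M" for k
      by simp
    then show "(\<lambda>x. \<Sum>k. ennreal (4 ^ k * (cmod ((G (Suc k) - G k) x))\<^sup>2)) \<in> borel_measurable ?M"
      by (rule borel_measurable_suminf_order)
  qed
  have conv: "AE x in ?M. (\<lambda>k. G k x) \<longlonglongrightarrow> lim (\<lambda>k. G k x)"
    using AE by (rule eventually_mono)
      (auto simp: convergent_LIMSEQ_iff[symmetric] intro!: convergent_if_weighted_square_sum)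
  \<comment> \<open>On the null set where the sequence diverges \<open>lim\<close> returns a default
    value, which does not disturb measurability.\<close>
  define f where "f x = lim (\<lambda>k. G k x)" for x
  have fm [measurable]: "f \<in> borel_measurable ?M"
    unfolding f_def by measurable
  \<comment> \<open>Fatou's lemma in \<open>m\<close>: the pointwise limit of
    \<open>G m - G k\<close> inherits the bound on the norms, which is uniform in
    \<open>m \<ge> k\<close>.\<close>
  have le: "(\<integral>\<^sup>+x. ennreal ((cmod ((G k - f) x))\<^sup>2) \<partial>?M) \<le> ennreal (((1 / 4) ^ k)\<^sup>2)" for k
  proof -
    have "(\<integral>\<^sup>+x. ennreal ((cmod ((G k - f) x))\<^sup>2) \<partial>?M)
      = (\<integral>\<^sup>+x. liminf (\<lambda>m. ennreal ((cmod ((G m - G k) x))\<^sup>2)) \<partial>?M)"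
    proof (rule nn_integral_cong_AE)
      show "AE x in ?M. ennreal ((cmod ((G k - f) x))\<^sup>2) = liminf (\<lambda>m. ennreal ((cmod ((G m - G k) x))\<^sup>2))"
        using conv
      proof eventually_elim
        case (elim x)
        then have "(\<lambda>m. ennreal ((cmod (G m x - G k x))\<^sup>2)) \<longlonglongrightarrow> ennreal ((cmod (f x - G k x))\<^sup>2)"
          unfolding f_def by (intro tendsto_ennrealI tendsto_intros)
        from lim_imp_Liminf[OF _ this] show ?case by (simp add: norm_minus_commute)
      qed
    qed
    also have "\<dots> \<le> liminf (\<lambda>m. \<integral>\<^sup>+x. ennreal ((cmod ((G m - G k) x))\<^sup>2) \<partial>?M)"
      by (rule nn_integral_liminf) simp
    also have "\<dots> \<le> liminf (\<lambda>m::nat. ennreal (((1 / 4) ^ k)\<^sup>2))"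
    proof (rule Liminf_mono)
      show "\<forall>\<^sub>F m in sequentially. (\<integral>\<^sup>+x. ennreal ((cmod ((G m - G k) x))\<^sup>2) \<partial>?M) \<le> ennreal (((1 / 4) ^ k)\<^sup>2)"
        using eventually_ge_at_top[of k]
      proof eventually_elim
        case (elim m)
        show ?case
          unfolding nn_integral_cmod_square[OF L2_diff[OF GL GL]]
          by (rule ennreal_leI, rule power_mono[OF less_imp_le[OF G[OF elim]]]) simp
      qed
    qed
    also have "\<dots> = ennreal (((1 / 4) ^ k)\<^sup>2)" by (simp add: Liminf_const)
    finally show ?thesis .
  qed
  have GfL: "G k - f \<in> L2 d \<Omega>" for k
    unfolding L2_def
  proof safe
    show m: "G k - f \<in> borel_measurable ?M" unfolding fun_diff_def by measurable
    show "integrable ?M (\<lambda>x. (cmod ((G k - f) x))\<^sup>2)"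
      unfolding integrable_iff_bounded
      using le[of k] m by (auto simp: le_less_trans)
  qed
  have "G 0 - (G 0 - f) \<in> L2 d \<Omega>" by (intro L2_diff GL GfL)
  then have fL: "f \<in> L2 d \<Omega>" by simp
  have Gf: "L2_norm d \<Omega> (G k - f) \<le> (1 / 4) ^ k" for k
  proof -
    have "ennreal ((L2_norm d \<Omega> (G k - f))\<^sup>2) \<le> ennreal (((1 / 4) ^ k)\<^sup>2)"
      using le[of k] nn_integral_cmod_square[OF GfL] by simp
    then show ?thesis by (simp add: power2_le_iff_abs_le)
  qed
  have "(\<lambda>n. L2_norm d \<Omega> (F n - f)) \<longlonglongrightarrow> 0"
  proof (rule LIMSEQ_I)
    fix e :: real assume "e > 0"
    then obtain k where k: "(1 / 4) ^ k < e / 2"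
      using real_arch_pow_inv[of "e / 2" "1 / 4"] by auto
    show "\<exists>n0. \<forall>n\<ge>n0. norm (L2_norm d \<Omega> (F n - f) - 0) < e"
    proof (intro exI allI impI)
      fix n assume "n \<ge> N k"
      then have "L2_norm d \<Omega> (F n - G k) < (1 / 4) ^ k"
        unfolding G_def by (intro N r) auto
      then show "norm (L2_norm d \<Omega> (F n - f) - 0) < e"
        using L2_triangle_diff[OF F[of n] fL GL[of k]] Gf[of k] k by simp
    qed
  qed
  with fL show ?thesis by (rule that)
qed

section \<open>Orthogonal projection and density of spans\<close>

text \<open>The projection argument for a subspace that need not be closed: a minimising sequence
  for the distance from \<open>f\<close> to \<open>V\<close> is Cauchy, its limit \<open>p\<close>
  leaves a remainder \<open>f - p\<close> orthogonal to \<open>V\<close>, and the hypothesis makes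
  that remainder vanish in norm, so the distance is zero.\<close>

lemma L2_dense_if_orthogonal_trivial:
  assumes V: "csubspace V" "V \<subseteq> L2 d \<Omega>"
    and orth: "\<And>h. h \<in> L2 d \<Omega> \<Longrightarrow> (\<And>v. v \<in> V \<Longrightarrow> L2_inner d \<Omega> h v = 0) \<Longrightarrow> L2_norm d \<Omega> h = 0"
  shows "L2_dense d \<Omega> V"
  unfolding L2_dense_def
proof (intro conjI V ballI allI impI)
  let ?N = "L2_norm d \<Omega>"
  fix f and e :: real assume f: "f \<in> L2 d \<Omega>" and e: "e > 0"
  define \<delta> where "\<delta> = Inf ((\<lambda>v. ?N (f - v)) ` V)"
  have V0: "0 \<in> V" using V(1) by (rule cfun.subspace_0)
  have bdd: "bdd_below ((\<lambda>v. ?N (f - v)) ` V)" by (rule bdd_belowI[of _ 0]) auto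
  have \<delta>: "\<delta> \<le> ?N (f - v)" if "v \<in> V" for v
    unfolding \<delta>_def using bdd that by (intro cInf_lower) auto
  have \<delta>0: "0 \<le> \<delta>" unfolding \<delta>_def using V0 by (intro cInf_greatest) auto
  have "\<exists>v\<in>V. ?N (f - v) < \<delta> + 1 / Suc m" for m
  proof -
    have ne: "(\<lambda>v. ?N (f - v)) ` V \<noteq> {}" using V0 by auto
    have "\<delta> < \<delta> + 1 / Suc m" by simp
    then show ?thesis
      using cInf_less_iff[OF ne bdd, of "\<delta> + 1 / Suc m"] unfolding \<delta>_def[symmetric] by auto
  qed
  then obtain v where vV: "\<And>m. v m \<in> V" and v: "\<And>m. ?N (f - v m) < \<delta> + 1 / Suc m"
    by metis
  have vL: "v m \<in> L2 d \<Omega>" for m using vV V by auto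
  have fv: "f - v m \<in> L2 d \<Omega>" for m using vL f by (intro L2_diff)
  have lim: "(\<lambda>m. ?N (f - v m)) \<longlonglongrightarrow> \<delta>"
  proof (rule tendsto_sandwich[of "\<lambda>_. \<delta>"])
    show "(\<lambda>m. \<delta> + 1 / Suc m) \<longlonglongrightarrow> \<delta>"
      using tendsto_add[OF tendsto_const[of \<delta>] LIMSEQ_inverse_real_of_nat] by (simp add: inverse_eq_divide)
    show "\<forall>\<^sub>F m in sequentially. \<delta> \<le> ?N (f - v m)" using \<delta> vV by simp
    show "\<forall>\<^sub>F m in sequentially. ?N (f - v m) \<le> \<delta> + 1 / Suc m"
      by (intro always_eventually allI less_imp_le v)
  qed simp
  \<comment> \<open>Parallelogram law for \<open>f - v m\<close> and \<open>f - v l\<close>: half of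
    their sum is \<open>f\<close> minus the midpoint of \<open>v m\<close> and \<open>v l\<close>,
    which lies in \<open>V\<close> and so has distance at least \<open>\<delta>\<close> from
    \<open>f\<close>.\<close>
  have Cau: "(?N (v m - v l))\<^sup>2 \<le> 2 * (?N (f - v m))\<^sup>2 + 2 * (?N (f - v l))\<^sup>2 - 4 * \<delta>\<^sup>2" for m l
  proof -
    have "csmult (1/2) (v m + v l) \<in> V"
      using vV V(1) by (intro cfun.subspace_scale cfun.subspace_add)
    then have "\<delta> \<le> ?N (f - csmult (1/2) (v m + v l))" by (rule \<delta>)
    also have "f - csmult (1/2) (v m + v l) = csmult (1/2) ((f - v m) + (f - v l))"
      by (simp add: fun_eq_iff field_simps)
    finally have "2 * \<delta> \<le> ?N ((f - v m) + (f - v l))"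
      unfolding L2_norm_csmult by simp
    then have "4 * \<delta>\<^sup>2 \<le> (?N ((f - v m) + (f - v l)))\<^sup>2"
      using power_mono[of "2 * \<delta>" _ 2] \<delta>0 by (simp add: power_mult_distrib)
    moreover have "(f - v m) - (f - v l) = v l - v m" by simp
    ultimately show ?thesis
      using L2_parallelogram[OF fv[of m] fv[of l]] L2_norm_minus_commute[of d \<Omega> "v m" "v l"] by simp
  qed
  obtain p where p: "p \<in> L2 d \<Omega>" and vp: "(\<lambda>m. ?N (v m - p)) \<longlonglongrightarrow> 0"
  proof (rule L2_complete[of v])
    fix r :: real assume r: "r > 0"
    have "(\<lambda>m. (?N (f - v m))\<^sup>2) \<longlonglongrightarrow> \<delta>\<^sup>2" using lim by (intro tendsto_intros)
    from LIMSEQ_D[OF this, of "r\<^sup>2 / 4"] r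
    obtain m0 where m0: "\<And>m. m \<ge> m0 \<Longrightarrow> norm ((?N (f - v m))\<^sup>2 - \<delta>\<^sup>2) < r\<^sup>2 / 4" by auto
    show "\<exists>N. \<forall>m\<ge>N. \<forall>n\<ge>N. ?N (v m - v n) < r"
    proof (intro exI allI impI)
      fix m n assume "m \<ge> m0" "n \<ge> m0"
      then have "(?N (v m - v n))\<^sup>2 < r\<^sup>2" using Cau[of m n] m0[of m] m0[of n]
        unfolding real_norm_def by linarith
      then show "?N (v m - v n) < r" using r by (simp add: power2_less_imp_less)
    qed
  qed (use vL in auto)
  \<comment> \<open>The limit \<open>p\<close> lies only in the closure of \<open>V\<close>, so
    minimality is carried over to it from the competitors \<open>v m + w\<close>.\<close>
  have min: "\<delta> \<le> ?N ((f - p) - w)" if w: "w \<in> V" for w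
  proof (rule LIMSEQ_le_const)
    show "(\<lambda>m. ?N ((f - p) - w) + ?N (v m - p)) \<longlonglongrightarrow> ?N ((f - p) - w)"
      using tendsto_add[OF tendsto_const vp] by simp
    have wL: "w \<in> L2 d \<Omega>" using w V by auto
    show "\<exists>N. \<forall>m\<ge>N. \<delta> \<le> ?N ((f - p) - w) + ?N (v m - p)"
    proof (intro exI allI impI)
      fix m
      have "\<delta> \<le> ?N (f - (v m + w))" using w vV V(1) by (intro \<delta> cfun.subspace_add)
      also have "f - (v m + w) = ((f - p) - w) + (p - v m)" by (simp add: algebra_simps)
      also have "?N \<dots> \<le> ?N ((f - p) - w) + ?N (p - v m)"
        using p f vL wL by (intro L2_triangle L2_diff)
      finally show "\<delta> \<le> ?N ((f - p) - w) + ?N (v m - p)" by (simp add: L2_norm_minus_commute)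
    qed
  qed
  have fp: "f - p \<in> L2 d \<Omega>" using f p by (rule L2_diff)
  have Nfp: "?N (f - p) \<le> \<delta>"
  proof (rule LIMSEQ_le_const)
    show "(\<lambda>m. ?N (f - v m) + ?N (v m - p)) \<longlonglongrightarrow> \<delta>"
      using tendsto_add[OF lim vp] by simp
    show "\<exists>N. \<forall>m\<ge>N. ?N (f - p) \<le> ?N (f - v m) + ?N (v m - p)"
      using L2_triangle_diff[OF f p vL] by auto
  qed
  have "L2_inner d \<Omega> (f - p) w = 0" if w: "w \<in> V" for w
  proof (rule ccontr)
    assume nz: "L2_inner d \<Omega> (f - p) w \<noteq> 0"
    have wL: "w \<in> L2 d \<Omega>" using w V by auto
    define z where "z = L2_inner d \<Omega> (f - p) w"
    \<comment> \<open>Moving \<open>f - p\<close> by \<open>t * z\<close> along \<open>w\<close>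
      lowers the squared norm by \<open>t * (cmod z)\<^sup>2 * (2 - t * (?N w)\<^sup>2)\<close>,
      which is positive once \<open>t * (?N w)\<^sup>2 < 1\<close>. The summand 1 in the denominator
      covers \<open>?N w = 0\<close>.\<close>
    define t where "t = 1 / ((?N w)\<^sup>2 + 1)"
    have t: "t > 0" "t * (?N w)\<^sup>2 < 1" unfolding t_def
      by (simp_all add: add_nonneg_pos)
    have "\<delta>\<^sup>2 \<le> (?N ((f - p) - csmult (t * z) w))\<^sup>2"
      using w V(1) \<delta>0 by (intro power_mono min cfun.subspace_scale)
    also have "\<dots> = (?N (f - p))\<^sup>2 - 2 * Re (cnj (t * z) * z) + (cmod (t * z))\<^sup>2 * (?N w)\<^sup>2"
      by (simp only: L2_norm_square_diff_csmult[OF fp wL] z_def)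
    also have "cnj (t * z) * z = complex_of_real (t * (cmod z)\<^sup>2)"
      unfolding of_real_mult complex_norm_square by simp
    also have "(?N (f - p))\<^sup>2 - 2 * Re (complex_of_real (t * (cmod z)\<^sup>2)) + (cmod (t * z))\<^sup>2 * (?N w)\<^sup>2
      = (?N (f - p))\<^sup>2 - t * (cmod z)\<^sup>2 * (2 - t * (?N w)\<^sup>2)"
      using t by (simp only: Re_complex_of_real norm_mult norm_of_real)
        (simp add: power2_eq_square algebra_simps)
    also have "\<dots> < (?N (f - p))\<^sup>2"
      using t nz by (simp add: z_def)
    also have "\<dots> \<le> \<delta>\<^sup>2" using Nfp by (intro power_mono) auto
    finally show False by simp
  qed
  then have "?N (f - p) = 0" by (intro orth[OF fp])
  then have "\<delta> = 0" using min[OF V0] \<delta>0 by simp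
  with lim have "(\<lambda>m. ?N (f - v m)) \<longlonglongrightarrow> 0" by simp
  from LIMSEQ_D[OF this e] obtain m where "?N (f - v m) < e" by force
  then show "\<exists>g\<in>V. ?N (f - g) < e" using vV by blast
qed

text \<open>Coefficients and vectors become sequences over an initial segment, the form in which the
  Gram sums over pairs of indices are written later.\<close>

lemma cspan_finite_sum:
  assumes "v \<in> cspan G"
  obtains m :: nat and c g where "\<And>i. i < m \<Longrightarrow> g i \<in> G" "v = (\<Sum>i<m. csmult (c i) (g i))"
proof -
  from assms obtain S r where S: "finite S" "S \<subseteq> G" "v = (\<Sum>a\<in>S. csmult (r a) a)"
    by (auto simp: cfun.span_explicit)
  from ex_bij_betw_nat_finite[OF S(1)] obtain b where b: "bij_betw b {0..<card S} S" by auto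
  show ?thesis
  proof (rule that[of "card S" b "\<lambda>i. r (b i)"])
    show "b i \<in> G" if "i < card S" for i
      using that b S(2) by (auto simp: bij_betw_def)
    show "v = (\<Sum>i<card S. csmult (r (b i)) (b i))"
      unfolding S(3) using sum.reindex_bij_betw[OF b, of "\<lambda>a. csmult (r a) a"] by (simp add: lessThan_atLeast0)
  qed
qed

lemma csubspace_L2: "csubspace (L2 d \<Omega>)"
  by (intro cfun.subspaceI L2_intros)

lemma L2_approx_if_orthogonal_trivial:
  assumes G: "G \<subseteq> L2 d \<Omega>"
    and orth: "\<And>h. h \<in> L2 d \<Omega> \<Longrightarrow> (\<And>v. v \<in> G \<Longrightarrow> L2_inner d \<Omega> h v = 0) \<Longrightarrow> L2_norm d \<Omega> h = 0"
    and f: "f \<in> L2 d \<Omega>" and e: "e > 0"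
  obtains m :: nat and c g where "\<And>i. i < m \<Longrightarrow> g i \<in> G"
    "L2_norm d \<Omega> (f - (\<Sum>i<m. csmult (c i) (g i))) < e"
proof -
  have "L2_dense d \<Omega> (cspan G)"
  proof (rule L2_dense_if_orthogonal_trivial)
    show "cspan G \<subseteq> L2 d \<Omega>"
      by (rule cfun.span_minimal[OF G csubspace_L2])
  qed (auto intro: orth cfun.span_base)
  with f e obtain v where "v \<in> cspan G" "L2_norm d \<Omega> (f - v) < e"
    unfolding L2_dense_def by blast
  then show ?thesis using that cspan_finite_sum[of v G] by metis
qed

section \<open>Boxes and open sets\<close>

abbreviation leb :: "nat \<Rightarrow> point measure" where
  "leb d \<equiv> Pi\<^sub>M {..<d} (\<lambda>_. lborel)"

interpretation lborel_product: product_sigma_finite "\<lambda>_::nat. lborel :: real measure"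
  by standard

lemma space_leb: "space (leb d) = topspace (eucl d)"
  by (simp add: space_PiM)

definition open_box :: "nat \<Rightarrow> point \<Rightarrow> point \<Rightarrow> point set" where
  "open_box d a b = (\<Pi>\<^sub>E i\<in>{..<d}. {a i<..<b i})"

definition closed_box :: "nat \<Rightarrow> point \<Rightarrow> point \<Rightarrow> point set" where
  "closed_box d a b = (\<Pi>\<^sub>E i\<in>{..<d}. {a i..b i})"

lemma mem_range_open_box: "X \<in> range (\<lambda>(a, b). open_box d a b) \<longleftrightarrow> (\<exists>a b. X = open_box d a b)"
  by (simp add: image_iff)

lemma open_box_subset: "open_box d a b \<subseteq> closed_box d a b"
  unfolding open_box_def closed_box_def by (intro PiE_mono) auto

lemma open_box_Int: "open_box d a b \<inter> open_box d a' b'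
    = open_box d (\<lambda>i. max (a i) (a' i)) (\<lambda>i. min (b i) (b' i))"
  unfolding open_box_def PiE_Int by (intro PiE_cong) auto

lemma sets_open_box [measurable]: "open_box d a b \<in> sets (leb d)"
  unfolding open_box_def by (intro sets_PiM_I_finite) auto

lemma emeasure_open_box_finite: "emeasure (leb d) (open_box d a b) < \<infinity>"
proof -
  have "emeasure lborel {a i<..<b i} \<noteq> \<infinity>" for i
    using emeasure_lborel_box_finite[of "a i" "b i"] by (simp add: box_real)
  then have "emeasure (leb d) (open_box d a b) \<noteq> \<infinity>"
    unfolding open_box_def by (subst lborel_product.emeasure_PiM) (auto simp: ennreal_prod_eq_top)
  then show ?thesis by (simp add: less_top)
qed

text \<open>Open intervals generate the Borel sets of a coordinate and countably many of them cover
  the line; under these two conditions the product \<sigma>-algebra is generated by boxes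
  constraining all coordinates at once. Boxes are also stable under intersection, as the uniqueness
  argument below requires.\<close>

lemma sets_leb: "sets (leb d) = sigma_sets (space (leb d)) (range (\<lambda>(a, b). open_box d a b))"
proof -
  let ?E = "range (\<lambda>(a, b). {a<..<b::real})"
  have "sets (leb d) = sets (Pi\<^sub>M {..<d} (\<lambda>_. sigma UNIV ?E))"
  proof (intro sets_PiM_cong refl)
    show "sets (lborel :: real measure) = sets (sigma UNIV ?E)"
    proof -
      have "(\<lambda>(a, b). box a b) = (\<lambda>(a, b). {a<..<b::real})" by (auto simp: box_real)
      then show ?thesis unfolding sets_lborel borel_eq_box by (rule arg_cong[where f = "\<lambda>E. sets (sigma UNIV (range E))"])
    qed
  qed
  also have "\<dots> = sets (sigma (\<Pi>\<^sub>E i\<in>{..<d}. UNIV)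
    {{f \<in> \<Pi>\<^sub>E i\<in>{..<d}. UNIV. \<forall>i\<in>j. f i \<in> A i} | A j. j \<in> {{..<d}} \<and> A \<in> Pi j (\<lambda>_. ?E)})"
  proof (rule sets_PiM_sigma)
    have "\<exists>n::nat. x \<in> {- real n<..<real n}" for x
    proof -
      obtain n :: nat where "\<bar>x\<bar> < real n" using reals_Archimedean2 by blast
      then show ?thesis by (intro exI[of _ n]) (auto simp: abs_less_iff)
    qed
    then have "UNIV = \<Union> ((\<lambda>n::nat. {- real n<..<real n}) ` UNIV)" by blast
    then show "\<exists>S\<subseteq>?E. countable S \<and> UNIV = \<Union>S"
      by (intro exI[of _ "(\<lambda>n::nat. {- real n<..<real n}) ` UNIV"]) auto
  qed auto
  also have "{{f \<in> \<Pi>\<^sub>E i\<in>{..<d}. UNIV. \<forall>i\<in>j. f i \<in> A i} | A j. j \<in> {{..<d}} \<and> A \<in> Pi j (\<lambda>_. ?E)}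
    = range (\<lambda>(a, b). open_box d a b)" (is "?L = ?R")
  proof (intro equalityI subsetI)
    fix X assume "X \<in> ?L"
    then obtain A j where "j \<in> {{..<d}}" and A: "A \<in> Pi j (\<lambda>_. ?E)"
      and X: "X = {f \<in> \<Pi>\<^sub>E i\<in>{..<d}. UNIV. \<forall>i\<in>j. f i \<in> A i}"
      by (elim CollectE exE conjE) (rule that)
    then have j: "j = {..<d}" by blast
    note A = A[unfolded j] and X = X[unfolded j]
    have "\<forall>i\<in>{..<d}. \<exists>a b. A i = {a<..<b}"
    proof
      fix i assume "i \<in> {..<d}"
      with A have "A i \<in> ?E" by blast
      then show "\<exists>a b. A i = {a<..<b}" by auto
    qed
    then obtain a b where ab: "\<And>i. i < d \<Longrightarrow> A i = {a i<..<b i}" by (metis lessThan_iff)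
    have "X = open_box d a b" unfolding X open_box_def
      by (intro set_eqI) (simp add: PiE_iff ab conj_commute)
    then show "X \<in> ?R" unfolding mem_range_open_box by blast
  next
    fix X assume "X \<in> ?R"
    then obtain a b where X: "X = open_box d a b"
        unfolding mem_range_open_box by blast
    have "X = {f \<in> \<Pi>\<^sub>E i\<in>{..<d}. UNIV. \<forall>i\<in>{..<d}. f i \<in> {a i<..<b i}}"
      unfolding X open_box_def by (intro set_eqI) (simp add: PiE_iff conj_commute)
    then show "X \<in> ?L"
      by (intro CollectI exI[of _ "\<lambda>i. {a i<..<b i}"] exI[of _ "{..<d}"] conjI) auto
  qed
  also have "sets (sigma (\<Pi>\<^sub>E i\<in>{..<d}. UNIV) ?R) = sigma_sets (\<Pi>\<^sub>E i\<in>{..<d}. UNIV) ?R"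
  proof (rule sets_measure_of, rule subsetI)
    fix X assume "X \<in> ?R"
    then obtain a b where X: "X = open_box d a b"
      unfolding mem_range_open_box by blast
    show "X \<in> Pow (\<Pi>\<^sub>E i\<in>{..<d}. UNIV)"
      unfolding X open_box_def by (intro PowI PiE_mono) auto
  qed
  finally show ?thesis unfolding space_PiM space_lborel by (simp only: space_borel)
qed

lemma Int_stable_open_box: "Int_stable (range (\<lambda>(a, b). open_box d a b))"
  unfolding Int_stable_def Ball_def mem_range_open_box using open_box_Int by blast

text \<open>The sets over which \<open>f\<close> integrates to zero form a Dynkin system:
  complements use the assumption on the whole space, disjoint unions use countable additivity. It
  therefore contains the sets where \<open>f\<close> is positive and where it is negative, the two
  signs \<open>s\<close> below, and these must be null.\<close>

lemma AE_zero_if_integrals_zero_on_generator: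
  fixes f :: "'a \<Rightarrow> real"
  assumes f: "integrable M f" and E: "sets M = sigma_sets (space M) E" "Int_stable E"
    and int: "integral\<^sup>L M f = 0" "\<And>X. X \<in> E \<Longrightarrow> (\<integral>x. indicator X x * f x \<partial>M) = 0"
  shows "AE x in M. f x = 0"
proof -
  have EP: "E \<subseteq> Pow (space M)"
    using sets.space_closed[of M] E(1) sigma_sets_superset_generator[of E "space M"] by simp
  have *: "(\<integral>x. indicator A x * f x \<partial>M) = 0" if "A \<in> sets M" for A
  proof -
    from that have "A \<in> sigma_sets (space M) E" using E(1) by simp
    with E(2) EP show ?thesis
    proof (induction rule: sigma_sets_induct_disjoint)
      case (compl A)
      then have A: "A \<in> sets M" using E(1) by simp
      have "(\<integral>x. indicator (space M - A) x * f x \<partial>M) = (\<integral>x. f x - indicator A x * f x \<partial>M)"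
        by (intro Bochner_Integration.integral_cong) (auto simp: indicator_def)
      also have "\<dots> = 0"
        using integrable_mult_indicator[OF A f] compl f int(1) by simp
      finally show ?case .
    next
      case (union A)
      have A: "A i \<in> sets M" for i using union E(1) by auto
      have "set_integrable M (\<Union>i. A i) f"
        unfolding set_integrable_def using A f by (intro integrable_mult_indicator) auto
      then have "(LINT x:(\<Union>i. A i)|M. f x) = (\<Sum>i. (LINT x:A i|M. f x))"
        using union(1) A by (intro lebesgue_integral_countable_add) (auto simp: disjoint_family_on_def)
      moreover have "(LINT x:A i|M. f x) = 0" for i
        using union(3)[of i] by (simp add: set_lebesgue_integral_def)
      ultimately have "(LINT x:(\<Union>i. A i)|M. f x) = 0" by simp
      then show ?case by (simp add: set_lebesgue_integral_def)
    qed (use int in auto)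
  qed
  have fm[measurable]: "f \<in> borel_measurable M" using f by auto
  have part: "AE x in M. s * f x \<le> 0" if s: "s = 1 \<or> s = -1" for s
  proof -
    let ?A = "{x\<in>space M. 0 < s * f x}"
    have A: "?A \<in> sets M" by measurable
    have Z: "(\<integral>x. s * (indicator ?A x * f x) \<partial>M) = 0"
      using *[OF A] by simp
    have N: "AE x in M. 0 \<le> s * (indicator ?A x * f x)" by (auto simp: indicator_def)
    have I: "integrable M (\<lambda>x. s * (indicator ?A x * f x))"
      using integrable_mult_indicator[OF A f] by simp
    have "AE x in M. s * (indicator ?A x * f x) = 0"
      using iffD1[OF integral_nonneg_eq_0_iff_AE[OF I N] Z] .
    then show ?thesis using AE_space by eventually_elim (auto simp: indicator_def split: if_splits)
  qed
  have "AE x in M. 1 * f x \<le> 0" "AE x in M. -1 * f x \<le> 0" by (rule part, simp)+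
  then show ?thesis by eventually_elim auto
qed

text \<open>Rational corners keep the family of boxes countable. The closed box is kept inside
  \<Omega> because it will be the compact support of a test function.\<close>

lemma open_in_box:
  assumes "openin (eucl d) \<Omega>" "x \<in> \<Omega>"
  obtains a b where "a \<in> {..<d} \<rightarrow>\<^sub>E \<rat>" "b \<in> {..<d} \<rightarrow>\<^sub>E \<rat>" "x \<in> open_box d a b" "closed_box d a b \<subseteq> \<Omega>"
proof -
  obtain U where U: "\<forall>i\<in>{..<d}. open (U i)" "x \<in> (\<Pi>\<^sub>E i\<in>{..<d}. U i)" "(\<Pi>\<^sub>E i\<in>{..<d}. U i) \<subseteq> \<Omega>"
    using assms unfolding openin_product_topology_alt open_openin[symmetric] by blast
  have "\<exists>a b. a \<in> \<rat> \<and> b \<in> \<rat> \<and> a < x i \<and> x i < b \<and> {a..b} \<subseteq> U i" if i: "i < d" for i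
  proof -
    have "x i \<in> U i" "open (U i)" using U i by (auto simp: PiE_iff)
    then obtain e where e: "e > 0" "cball (x i) e \<subseteq> U i" by (meson open_contains_cball)
    obtain a where a: "a \<in> \<rat>" "x i - e < a" "a < x i" using Rats_dense_in_real[of "x i - e" "x i"] e by auto
    obtain b where b: "b \<in> \<rat>" "x i < b" "b < x i + e" using Rats_dense_in_real[of "x i" "x i + e"] e by auto
    have "{a..b} \<subseteq> cball (x i) e" using a b by (auto simp: dist_real_def abs_le_iff)
    then show ?thesis using a b e by blast
  qed
  then obtain a b where ab: "\<And>i. i < d \<Longrightarrow> a i \<in> \<rat> \<and> b i \<in> \<rat> \<and> a i < x i \<and> x i < b i \<and> {a i..b i} \<subseteq> U i"
    by metis
  show ?thesis
  \<comment> \<open>Corners are restricted to \<open>{..<d}\<close> so that they belong to the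
    countable set \<open>{..<d} \<rightarrow>\<^sub>E \<rat>\<close>; values beyond \<open>d\<close>
    would be unconstrained.\<close>
  proof (rule that[of "restrict a {..<d}" "restrict b {..<d}"])
    show "x \<in> open_box d (restrict a {..<d}) (restrict b {..<d})"
      using ab U(2) by (auto simp: open_box_def PiE_iff)
    have "closed_box d (restrict a {..<d}) (restrict b {..<d}) \<subseteq> (\<Pi>\<^sub>E i\<in>{..<d}. U i)"
      using ab by (auto simp: closed_box_def PiE_iff subset_iff)
    then show "closed_box d (restrict a {..<d}) (restrict b {..<d}) \<subseteq> \<Omega>" using U(3) by blast
  qed (use ab in auto)
qed

lemma open_eq_Union_boxes:
  assumes "openin (eucl d) \<Omega>"
  obtains C where "countable C" "\<Omega> = (\<Union>(a, b)\<in>C. open_box d a b)" "\<And>a b. (a, b) \<in> C \<Longrightarrow> closed_box d a b \<subseteq> \<Omega>"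
proof -
  let ?Q = "{..<d} \<rightarrow>\<^sub>E (\<rat> :: real set)"
  let ?C = "{(a, b) \<in> ?Q \<times> ?Q. closed_box d a b \<subseteq> \<Omega>}"
  have "countable (?Q \<times> ?Q)" by (intro countable_SIGMA countable_PiE) (auto intro: countable_rat)
  then have "countable ?C" by (rule countable_subset[rotated]) auto
  moreover have "\<Omega> = (\<Union>(a, b)\<in>?C. open_box d a b)"
  proof (intro equalityI subsetI)
    fix x assume "x \<in> \<Omega>"
    from open_in_box[OF assms this] obtain a b where
      "a \<in> ?Q" "b \<in> ?Q" "x \<in> open_box d a b" "closed_box d a b \<subseteq> \<Omega>" .
    then show "x \<in> (\<Union>(a, b)\<in>?C. open_box d a b)" by (intro UN_I[of "(a, b)"]) simp_all
  next
    fix x assume "x \<in> (\<Union>(a, b)\<in>?C. open_box d a b)"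
    then obtain a b where "x \<in> open_box d a b" "closed_box d a b \<subseteq> \<Omega>" by blast
    then show "x \<in> \<Omega>" using open_box_subset by blast
  qed
  ultimately show ?thesis by (rule that) blast
qed

lemma sets_leb_open: 
  assumes "openin (eucl d) \<Omega>"
  shows "\<Omega> \<in> sets (leb d)"
proof -
  obtain C where C: "countable C" "\<Omega> = (\<Union>(a, b)\<in>C. open_box d a b)"
    using open_eq_Union_boxes[OF assms] by metis
  show ?thesis unfolding C(2) using C(1) by (intro sets.countable_UN') auto
qed

section \<open>Integration over open sets\<close>

lemma space_leb_on: "openin (eucl d) \<Omega> \<Longrightarrow> space (leb_on d \<Omega>) = \<Omega>"
  using openin_subset[of "eucl d" \<Omega>] by (auto simp: leb_on_def space_restrict_space space_leb)

lemma open_Int_space: "openin (eucl d) \<Omega> \<Longrightarrow> \<Omega> \<inter> space (leb d) \<in> sets (leb d)"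
  using sets_leb_open sets.sets_into_space by (metis Int_absorb2)

lemma integrable_leb_on:
  fixes f :: "point \<Rightarrow> 'b::{banach, second_countable_topology}"
  shows "openin (eucl d) \<Omega> \<Longrightarrow> integrable (leb_on d \<Omega>) f \<longleftrightarrow> integrable (leb d) (\<lambda>x. indicator \<Omega> x *\<^sub>R f x)"
  unfolding leb_on_def by (rule integrable_restrict_space[OF open_Int_space])

lemma integral_leb_on:
  fixes f :: "point \<Rightarrow> 'b::{banach, second_countable_topology}"
  shows "openin (eucl d) \<Omega> \<Longrightarrow> integral\<^sup>L (leb_on d \<Omega>) f = (\<integral>x. indicator \<Omega> x *\<^sub>R f x \<partial>leb d)"
  unfolding leb_on_def by (rule integral_restrict_space[OF open_Int_space])

lemma borel_measurable_leb_on: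
  fixes f :: "point \<Rightarrow> 'b::real_normed_vector"
  shows "openin (eucl d) \<Omega> \<Longrightarrow> f \<in> borel_measurable (leb_on d \<Omega>)
    \<longleftrightarrow> (\<lambda>x. indicator \<Omega> x *\<^sub>R f x) \<in> borel_measurable (leb d)"
  unfolding leb_on_def by (rule borel_measurable_restrict_space_iff[OF open_Int_space])

lemma measurable_leb_on: "f \<in> measurable (leb d) N \<Longrightarrow> f \<in> measurable (leb_on d \<Omega>) N"
  unfolding leb_on_def by (rule measurable_restrict_space1)

lemma indicator_open_box_L2:
  assumes "openin (eucl d) \<Omega>"
  shows "(\<lambda>x. indicator (open_box d a b) x) \<in> L2 d \<Omega>"
  unfolding L2_def
proof safe
  show "(\<lambda>x. indicator (open_box d a b) x :: complex) \<in> borel_measurable (leb_on d \<Omega>)"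
    by (rule measurable_leb_on) measurable
  have "integrable (leb d) (\<lambda>x. indicator \<Omega> x *\<^sub>R indicator (open_box d a b) x :: real)"
    using emeasure_open_box_finite[of d a b] sets_leb_open[OF assms]
    by (intro integrable_mult_indicator) (auto simp: integrable_indicator_iff)
  then have "integrable (leb_on d \<Omega>) (\<lambda>x. indicator (open_box d a b) x :: real)"
    by (simp add: integrable_leb_on[OF assms])
  then show "integrable (leb_on d \<Omega>) (\<lambda>x. (cmod (indicator (open_box d a b) x))\<^sup>2)"
    by (rule Bochner_Integration.integrable_cong[THEN iffD1, rotated 2]) (auto simp: indicator_def)
qed

text \<open>A function in L2 need not be integrable over \<Omega>, and only boxes with closure
  inside \<Omega> are tested. Cutting \<open>g\<close> off to one such box \<open>?Q\<close> settles
  both points: the cut-off is integrable, and any box meets \<open>?Q\<close> in a box of the tested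
  kind. Countably many \<open>?Q\<close> exhaust \<Omega>.\<close>

lemma L2_AE_zero_if_box_integrals_zero:
  assumes \<Omega>: "openin (eucl d) \<Omega>" and g: "g \<in> L2 d \<Omega>"
    and int: "\<And>a b. closed_box d a b \<subseteq> \<Omega> \<Longrightarrow> (\<integral>x. indicator (open_box d a b) x * g x \<partial>leb_on d \<Omega>) = 0"
  shows "AE x in leb_on d \<Omega>. g x = 0"
proof -
  obtain C where C: "countable C" "\<Omega> = (\<Union>(a, b)\<in>C. open_box d a b)"
      "\<And>a b. (a, b) \<in> C \<Longrightarrow> closed_box d a b \<subseteq> \<Omega>"
    using open_eq_Union_boxes[OF \<Omega>] by metis
  have "AE x in leb d. x \<in> open_box d A B \<longrightarrow> g x = 0" if AB: "closed_box d A B \<subseteq> \<Omega>" for A B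
  proof -
    let ?Q = "open_box d A B"
    define h where "h x = indicator ?Q x * g x" for x
    have Q\<Omega>: "?Q \<subseteq> \<Omega>" using AB open_box_subset by blast
    have sc: "indicator \<Omega> x *\<^sub>R (indicator ?Q x * z) = indicator ?Q x * z" for x and z :: complex
      using Q\<Omega> by (auto simp: indicator_def)
    have h: "integrable (leb d) h"
      using L2_integrable_mult[OF indicator_open_box_L2[OF \<Omega>] g, of A B]
      unfolding integrable_leb_on[OF \<Omega>] sc h_def .
    have box: "(\<integral>x. indicator (open_box d a b) x * h x \<partial>leb d) = 0" for a b
    proof -
      let ?a = "\<lambda>i. max (a i) (A i)" and ?b = "\<lambda>i. min (b i) (B i)"
      have sub: "closed_box d ?a ?b \<subseteq> \<Omega>"
      proof (rule order_trans[OF _ AB])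
        show "closed_box d ?a ?b \<subseteq> closed_box d A B"
          unfolding closed_box_def by (intro PiE_mono) auto
      qed
      have "(\<integral>x. indicator (open_box d a b) x * h x \<partial>leb d)
          = (\<integral>x. indicator \<Omega> x *\<^sub>R (indicator (open_box d ?a ?b) x * g x) \<partial>leb d)"
      proof (rule Bochner_Integration.integral_cong[OF refl])
        fix x
        show "indicator (open_box d a b) x * h x
          = indicator \<Omega> x *\<^sub>R (indicator (open_box d ?a ?b) x * g x)"
          unfolding open_box_Int[symmetric] h_def using Q\<Omega>
          by (cases "x \<in> ?Q") (auto simp: indicator_def)
      qed
      also have "\<dots> = 0" using int[OF sub] by (simp add: integral_leb_on[OF \<Omega>])
      finally show ?thesis .
    qed
    have whole: "integral\<^sup>L (leb d) h = 0"
    proof -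
      have "indicator ?Q x * h x = h x" for x by (simp add: h_def indicator_def)
      then show ?thesis using box[of A B] by (simp only:)
    qed
    have re: "AE x in leb d. Re (h x) = 0"
    proof (rule AE_zero_if_integrals_zero_on_generator[OF _ sets_leb Int_stable_open_box])
      show "integrable (leb d) (\<lambda>x. Re (h x))" using h by simp
      show "(\<integral>x. Re (h x) \<partial>leb d) = 0" using h whole by simp
      fix X assume "X \<in> range (\<lambda>(a, b). open_box d a b)"
      then obtain a b where X: "X = open_box d a b"
        unfolding mem_range_open_box by blast
      have "(\<integral>x. indicator X x * Re (h x) \<partial>leb d) = (\<integral>x. Re (indicator X x * h x) \<partial>leb d)"
        by (intro Bochner_Integration.integral_cong) (auto simp: indicator_def)
      also have "\<dots> = Re (\<integral>x. indicator X x * h x \<partial>leb d)"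
        using integrable_mult_indicator[OF sets_open_box h, of a b]
        unfolding X by (intro integral_Re) (simp add: scaleR_conv_of_real of_real_indicator)
      finally show "(\<integral>x. indicator X x * Re (h x) \<partial>leb d) = 0" using box[of a b] by (simp add: X)
    qed
    have im: "AE x in leb d. Im (h x) = 0"
    proof (rule AE_zero_if_integrals_zero_on_generator[OF _ sets_leb Int_stable_open_box])
      show "integrable (leb d) (\<lambda>x. Im (h x))" using h by simp
      show "(\<integral>x. Im (h x) \<partial>leb d) = 0" using h whole by simp
      fix X assume "X \<in> range (\<lambda>(a, b). open_box d a b)"
      then obtain a b where X: "X = open_box d a b"
        unfolding mem_range_open_box by blast
      have "(\<integral>x. indicator X x * Im (h x) \<partial>leb d) = (\<integral>x. Im (indicator X x * h x) \<partial>leb d)"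
        by (intro Bochner_Integration.integral_cong) (auto simp: indicator_def)
      also have "\<dots> = Im (\<integral>x. indicator X x * h x \<partial>leb d)"
        using integrable_mult_indicator[OF sets_open_box h, of a b]
        unfolding X by (intro integral_Im) (simp add: scaleR_conv_of_real of_real_indicator)
      finally show "(\<integral>x. indicator X x * Im (h x) \<partial>leb d) = 0" using box[of a b] by (simp add: X)
    qed
    from re im show ?thesis
      by eventually_elim (auto simp: h_def indicator_def complex_eq_iff split: if_splits)
  qed
  then have "AE x in leb d. \<forall>p\<in>C. x \<in> open_box d (fst p) (snd p) \<longrightarrow> g x = 0"
    using C(1,3) by (subst AE_ball_countable) auto
  then have "AE x in leb d. x \<in> \<Omega> \<longrightarrow> g x = 0"
  proof eventually_elim
    case (elim x)
    show ?case
    proof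
      assume "x \<in> \<Omega>"
      then obtain a b where "(a, b) \<in> C" "x \<in> open_box d a b" unfolding C(2) by blast
      with elim show "g x = 0" by fastforce
    qed
  qed
  then show ?thesis
    unfolding leb_on_def by (subst AE_restrict_space_iff[OF open_Int_space[OF \<Omega>]])
qed

section \<open>Bump functions\<close>

text \<open>Coinduction reduces smoothness to exhibiting a class of functions closed under
  differentiation, with no bookkeeping of the order.\<close>

coinductive smooth_real :: "(real \<Rightarrow> real) \<Rightarrow> bool" where
  "(\<And>x. (f has_real_derivative f' x) (at x)) \<Longrightarrow> smooth_real f' \<Longrightarrow> smooth_real f"

lemma smooth_real_closed_class:
  assumes "X f" and step: "\<And>h. X h \<Longrightarrow> \<exists>h'. (\<forall>x. (h has_real_derivative h' x) (at x)) \<and> X h'"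
  shows "smooth_real f"
  using assms(1)
proof (rule smooth_real.coinduct[of X])
  fix h assume "X h"
  from step[OF this] obtain h' where "\<forall>x. (h has_real_derivative h' x) (at x)" "X h'" by blast
  then show "\<exists>f f'. h = f \<and> (\<forall>x. (f has_real_derivative f' x) (at x)) \<and> (X f' \<or> smooth_real f')"
    by (intro exI[of _ h] exI[of _ h']) simp
qed

lemma smooth_real_deriv:
  assumes "smooth_real f"
  shows "(f has_real_derivative deriv f x) (at x)" "smooth_real (deriv f)"
proof -
  from assms obtain f' where f': "\<And>x. (f has_real_derivative f' x) (at x)" "smooth_real f'"
    by cases auto
  have "deriv f = f'" using f'(1) DERIV_imp_deriv by blast
  then show "(f has_real_derivative deriv f x) (at x)" "smooth_real (deriv f)" using f' by auto
qed

lemma smooth_real_continuous: "smooth_real f \<Longrightarrow> continuous_on UNIV f"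
  using smooth_real_deriv(1) DERIV_continuous_on by blast

lemma smooth_real_affine:
  assumes "smooth_real f"
  shows "smooth_real (\<lambda>t. c * f (k * t + l))"
proof -
  define X where "X h \<longleftrightarrow> (\<exists>f c. smooth_real f \<and> h = (\<lambda>t. c * f (k * t + l)))" for h
  have "X (\<lambda>t. c * f (k * t + l))" using assms unfolding X_def by blast
  then show ?thesis
  proof (rule smooth_real_closed_class[of X])
    fix h assume "X h"
    then obtain f c where f: "smooth_real f" and h: "h = (\<lambda>t. c * f (k * t + l))"
      unfolding X_def by blast
    have "(h has_real_derivative (c * k) * deriv f (k * t + l)) (at t)" for t
      unfolding h by (auto intro!: derivative_eq_intros DERIV_chain2[OF smooth_real_deriv(1)[OF f]])
    moreover have "X (\<lambda>t. (c * k) * deriv f (k * t + l))"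
      using smooth_real_deriv(2)[OF f] unfolding X_def by blast
    ultimately show "\<exists>h'. (\<forall>x. (h has_real_derivative h' x) (at x)) \<and> X h'"
      by (intro exI[of _ "\<lambda>t. (c * k) * deriv f (k * t + l)"]) simp
  qed
qed

text \<open>Products are not closed under differentiation, but finite sums of products are: the
  derivative replaces each pair \<open>(f, g)\<close> by the two pairs of the product rule.\<close>

lemma smooth_real_mult:
  assumes "smooth_real f" "smooth_real g"
  shows "smooth_real (\<lambda>t. f t * g t)"
proof -
  define X where "X h \<longleftrightarrow> (\<exists>l. (\<forall>(f, g)\<in>set l. smooth_real f \<and> smooth_real g) \<and>
    h = (\<lambda>t. \<Sum>(f, g)\<leftarrow>l. f t * g t))" for h :: "real \<Rightarrow> real"
  have "X (\<lambda>t. f t * g t)" using assms unfolding X_def by (intro exI[of _ "[(f, g)]"]) auto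
  then show ?thesis
  proof (rule smooth_real_closed_class[of X])
    fix h assume "X h"
    then obtain l where l: "\<forall>(f, g)\<in>set l. smooth_real f \<and> smooth_real g"
      and h: "h = (\<lambda>t. \<Sum>(f, g)\<leftarrow>l. f t * g t)"
      unfolding X_def by blast
    define l' where "l' = concat (map (\<lambda>(f, g). [(deriv f, g), (f, deriv g)]) l)"
    have "((\<lambda>t. \<Sum>(f, g)\<leftarrow>l. f t * g t) has_real_derivative (\<Sum>(f, g)\<leftarrow>l'. f t * g t)) (at t)" for t
      using l unfolding l'_def
    proof (induction l)
      case (Cons p l)
      obtain f g where p: "p = (f, g)" by fastforce
      from Cons p show ?case
        by (auto intro!: derivative_eq_intros smooth_real_deriv(1))
    qed auto
    moreover have "X (\<lambda>t. \<Sum>(f, g)\<leftarrow>l'. f t * g t)"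
      unfolding X_def using l by (intro exI[of _ l']) (auto simp: l'_def intro: smooth_real_deriv(2))
    ultimately show "\<exists>h'. (\<forall>x. (h has_real_derivative h' x) (at x)) \<and> X h'"
      unfolding h by (intro exI[of _ "\<lambda>t. \<Sum>(f, g)\<leftarrow>l'. f t * g t"]) simp
  qed
qed

text \<open>The polynomial in \<open>1 / x\<close> is carried along because derivatives of
  \<open>exp (- (1 / x))\<close> have exactly this shape; the bumps use only
  \<open>p = 1\<close>.\<close>

definition flat_exp :: "real poly \<Rightarrow> real \<Rightarrow> real" where
  "flat_exp p x = (if x > 0 then poly p (1 / x) * exp (- (1 / x)) else 0)"

lemma poly_div_exp_tendsto_0: "((\<lambda>y::real. poly p y / exp y) \<longlongrightarrow> 0) at_top"
proof -
  have "((\<lambda>y::real. \<Sum>i\<le>degree p. coeff p i * (y ^ i / exp y)) \<longlongrightarrow> (\<Sum>i\<le>degree p. coeff p i * 0)) at_top"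
    by (intro tendsto_intros tendsto_power_div_exp_0)
  then show ?thesis by (simp add: poly_altdef sum_divide_distrib)
qed

text \<open>With \<open>y = 1 / x\<close>, differentiating \<open>poly p y * exp (- y)\<close>
  brings down the inner derivative \<open>- y\<^sup>2\<close>, hence the polynomial
  \<open>y\<^sup>2 * (p - pderiv p)\<close>, with \<open>[:0, 0, 1:]\<close> for
  \<open>y\<^sup>2\<close>. At the origin, exponential decay beats every polynomial.\<close>

lemma flat_exp_has_derivative:
  "(flat_exp p has_real_derivative flat_exp ([:0, 0, 1:] * (p - pderiv p)) x) (at x)"
proof -
  consider "x > 0" | "x < 0" | "x = 0" by linarith
  then show ?thesis
  proof cases
    case 1
    have "((\<lambda>x. poly p (1 / x) * exp (- (1 / x))) has_real_derivative
      flat_exp ([:0, 0, 1:] * (p - pderiv p)) x) (at x)"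
      using 1 by (auto intro!: derivative_eq_intros DERIV_chain2[OF poly_DERIV]
        simp: flat_exp_def field_simps power2_eq_square)
    moreover have "\<forall>\<^sub>F y in nhds x. flat_exp p y = poly p (1 / y) * exp (- (1 / y))"
      using eventually_nhds_in_open[of "{0<..}" x] 1
      by (auto elim!: eventually_mono simp: flat_exp_def)
    ultimately show ?thesis by (subst DERIV_cong_ev[OF refl _ refl]) auto
  next
    case 2
    have "\<forall>\<^sub>F y in nhds x. flat_exp p y = 0"
      using eventually_nhds_in_open[of "{..<0}" x] 2
      by (auto elim!: eventually_mono simp: flat_exp_def)
    moreover have "flat_exp ([:0, 0, 1:] * (p - pderiv p)) x = 0" using 2 by (simp add: flat_exp_def)
    ultimately show ?thesis by (subst DERIV_cong_ev[OF refl _ refl]) auto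
  next
    case 3
    have "((\<lambda>h. flat_exp p h / h) \<longlongrightarrow> 0) (at 0)"
      proof (rule filterlim_split_at)
      show "((\<lambda>h. flat_exp p h / h) \<longlongrightarrow> 0) (at_left 0)"
        by (rule tendsto_eventually) (auto simp: eventually_at_filter flat_exp_def)
      \<comment> \<open>Dividing by \<open>h\<close> multiplies the polynomial in
        \<open>1 / h\<close> by its variable, which is \<open>pCons 0 p\<close>.\<close>
      have "((\<lambda>h. poly (pCons 0 p) (inverse h) / exp (inverse h)) \<longlongrightarrow> 0) (at_right (0::real))"
        by (rule filterlim_compose[OF poly_div_exp_tendsto_0 filterlim_inverse_at_top_right])
      moreover have "\<forall>\<^sub>F h in at_right 0. poly (pCons 0 p) (inverse h) / exp (inverse h) = flat_exp p h / h"
        by (auto simp: eventually_at_filter flat_exp_def exp_minus field_simps)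
      ultimately show "((\<lambda>h. flat_exp p h / h) \<longlongrightarrow> 0) (at_right 0)"
        by (rule Lim_transform_eventually)
    qed
    then show ?thesis by (simp add: 3 DERIV_def flat_exp_def)
  qed
qed

lemma smooth_flat_exp: "smooth_real (flat_exp p)"
proof (coinduction arbitrary: p rule: smooth_real.coinduct)
  case smooth_real
  then show ?case using flat_exp_has_derivative by blast
qed

text \<open>Scaling by \<open>Suc m\<close> leaves the zero set unchanged but drives both factors to
  1 inside the interval, so the bumps converge to the indicator of \<open>{a<..<b}\<close> and stay
  between 0 and 1.\<close>

definition bump :: "nat \<Rightarrow> real \<Rightarrow> real \<Rightarrow> real \<Rightarrow> real" where
  "bump m a b t = flat_exp 1 (real (Suc m) * (t - a)) * flat_exp 1 (real (Suc m) * (b - t))"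

lemma smooth_bump: "smooth_real (bump m a b)"
proof -
  have "smooth_real (\<lambda>t. 1 * flat_exp 1 (real (Suc m) * t + - real (Suc m) * a))"
    "smooth_real (\<lambda>t. 1 * flat_exp 1 (- real (Suc m) * t + real (Suc m) * b))"
    by (intro smooth_real_affine smooth_flat_exp)+
  from smooth_real_mult[OF this] show ?thesis
    unfolding bump_def[abs_def] by (simp add: algebra_simps)
qed

lemma flat_exp_1_bounds: "0 \<le> flat_exp 1 x" "flat_exp 1 x \<le> 1"
  by (auto simp: flat_exp_def)

lemma bump_bounds: "0 \<le> bump m a b t" "bump m a b t \<le> 1"
  unfolding bump_def using flat_exp_1_bounds by (auto intro: mult_le_one)

lemma bump_eq_0: "t \<notin> {a<..<b} \<Longrightarrow> bump m a b t = 0"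
  by (auto simp: bump_def flat_exp_def zero_less_mult_iff)

lemma flat_exp_tendsto_1:
  assumes "s > 0"
  shows "(\<lambda>m. flat_exp 1 (real (Suc m) * s)) \<longlonglongrightarrow> 1"
proof -
  have "(\<lambda>m. exp (- (inverse (real (Suc m)) * (1 / s)))) \<longlonglongrightarrow> exp (- (0 * (1 / s)))"
    by (intro tendsto_intros LIMSEQ_inverse_real_of_nat)
  moreover have "flat_exp 1 (real (Suc m) * s) = exp (- (inverse (real (Suc m)) * (1 / s)))" for m
    using assms by (simp add: flat_exp_def zero_less_mult_iff divide_simps)
  ultimately show ?thesis by simp
qed

lemma bump_tendsto: "(\<lambda>m. bump m a b t) \<longlonglongrightarrow> indicator {a<..<b} t"
proof (cases "t \<in> {a<..<b}")
  case True
  then have "(\<lambda>m. bump m a b t) \<longlonglongrightarrow> 1 * 1"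
    unfolding bump_def by (intro tendsto_mult flat_exp_tendsto_1) auto
  then show ?thesis using True by simp
qed (simp add: bump_eq_0)

text \<open>Products of functions of one variable are stable under partial derivatives, so
  smoothness in \<open>d\<close> variables follows from that of the factors.\<close>

definition prod_fun :: "nat \<Rightarrow> (nat \<Rightarrow> real \<Rightarrow> real) \<Rightarrow> cfun" where
  "prod_fun d \<psi> x = complex_of_real (\<Prod>i<d. \<psi> i (x i))"

lemma prod_fun_update:
  assumes "k < d"
  shows "prod_fun d \<psi> (x(k := t)) = complex_of_real ((\<Prod>i\<in>{..<d} - {k}. \<psi> i (x i)) * \<psi> k t)"
proof -
  have "(\<Prod>i<d. \<psi> i ((x(k := t)) i)) = \<psi> k t * (\<Prod>i\<in>{..<d} - {k}. \<psi> i ((x(k := t)) i))"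
    using assms by (subst prod.remove[of _ k]) auto
  also have "(\<Prod>i\<in>{..<d} - {k}. \<psi> i ((x(k := t)) i)) = (\<Prod>i\<in>{..<d} - {k}. \<psi> i (x i))"
    by (rule prod.cong) auto
  finally show ?thesis unfolding prod_fun_def by (simp only: mult.commute)
qed

lemma prod_fun_has_vector_derivative:
  assumes "k < d" "smooth_real (\<psi> k)"
  shows "((\<lambda>t. prod_fun d \<psi> (x(k := t))) has_vector_derivative
    prod_fun d (\<psi>(k := deriv (\<psi> k))) (x(k := s))) (at s)"
proof -
  have "prod_fun d (\<psi>(k := deriv (\<psi> k))) (x(k := s))
      = complex_of_real ((\<Prod>i\<in>{..<d} - {k}. \<psi> i (x i)) * deriv (\<psi> k) s)"
    unfolding prod_fun_update[OF assms(1)] by (auto intro!: prod.cong)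
  moreover have "((\<lambda>t. (\<Prod>i\<in>{..<d} - {k}. \<psi> i (x i)) * \<psi> k t) has_real_derivative
      (\<Prod>i\<in>{..<d} - {k}. \<psi> i (x i)) * deriv (\<psi> k) s) (at s)"
    by (intro DERIV_cmult smooth_real_deriv assms)
  ultimately show ?thesis
    unfolding prod_fun_update[OF assms(1)]
    by (simp only: has_vector_derivative_of_real has_real_derivative_iff_has_vector_derivative)
qed

lemma partial_deriv_prod_fun:
  assumes "k < d" "smooth_real (\<psi> k)"
  shows "partial_deriv k (prod_fun d \<psi>) = prod_fun d (\<psi>(k := deriv (\<psi> k)))"
proof
  fix x
  show "partial_deriv k (prod_fun d \<psi>) x = prod_fun d (\<psi>(k := deriv (\<psi> k))) x"
    unfolding partial_deriv_def
    using vector_derivative_at[OF prod_fun_has_vector_derivative[where d = d and \<psi> = \<psi> and k = k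
          and x = x and s = "x k"]] assms by simp
qed

lemma foldr_partial_deriv_prod_fun:
  assumes "set ks \<subseteq> {..<d}" "\<forall>i. smooth_real (\<psi> i)"
  obtains \<psi>' where "\<forall>i. smooth_real (\<psi>' i)" "foldr partial_deriv ks (prod_fun d \<psi>) = prod_fun d \<psi>'"
  using assms(1)
proof (induction ks arbitrary: thesis)
  case Nil
  then show ?case using assms(2) by auto
next
  case (Cons k ks)
  obtain \<psi>' where \<psi>': "\<forall>i. smooth_real (\<psi>' i)" "foldr partial_deriv ks (prod_fun d \<psi>) = prod_fun d \<psi>'"
    using Cons.IH Cons.prems by auto
  show ?case
  proof (rule Cons.prems(1))
    show "\<forall>i. smooth_real ((\<psi>'(k := deriv (\<psi>' k))) i)" using \<psi>' smooth_real_deriv by auto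
    show "foldr partial_deriv (k # ks) (prod_fun d \<psi>) = prod_fun d (\<psi>'(k := deriv (\<psi>' k)))"
      using \<psi>' Cons.prems(2) by (simp add: partial_deriv_prod_fun)
  qed
qed

lemma continuous_map_prod_fun:
  assumes "\<forall>i. continuous_on UNIV (\<psi> i)"
  shows "continuous_map (eucl d) euclidean (prod_fun d \<psi>)"
proof -
  have "continuous_map (eucl d) euclideanreal (\<lambda>x. \<Prod>i\<in>I. \<psi> i (x i))" if "finite I" "I \<subseteq> {..<d}" for I
    using that
  proof (induction I)
    case (insert i I)
    have "continuous_map (eucl d) euclideanreal (\<psi> i \<circ> (\<lambda>x. x i))"
      using insert.prems assms
      by (intro continuous_map_compose[OF continuous_map_product_projection]) auto
    then show ?case using insert by (simp add: o_def continuous_map_real_mult)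
  qed simp
  then have "continuous_map (eucl d) euclidean (complex_of_real \<circ> (\<lambda>x. \<Prod>i<d. \<psi> i (x i)))"
    by (intro continuous_map_compose[where X' = euclideanreal]) (auto intro!: continuous_intros)
  then show ?thesis by (simp add: o_def prod_fun_def[abs_def])
qed

lemma smooth_prod_fun:
  assumes "\<forall>i. smooth_real (\<psi> i)"
  shows "smooth d (prod_fun d \<psi>)"
  unfolding smooth_def
proof (intro allI impI)
  fix ks assume ks: "set ks \<subseteq> {..<d}"
  obtain \<psi>' where \<psi>': "\<forall>i. smooth_real (\<psi>' i)" "foldr partial_deriv ks (prod_fun d \<psi>) = prod_fun d \<psi>'"
    using foldr_partial_deriv_prod_fun[OF ks assms] .
  show "continuous_map (eucl d) euclidean (foldr partial_deriv ks (prod_fun d \<psi>)) \<and>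
    (\<forall>x\<in>topspace (eucl d). \<forall>k<d.
      (\<lambda>t. foldr partial_deriv ks (prod_fun d \<psi>) (x(k := t))) differentiable at (x k))"
    unfolding \<psi>'(2)
  proof (intro conjI ballI allI impI)
    show "continuous_map (eucl d) euclidean (prod_fun d \<psi>')"
      using \<psi>' by (intro continuous_map_prod_fun) (auto intro: smooth_real_continuous)
    fix x k assume "k < d"
    then show "(\<lambda>t. prod_fun d \<psi>' (x(k := t))) differentiable at (x k)"
      using \<psi>'(1) prod_fun_has_vector_derivative
      by (intro differentiableI_vector) blast
  qed
qed

section \<open>Bumps on boxes and the fundamental lemma of the calculus of variations\<close>

definition box_bump :: "nat \<Rightarrow> nat \<Rightarrow> point \<Rightarrow> point \<Rightarrow> cfun" where
  "box_bump d m a b = prod_fun d (\<lambda>i. bump m (a i) (b i))"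

lemma box_bump_tendsto:
  assumes "x \<in> topspace (eucl d)"
  shows "(\<lambda>m. box_bump d m a b x) \<longlonglongrightarrow> indicator (open_box d a b) x"
proof -
  have "(\<lambda>m. box_bump d m a b x) \<longlonglongrightarrow> complex_of_real (\<Prod>i<d. indicator {a i<..<b i} (x i))"
    unfolding box_bump_def prod_fun_def by (intro tendsto_of_real tendsto_prod bump_tendsto)
  also have "(\<Prod>i<d. indicator {a i<..<b i} (x i)) = (indicator (open_box d a b) x :: real)"
  proof (cases "x \<in> open_box d a b")
    case True
    then show ?thesis by (simp add: open_box_def PiE_iff)
  next
    case False
    then obtain i where "i < d" "x i \<notin> {a i<..<b i}"
      using assms by (auto simp: open_box_def PiE_iff simp del: greaterThanLessThan_iff)
    then have "(\<Prod>i<d. indicator {a i<..<b i} (x i)) = (0::real)"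
      by (intro prod_zero bexI[of _ i]) (auto simp del: greaterThanLessThan_iff)
    then show ?thesis using False by simp
  qed
  finally show ?thesis by (simp add: of_real_indicator)
qed

lemma box_bump_eq_0:
  assumes "x \<in> topspace (eucl d)" "x \<notin> open_box d a b"
  shows "box_bump d m a b x = 0"
proof -
  obtain i where i: "i < d" "x i \<notin> {a i<..<b i}"
    using assms by (auto simp: open_box_def PiE_iff simp del: greaterThanLessThan_iff)
  then have "(\<Prod>i<d. bump m (a i) (b i) (x i)) = 0"
    using bump_eq_0 by (intro prod_zero bexI[of _ i]) (auto simp del: greaterThanLessThan_iff)
  then show ?thesis by (simp add: box_bump_def prod_fun_def)
qed

lemma cmod_box_bump_le: "cmod (box_bump d m a b x) \<le> 1"
proof -
  have "0 \<le> (\<Prod>i<d. bump m (a i) (b i) (x i))" "(\<Prod>i<d. bump m (a i) (b i) (x i)) \<le> 1"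
    using bump_bounds by (auto intro: prod_nonneg prod_le_1)
  then show ?thesis by (simp only: box_bump_def prod_fun_def norm_of_real abs_of_nonneg)
qed

lemma box_bump_test_function:
  assumes "closed_box d a b \<subseteq> \<Omega>"
  shows "box_bump d m a b \<in> test_functions d \<Omega>"
  unfolding test_functions_def
proof (intro CollectI conjI exI)
  show "smooth d (box_bump d m a b)"
    unfolding box_bump_def by (intro smooth_prod_fun allI smooth_bump)
  show "compactin (eucl d) (closed_box d a b)"
    unfolding closed_box_def by (auto simp: compactin_PiE)
  show "closed_box d a b \<subseteq> \<Omega>" by fact
  show "\<forall>x\<in>topspace (eucl d) - closed_box d a b. box_bump d m a b x = 0"
    using box_bump_eq_0 open_box_subset by blast
qed

text \<open>Bumps on a box converge to its indicator and are dominated by it, so orthogonality to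
  test functions passes to integrals over boxes by dominated convergence. Uniqueness of weak
  derivatives rests on this.\<close>

lemma AE_zero_if_orthogonal_to_test_functions:
  assumes \<Omega>: "openin (eucl d) \<Omega>" and g: "g \<in> L2 d \<Omega>"
    and orth: "\<And>\<phi>. \<phi> \<in> test_functions d \<Omega> \<Longrightarrow> (\<integral>x. g x * \<phi> x \<partial>leb_on d \<Omega>) = 0"
  shows "AE x in leb_on d \<Omega>. g x = 0"
proof (rule L2_AE_zero_if_box_integrals_zero[OF \<Omega> g])
  fix a b assume ab: "closed_box d a b \<subseteq> \<Omega>"
  have top: "x \<in> topspace (eucl d)" if "x \<in> space (leb_on d \<Omega>)" for x
    using that space_leb_on[OF \<Omega>] openin_subset[OF \<Omega>] by blast
  have [measurable]: "g \<in> borel_measurable (leb_on d \<Omega>)" using g by (rule L2_measurable)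
  have int: "integrable (leb_on d \<Omega>) (\<lambda>x. indicator (open_box d a b) x * g x)"
    by (rule L2_integrable_mult[OF indicator_open_box_L2[OF \<Omega>] g])
  have "(\<lambda>m. \<integral>x. g x * box_bump d m a b x \<partial>leb_on d \<Omega>)
    \<longlonglongrightarrow> (\<integral>x. indicator (open_box d a b) x * g x \<partial>leb_on d \<Omega>)"
  proof (rule integral_dominated_convergence)
    show "integrable (leb_on d \<Omega>) (\<lambda>x. norm (indicator (open_box d a b) x * g x))"
      using int by (rule integrable_norm)
    show "AE x in leb_on d \<Omega>. (\<lambda>m. g x * box_bump d m a b x) \<longlonglongrightarrow> indicator (open_box d a b) x * g x"
    proof (rule AE_I2)
      fix x assume "x \<in> space (leb_on d \<Omega>)"
      from tendsto_mult[OF tendsto_const box_bump_tendsto[OF top[OF this]], of "g x"]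
      show "(\<lambda>m. g x * box_bump d m a b x) \<longlonglongrightarrow> indicator (open_box d a b) x * g x"
        by (simp add: mult.commute)
    qed
    show "AE x in leb_on d \<Omega>. norm (g x * box_bump d m a b x) \<le> norm (indicator (open_box d a b) x * g x)" for m
    proof (rule AE_I2)
      fix x assume x: "x \<in> space (leb_on d \<Omega>)"
      show "norm (g x * box_bump d m a b x) \<le> norm (indicator (open_box d a b) x * g x)"
        using box_bump_eq_0[OF top[OF x], of a b m] cmod_box_bump_le[of d m a b x]
        by (cases "x \<in> open_box d a b") (auto simp: norm_mult mult_left_le)
    qed
    have "box_bump d m a b \<in> borel_measurable (leb_on d \<Omega>)" for m
    proof (rule measurable_leb_on)
      have "bump m (a i) (b i) \<in> borel_measurable borel" for i
        by (intro borel_measurable_continuous_onI smooth_real_continuous smooth_bump)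
      then show "box_bump d m a b \<in> borel_measurable (leb d)"
        unfolding box_bump_def prod_fun_def[abs_def] by measurable
    qed
    then show "(\<lambda>x. g x * box_bump d m a b x) \<in> borel_measurable (leb_on d \<Omega>)" for m
      by measurable
    show "(\<lambda>x. indicator (open_box d a b) x * g x) \<in> borel_measurable (leb_on d \<Omega>)"
      using int by auto
  qed
  moreover have "(\<integral>x. g x * box_bump d m a b x \<partial>leb_on d \<Omega>) = 0" for m
    by (intro orth box_bump_test_function ab)
  ultimately show "(\<integral>x. indicator (open_box d a b) x * g x \<partial>leb_on d \<Omega>) = 0"
    by (simp add: LIMSEQ_const_iff)
qed

section \<open>Weak derivatives\<close>

lemma continuous_map_borel_measurable:
  fixes \<phi> :: "point \<Rightarrow> 'b::topological_space"
  assumes "continuous_map (eucl d) euclidean \<phi>"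
  shows "\<phi> \<in> borel_measurable (leb d)"
proof (rule borel_measurableI)
  fix S :: "'b set" assume "open S"
  then have "openin (eucl d) {x \<in> topspace (eucl d). \<phi> x \<in> S}"
    using assms by (intro openin_continuous_map_preimage) auto
  from sets_leb_open[OF this] show "\<phi> -` S \<inter> space (leb d) \<in> sets (leb d)"
    by (simp only: space_leb vimage_def Int_def mem_Collect_eq conj_commute)
qed

lemma test_functionE:
  assumes "\<phi> \<in> test_functions d \<Omega>"
  obtains K where "smooth d \<phi>" "compactin (eucl d) K" "K \<subseteq> \<Omega>"
    "\<forall>x\<in>topspace (eucl d) - K. \<phi> x = 0"
  using assms unfolding test_functions_def by blast

lemma smooth_continuous: "smooth d \<phi> \<Longrightarrow> continuous_map (eucl d) euclidean \<phi>"
  unfolding smooth_def by (erule allE[of _ "[]"]) simp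

lemma compactin_subset_open_box:
  assumes "compactin (eucl d) K"
  obtains a b where "K \<subseteq> open_box d a b"
proof -
  have "\<exists>c. \<forall>x\<in>K. \<bar>x i\<bar> \<le> c" if "i < d" for i
  proof -
    have "compactin euclideanreal ((\<lambda>x. x i) ` K)"
      using assms that by (intro image_compactin[OF assms] continuous_map_product_projection) auto
    then have "bounded ((\<lambda>x. x i) ` K)" by (simp add: compact_imp_bounded)
    then show ?thesis by (simp add: bounded_iff)
  qed
  then obtain c where c: "\<And>i x. i < d \<Longrightarrow> x \<in> K \<Longrightarrow> \<bar>x i\<bar> \<le> c i" by metis
  have K: "K \<subseteq> topspace (eucl d)" using assms by (rule compactin_subset_topspace)
  show ?thesis
  proof (rule that, rule subsetI)
    fix x assume x: "x \<in> K"
    have "x \<in> extensional {..<d}" using K x by (auto simp: PiE_def)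
    moreover have "- c i - 1 < x i \<and> x i < c i + 1" if "i < d" for i using c[OF that x] by linarith
    ultimately show "x \<in> open_box d (\<lambda>i. - c i - 1) (\<lambda>i. c i + 1)"
      by (simp add: open_box_def PiE_iff)
  qed
qed

lemma test_function_L2:
  assumes \<Omega>: "openin (eucl d) \<Omega>" and \<phi>: "\<phi> \<in> test_functions d \<Omega>"
  shows "\<phi> \<in> L2 d \<Omega>"
proof -
  from \<phi> obtain K where K: "smooth d \<phi>" "compactin (eucl d) K" "K \<subseteq> \<Omega>"
    "\<forall>x\<in>topspace (eucl d) - K. \<phi> x = 0" by (rule test_functionE)
  have cont: "continuous_map (eucl d) euclidean \<phi>" using K(1) by (rule smooth_continuous)
  obtain a b where ab: "K \<subseteq> open_box d a b" using compactin_subset_open_box[OF K(2)] .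
  have "compactin euclidean (\<phi> ` K)" by (rule image_compactin[OF K(2) cont])
  then have "bounded (\<phi> ` K)" by (simp add: compact_imp_bounded)
  then obtain C where C: "\<And>x. x \<in> K \<Longrightarrow> cmod (\<phi> x) \<le> C" by (auto simp: bounded_iff)
  show ?thesis
  proof (rule L2_bounded)
    show "csmult C (\<lambda>x. indicator (open_box d a b) x) \<in> L2 d \<Omega>"
      by (intro L2_csmult indicator_open_box_L2 \<Omega>)
    show "\<phi> \<in> borel_measurable (leb_on d \<Omega>)"
      by (intro measurable_leb_on continuous_map_borel_measurable cont)
    fix x assume "x \<in> space (leb_on d \<Omega>)"
    then have x: "x \<in> topspace (eucl d)" using space_leb_on[OF \<Omega>] openin_subset[OF \<Omega>] by blast
    show "cmod (\<phi> x) \<le> cmod (csmult C (\<lambda>x. indicator (open_box d a b) x) x)"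
    proof (cases "x \<in> K")
      case True
      then have "x \<in> open_box d a b" using ab by blast
      then show ?thesis using C[OF True] by simp
    next
      case False
      then show ?thesis using K(4) x by simp
    qed
  qed
qed

lemma fun_upd_topspace:
  assumes "x \<in> topspace (eucl d)" "k < d"
  shows "x(k := t) \<in> topspace (eucl d)"
proof -
  have "x \<in> extensional {..<d}" using assms(1) by (simp add: PiE_iff)
  then show ?thesis using assms(2) by (simp add: PiE_iff extensional_def)
qed

lemma continuous_map_fun_upd:
  assumes "k < d" "x \<in> topspace (eucl d)"
  shows "continuous_map euclideanreal (eucl d) (\<lambda>t. x(k := t))"
proof -
  have "continuous_map euclideanreal euclideanreal (\<lambda>t. (x(k := t)) i)" for i
    by (cases "i = k") simp_all
  moreover have "(\<lambda>t. x(k := t)) ` topspace euclideanreal \<subseteq> extensional {..<d}"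
    using fun_upd_topspace[OF assms(2,1)] by (auto simp: PiE_def)
  ultimately show ?thesis by (simp add: continuous_map_componentwise)
qed

lemma test_function_partial_deriv:
  assumes \<phi>: "\<phi> \<in> test_functions d \<Omega>" and k: "k < d"
  shows "partial_deriv k \<phi> \<in> test_functions d \<Omega>"
proof -
  from \<phi> obtain K where K: "smooth d \<phi>" "compactin (eucl d) K" "K \<subseteq> \<Omega>"
    "\<forall>x\<in>topspace (eucl d) - K. \<phi> x = 0" by (rule test_functionE)
  have "smooth d (partial_deriv k \<phi>)"
    unfolding smooth_def
  proof (intro allI impI)
    fix ks assume ks: "set ks \<subseteq> {..<d}"
    then have "set (ks @ [k]) \<subseteq> {..<d}" using k by auto
    with K(1) have "continuous_map (eucl d) euclidean (foldr partial_deriv (ks @ [k]) \<phi>) \<and>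
      (\<forall>x\<in>topspace (eucl d). \<forall>k'<d.
       (\<lambda>t. foldr partial_deriv (ks @ [k]) \<phi> (x(k' := t))) differentiable at (x k'))"
      unfolding smooth_def by blast
    then show "continuous_map (eucl d) euclidean (foldr partial_deriv ks (partial_deriv k \<phi>)) \<and>
      (\<forall>x\<in>topspace (eucl d). \<forall>k'<d.
       (\<lambda>t. foldr partial_deriv ks (partial_deriv k \<phi>) (x(k' := t))) differentiable at (x k'))" by simp
  qed
  moreover have "partial_deriv k \<phi> x = 0" if x: "x \<in> topspace (eucl d)" "x \<notin> K" for x
  proof -
    \<comment> \<open>Compact sets are closed here, so at a point off \<open>K\<close> the function
      vanishes on a whole interval around \<open>x k\<close> along the \<open>k\<close>-th axis. The
      derivative is therefore supported in the same \<open>K\<close>.\<close>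
    have "Hausdorff_space (eucl d)" by (simp add: Hausdorff_space_product_topology)
    then have "closedin (eucl d) K" using K(2) compactin_imp_closedin by blast
    then have "openin (eucl d) (topspace (eucl d) - K)" by blast
    from openin_continuous_map_preimage[OF continuous_map_fun_upd[OF k x(1)] this]
    have op: "open {t. x(k := t) \<in> topspace (eucl d) - K}" by simp
    have "((\<lambda>t. \<phi> (x(k := t))) has_vector_derivative 0) (at (x k))"
    proof (rule has_vector_derivative_transform_within_open[OF has_vector_derivative_const op])
      show "x k \<in> {t. x(k := t) \<in> topspace (eucl d) - K}" using x by simp
      fix t assume "t \<in> {t. x(k := t) \<in> topspace (eucl d) - K}"
      then show "0 = \<phi> (x(k := t))" using K(4) by simp
    qed
    then show ?thesis unfolding partial_deriv_def by (rule vector_derivative_at)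
  qed
  ultimately show ?thesis unfolding test_functions_def using K(2,3) by blast
qed

lemma test_function_foldr_partial_deriv:
  "set ks \<subseteq> {..<d} \<Longrightarrow> \<phi> \<in> test_functions d \<Omega>
    \<Longrightarrow> foldr (\<lambda>i. partial_deriv i ^^ \<alpha> i) ks \<phi> \<in> test_functions d \<Omega>"
proof (induction ks)
  case (Cons k ks)
  have "(partial_deriv k ^^ m) \<psi> \<in> test_functions d \<Omega>" if "\<psi> \<in> test_functions d \<Omega>" for m \<psi>
    using that Cons.prems(1) by (induction m) (auto intro: test_function_partial_deriv)
  with Cons show ?case by simp
qed simp

lemma test_function_multi_deriv:
  "\<phi> \<in> test_functions d \<Omega> \<Longrightarrow> multi_deriv d \<alpha> \<phi> \<in> test_functions d \<Omega>"
  unfolding multi_deriv_def by (rule test_function_foldr_partial_deriv) auto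

lemma foldr_single:
  assumes "distinct xs" "\<And>i. i \<in> set xs \<Longrightarrow> i \<noteq> k \<Longrightarrow> g i = id"
  shows "foldr g xs \<phi> = (if k \<in> set xs then g k \<phi> else \<phi>)"
  using assms by (induction xs) (auto, metis id_apply)

lemma multi_deriv_unit:
  assumes "k < d"
  shows "multi_deriv d (mi_unit k) \<phi> = partial_deriv k \<phi>"
  unfolding multi_deriv_def
  using assms by (subst foldr_single[where k = k]) (auto simp: mi_unit_def id_def)

text \<open>\<open>foldr\<close> applies the largest index first, which is why the lemma is stated
  for \<open>k < l\<close>; later uses arrange their coordinates accordingly.\<close>

lemma multi_deriv_two_units:
  assumes "k < l" "l < d"
  shows "multi_deriv d (mi_unit k + mi_unit l) \<phi> = partial_deriv k (partial_deriv l \<phi>)"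
proof -
  let ?g = "\<lambda>i. partial_deriv i ^^ (mi_unit k + mi_unit l) i"
  have "[0..<d] = [0..<l] @ [l..<d]" using assms upt_add_eq_append[of 0 l "d - l"] by simp
  moreover have "foldr ?g [l..<d] \<phi> = partial_deriv l \<phi>"
    using assms by (subst foldr_single[where k = l]) (auto simp: mi_unit_def id_def)
  moreover have "foldr ?g [0..<l] \<psi> = partial_deriv k \<psi>" for \<psi>
    using assms by (subst foldr_single[where k = k]) (auto simp: mi_unit_def id_def)
  ultimately show ?thesis unfolding multi_deriv_def by simp
qed

lemma mi_order_unit: "k < d \<Longrightarrow> mi_order d (mi_unit k) = 1"
  unfolding mi_order_def mi_unit_def by simp

lemma mi_order_add: "mi_order d (\<alpha> + \<beta>) = mi_order d \<alpha> + mi_order d \<beta>"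
  unfolding mi_order_def by (simp add: sum.distrib)

lemma mi_order_1:
  assumes "\<alpha> \<in> multiindices d" "mi_order d \<alpha> = 1"
  obtains k where "k < d" "\<alpha> = mi_unit k"
proof -
  have "(\<Sum>i<d. \<alpha> i) = 1" using assms(2) by (simp add: mi_order_def)
  then obtain k where k: "k < d" "\<alpha> k = 1" "\<And>i. i < d \<Longrightarrow> i \<noteq> k \<Longrightarrow> \<alpha> i = 0"
    by (auto simp: sum_eq_Suc0_iff)
  have "\<alpha> = mi_unit k"
    using k assms(1) unfolding multiindices_def mi_unit_def by (auto simp: fun_eq_iff) (metis not_less)
  then show ?thesis using k that by blast
qed

section \<open>Calculus of weak derivatives\<close>

lemma has_weak_derivD:
  assumes "has_weak_deriv d \<Omega> \<alpha> f g"
  shows "f \<in> L2 d \<Omega>" "g \<in> L2 d \<Omega>"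
    "\<phi> \<in> test_functions d \<Omega> \<Longrightarrow> (\<integral>x. f x * multi_deriv d \<alpha> \<phi> x \<partial>leb_on d \<Omega>)
          = (-1) ^ mi_order d \<alpha> * (\<integral>x. g x * \<phi> x \<partial>leb_on d \<Omega>)"
  using assms unfolding has_weak_deriv_def by blast+

text \<open>The pairing with test functions is bilinear, the inner product sesquilinear. Conjugating
  the test function makes linearity and continuity of the inner product available for weak
  derivatives.\<close>

lemma integral_mult_eq_inner: "(\<integral>x. f x * \<phi> x \<partial>leb_on d \<Omega>) = L2_inner d \<Omega> f (\<lambda>x. cnj (\<phi> x))"
  by (simp add: L2_inner_def)

lemma has_weak_deriv_csmult:
  assumes "has_weak_deriv d \<Omega> \<alpha> f g"
  shows "has_weak_deriv d \<Omega> \<alpha> (csmult c f) (csmult c g)"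
  unfolding has_weak_deriv_def
proof (intro conjI ballI)
  note f = has_weak_derivD[OF assms(1)]
  show "csmult c f \<in> L2 d \<Omega>" "csmult c g \<in> L2 d \<Omega>" using f by (auto intro: L2_csmult)
  fix \<phi> assume \<phi>: "\<phi> \<in> test_functions d \<Omega>"
  show "(\<integral>x. csmult c f x * multi_deriv d \<alpha> \<phi> x \<partial>leb_on d \<Omega>)
    = (-1) ^ mi_order d \<alpha> * (\<integral>x. csmult c g x * \<phi> x \<partial>leb_on d \<Omega>)"
    using f(3)[OF \<phi>] unfolding integral_mult_eq_inner L2_inner_csmult_left by simp
qed

lemma has_weak_deriv_zero: "has_weak_deriv d \<Omega> \<alpha> 0 0"
  by (simp add: has_weak_deriv_def L2_zero)

lemma has_weak_deriv_0: "f \<in> L2 d \<Omega> \<Longrightarrow> mi_order d \<alpha> = 0 \<Longrightarrow> has_weak_deriv d \<Omega> \<alpha> f f"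
proof -
  assume "f \<in> L2 d \<Omega>" and \<alpha>: "mi_order d \<alpha> = 0"
  moreover have "foldr (\<lambda>i. partial_deriv i ^^ \<alpha> i) ks \<phi> = \<phi>" if "set ks \<subseteq> {..<d}" for ks \<phi>
    using that \<alpha> by (induction ks) (auto simp: mi_order_def)
  ultimately show ?thesis
    by (simp add: has_weak_deriv_def multi_deriv_def lessThan_atLeast0)
qed

lemma has_weak_deriv_weak_deriv:
  "has_weak_deriv d \<Omega> \<alpha> f g \<Longrightarrow> has_weak_deriv d \<Omega> \<alpha> f (weak_deriv d \<Omega> \<alpha> f)"
  unfolding weak_deriv_def by (rule someI[where P = "has_weak_deriv d \<Omega> \<alpha> f"])

lemma L2_norm_le_H1_norm: "L2_norm d \<Omega> f \<le> H1_norm d \<Omega> f"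
  unfolding H1_norm_def by (intro real_le_rsqrt) (simp add: sum_nonneg)

context
  fixes d \<Omega>
  assumes \<Omega>: "openin (eucl d) \<Omega>"
begin

lemma cnj_test_L2: "\<phi> \<in> test_functions d \<Omega> \<Longrightarrow> (\<lambda>x. cnj (\<phi> x)) \<in> L2 d \<Omega>"
  by (intro L2_cnj test_function_L2 \<Omega>)

lemmas cnj_multi_L2 = cnj_test_L2[OF test_function_multi_deriv]

lemma has_weak_deriv_unique:
  assumes "has_weak_deriv d \<Omega> \<alpha> f g" "has_weak_deriv d \<Omega> \<alpha> f g'"
  shows "AE x in leb_on d \<Omega>. g x = g' x"
proof -
  note g = has_weak_derivD(2)[OF assms(1)] has_weak_derivD(2)[OF assms(2)]
  have "AE x in leb_on d \<Omega>. (g - g') x = 0"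
  proof (rule AE_zero_if_orthogonal_to_test_functions[OF \<Omega> L2_diff[OF g]])
    fix \<phi> assume \<phi>: "\<phi> \<in> test_functions d \<Omega>"
    have "(\<integral>x. (g - g') x * \<phi> x \<partial>leb_on d \<Omega>)
        = (\<integral>x. g x * \<phi> x \<partial>leb_on d \<Omega>) - (\<integral>x. g' x * \<phi> x \<partial>leb_on d \<Omega>)"
      unfolding integral_mult_eq_inner by (intro L2_inner_diff_left g cnj_test_L2 \<phi>)
    also have "\<dots> = 0"
    proof -
      have "(-1 :: complex) ^ m * a = (-1) ^ m * b \<Longrightarrow> a = b" for m a b
        by simp
      then show ?thesis
        using has_weak_derivD(3)[OF assms(1) \<phi>] has_weak_derivD(3)[OF assms(2) \<phi>] by force
    qed
    finally show "(\<integral>x. (g - g') x * \<phi> x \<partial>leb_on d \<Omega>) = 0" .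
  qed
  then show ?thesis by simp
qed

lemma has_weak_deriv_add:
  assumes "has_weak_deriv d \<Omega> \<alpha> f g" "has_weak_deriv d \<Omega> \<alpha> f' g'"
  shows "has_weak_deriv d \<Omega> \<alpha> (f + f') (g + g')"
  unfolding has_weak_deriv_def
proof (intro conjI ballI)
  note f = has_weak_derivD[OF assms(1)] and f' = has_weak_derivD[OF assms(2)]
  show "f + f' \<in> L2 d \<Omega>" "g + g' \<in> L2 d \<Omega>" using f f' by (auto intro: L2_add)
  fix \<phi> assume \<phi>: "\<phi> \<in> test_functions d \<Omega>"
  show "(\<integral>x. (f + f') x * multi_deriv d \<alpha> \<phi> x \<partial>leb_on d \<Omega>)
    = (-1) ^ mi_order d \<alpha> * (\<integral>x. (g + g') x * \<phi> x \<partial>leb_on d \<Omega>)"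
    using f(3)[OF \<phi>] f'(3)[OF \<phi>] unfolding integral_mult_eq_inner
    by (simp only: L2_inner_add_left f(1,2) f'(1,2) cnj_test_L2[OF \<phi>] cnj_multi_L2[OF \<phi>] distrib_left)
qed

lemma has_weak_deriv_diff:
  assumes "has_weak_deriv d \<Omega> \<alpha> f g" "has_weak_deriv d \<Omega> \<alpha> f' g'"
  shows "has_weak_deriv d \<Omega> \<alpha> (f - f') (g - g')"
  unfolding diff_eq_csmult by (intro has_weak_deriv_add has_weak_deriv_csmult assms)

text \<open>\<open>partial_deriv l \<phi>\<close> is again a test function, so the identity for
  \<open>g\<close> may be tested against it, followed by the identity for \<open>h\<close> against
  \<open>\<phi>\<close>; the two signs multiply. The condition \<open>k < l\<close> matches the
  order in which \<open>multi_deriv\<close> differentiates.\<close>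

lemma has_weak_deriv_compose:
  assumes kl: "k < l" "l < d"
    and "has_weak_deriv d \<Omega> (mi_unit k) f g" "has_weak_deriv d \<Omega> (mi_unit l) g h"
  shows "has_weak_deriv d \<Omega> (mi_unit k + mi_unit l) f h"
  unfolding has_weak_deriv_def
proof (intro conjI ballI)
  note f = has_weak_derivD[OF assms(3)] and g = has_weak_derivD[OF assms(4)]
  show "f \<in> L2 d \<Omega>" "h \<in> L2 d \<Omega>" using f g by auto
  fix \<phi> assume \<phi>: "\<phi> \<in> test_functions d \<Omega>"
  show "(\<integral>x. f x * multi_deriv d (mi_unit k + mi_unit l) \<phi> x \<partial>leb_on d \<Omega>)
    = (-1) ^ mi_order d (mi_unit k + mi_unit l) * (\<integral>x. h x * \<phi> x \<partial>leb_on d \<Omega>)"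
    using f(3)[OF test_function_partial_deriv[OF \<phi> kl(2)]] g(3)[OF \<phi>] kl
    by (simp add: multi_deriv_two_units multi_deriv_unit mi_order_add mi_order_unit)
qed

text \<open>For a fixed test function both sides of the defining identity are continuous in L2, so
  weak differentiation is a closed operation. This carries second derivatives from the core to the
  whole domain of \<open>T\<close>.\<close>

lemma has_weak_deriv_limit:
  assumes fg: "\<And>m. has_weak_deriv d \<Omega> \<alpha> (f m) (g m)" and L2: "f' \<in> L2 d \<Omega>" "g' \<in> L2 d \<Omega>"
    and lim: "(\<lambda>m. L2_norm d \<Omega> (f m - f')) \<longlonglongrightarrow> 0" "(\<lambda>m. L2_norm d \<Omega> (g m - g')) \<longlonglongrightarrow> 0"
  shows "has_weak_deriv d \<Omega> \<alpha> f' g'"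
  unfolding has_weak_deriv_def
proof (intro conjI ballI)
  fix \<phi> assume \<phi>: "\<phi> \<in> test_functions d \<Omega>"
  have c: "(\<lambda>m::nat. L2_norm d \<Omega> (u - u)) \<longlonglongrightarrow> 0" for u
    by (simp add: L2_norm_def)
  have "(\<lambda>m. \<integral>x. f m x * multi_deriv d \<alpha> \<phi> x \<partial>leb_on d \<Omega>) \<longlonglongrightarrow> (\<integral>x. f' x * multi_deriv d \<alpha> \<phi> x \<partial>leb_on d \<Omega>)"
    unfolding integral_mult_eq_inner
    by (rule L2_inner_tendsto[OF has_weak_derivD(1)[OF fg] _ L2(1) _ lim(1) c]) (rule cnj_multi_L2[OF \<phi>])+
  moreover have "(\<lambda>m. (-1) ^ mi_order d \<alpha> * (\<integral>x. g m x * \<phi> x \<partial>leb_on d \<Omega>))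
      \<longlonglongrightarrow> (-1) ^ mi_order d \<alpha> * (\<integral>x. g' x * \<phi> x \<partial>leb_on d \<Omega>)"
    unfolding integral_mult_eq_inner
    by (intro tendsto_mult tendsto_const, rule L2_inner_tendsto[OF has_weak_derivD(2)[OF fg] _ L2(2) _ lim(2) c])
      (rule cnj_test_L2[OF \<phi>])+
  ultimately show "(\<integral>x. f' x * multi_deriv d \<alpha> \<phi> x \<partial>leb_on d \<Omega>)
    = (-1) ^ mi_order d \<alpha> * (\<integral>x. g' x * \<phi> x \<partial>leb_on d \<Omega>)"
    unfolding has_weak_derivD(3)[OF fg \<phi>] by (rule LIMSEQ_unique)
qed (use L2 in auto)

lemma weak_deriv_AE_eq:
  "has_weak_deriv d \<Omega> \<alpha> f g \<Longrightarrow> AE x in leb_on d \<Omega>. weak_deriv d \<Omega> \<alpha> f x = g x"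
  using has_weak_deriv_unique has_weak_deriv_weak_deriv by blast

text \<open>\<open>weak_deriv\<close> is an arbitrary representative. Inner products do not see the
  choice, so they may be computed from any explicit derivative.\<close>

lemma inner_weak_deriv:
  assumes "has_weak_deriv d \<Omega> \<alpha> f f'" "has_weak_deriv d \<Omega> \<alpha> g g'"
  shows "L2_inner d \<Omega> (weak_deriv d \<Omega> \<alpha> f) (weak_deriv d \<Omega> \<alpha> g) = L2_inner d \<Omega> f' g'"
  using assms by (intro L2_inner_cong_AE weak_deriv_AE_eq)
    (auto dest: has_weak_derivD has_weak_deriv_weak_deriv)

lemma norm_weak_deriv:
  assumes "has_weak_deriv d \<Omega> \<alpha> f f'"
  shows "L2_norm d \<Omega> (weak_deriv d \<Omega> \<alpha> f) = L2_norm d \<Omega> f'"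
  using assms by (intro L2_norm_cong_AE weak_deriv_AE_eq)
    (auto dest: has_weak_derivD has_weak_deriv_weak_deriv)

lemma dirichlet_form_eq:
  assumes "\<And>k. k < d \<Longrightarrow> has_weak_deriv d \<Omega> (mi_unit k) f (f' k)"
    "\<And>k. k < d \<Longrightarrow> has_weak_deriv d \<Omega> (mi_unit k) g (g' k)"
  shows "dirichlet_form d \<Omega> f g = (\<Sum>k<d. L2_inner d \<Omega> (f' k) (g' k))"
  unfolding dirichlet_form_def using assms by (intro sum.cong inner_weak_deriv) auto

section \<open>The Sobolev space of first order\<close>

lemma sobolev_1_iff:
  "f \<in> sobolev 1 d \<Omega> \<longleftrightarrow> f \<in> L2 d \<Omega> \<and> (\<forall>k<d. \<exists>g. has_weak_deriv d \<Omega> (mi_unit k) f g)"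
proof
  assume f: "f \<in> sobolev 1 d \<Omega>"
  have "\<exists>g. has_weak_deriv d \<Omega> (mi_unit k) f g" if k: "k < d" for k
  proof -
    have "mi_unit k \<in> multiindices d" using k by (auto simp: multiindices_def mi_unit_def)
    then show ?thesis using f mi_order_unit[OF k] unfolding sobolev_def by auto
  qed
  with f show "f \<in> L2 d \<Omega> \<and> (\<forall>k<d. \<exists>g. has_weak_deriv d \<Omega> (mi_unit k) f g)"
    by (simp add: sobolev_def)
next
  assume f: "f \<in> L2 d \<Omega> \<and> (\<forall>k<d. \<exists>g. has_weak_deriv d \<Omega> (mi_unit k) f g)"
  have "\<exists>g. has_weak_deriv d \<Omega> \<alpha> f g" if \<alpha>: "\<alpha> \<in> multiindices d" "mi_order d \<alpha> \<le> 1" for \<alpha>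
  proof (cases "mi_order d \<alpha> = 0")
    case True
    then show ?thesis using has_weak_deriv_0 f by blast
  next
    case False
    then have "mi_order d \<alpha> = 1" using \<alpha> by simp
    then show ?thesis using mi_order_1[OF \<alpha>(1)] f by metis
  qed
  then show "f \<in> sobolev 1 d \<Omega>" using f by (simp add: sobolev_def)
qed

lemma sobolev_1_has_weak_deriv:
  "f \<in> sobolev 1 d \<Omega> \<Longrightarrow> k < d \<Longrightarrow> has_weak_deriv d \<Omega> (mi_unit k) f (weak_deriv d \<Omega> (mi_unit k) f)"
  unfolding sobolev_1_iff using has_weak_deriv_weak_deriv by blast

lemma csubspace_sobolev_1: "csubspace (sobolev 1 d \<Omega>)"
proof (rule cfun.subspaceI)
  show "0 \<in> sobolev 1 d \<Omega>" unfolding sobolev_1_iff using L2_zero has_weak_deriv_zero by blast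
next
  fix f g assume "f \<in> sobolev 1 d \<Omega>" "g \<in> sobolev 1 d \<Omega>"
  then show "f + g \<in> sobolev 1 d \<Omega>"
    unfolding sobolev_1_iff using L2_add has_weak_deriv_add by blast
next
  fix c f assume "f \<in> sobolev 1 d \<Omega>"
  then show "csmult c f \<in> sobolev 1 d \<Omega>"
    unfolding sobolev_1_iff using L2_csmult has_weak_deriv_csmult by blast
qed

lemma weak_deriv_diff_le_H1_norm:
  assumes "f \<in> sobolev 1 d \<Omega>" "g \<in> sobolev 1 d \<Omega>" "k < d"
  shows "L2_norm d \<Omega> (weak_deriv d \<Omega> (mi_unit k) f - weak_deriv d \<Omega> (mi_unit k) g) \<le> H1_norm d \<Omega> (f - g)"
proof -
  have "L2_norm d \<Omega> (weak_deriv d \<Omega> (mi_unit k) f - weak_deriv d \<Omega> (mi_unit k) g)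
      = L2_norm d \<Omega> (weak_deriv d \<Omega> (mi_unit k) (f - g))"
    by (rule norm_weak_deriv[symmetric]) (intro has_weak_deriv_diff sobolev_1_has_weak_deriv assms)
  also have "\<dots> \<le> H1_norm d \<Omega> (f - g)"
    unfolding H1_norm_def
  proof (intro real_le_rsqrt)
    have "(L2_norm d \<Omega> (weak_deriv d \<Omega> (mi_unit k) (f - g)))\<^sup>2
        \<le> (\<Sum>k<d. (L2_norm d \<Omega> (weak_deriv d \<Omega> (mi_unit k) (f - g)))\<^sup>2)"
      using assms(3) by (intro member_le_sum) auto
    then show "(L2_norm d \<Omega> (weak_deriv d \<Omega> (mi_unit k) (f - g)))\<^sup>2
      \<le> (L2_norm d \<Omega> (f - g))\<^sup>2 + (\<Sum>k<d. (L2_norm d \<Omega> (weak_deriv d \<Omega> (mi_unit k) (f - g)))\<^sup>2)"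
      by (simp add: add_increasing)
  qed
  finally show ?thesis .
qed

lemma H1_closure_superset:
  assumes "V \<subseteq> sobolev 1 d \<Omega>"
  shows "V \<subseteq> H1_closure d \<Omega> V"
proof
  fix f assume f: "f \<in> V"
  have "L2_norm d \<Omega> (weak_deriv d \<Omega> (mi_unit k) 0) = 0" for k
    by (subst norm_weak_deriv[OF has_weak_deriv_zero]) (simp add: L2_norm_def)
  then have "H1_norm d \<Omega> (f - f) = 0"
    by (simp add: H1_norm_def) (simp add: L2_norm_def)
  then show "f \<in> H1_closure d \<Omega> V" unfolding H1_closure_def using f assms
    by (intro CollectI conjI allI impI bexI[of _ f]) auto
qed

end

section \<open>Products of blocks of coordinates\<close>

definition offset :: "(nat \<Rightarrow> nat) \<Rightarrow> nat \<Rightarrow> nat" where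
  "offset d j = (\<Sum>l<j. d l)"

lemma offset_Suc: "offset d (Suc j) = offset d j + d j"
  by (simp add: offset_def)

lemma total_dim_eq_offset: "total_dim n d = offset d n"
  by (simp add: total_dim_def offset_def)

lemma offset_mono: "i \<le> j \<Longrightarrow> offset d i \<le> offset d j"
  unfolding offset_def by (intro sum_mono2) auto

lemma offset_less: "j < n \<Longrightarrow> k < d j \<Longrightarrow> offset d j + k < offset d n"
  using offset_mono[of "Suc j" n d] by (simp add: offset_Suc)

text \<open>Recovers the block \<open>j\<close> from a coordinate number
  \<open>offset d j + k\<close>, so that families given by pairs \<open>(j, k)\<close> can be
  written over the coordinates.\<close>

definition block_index :: "(nat \<Rightarrow> nat) \<Rightarrow> nat \<Rightarrow> nat" where
  "block_index d i = (LEAST j. i < offset d (Suc j))"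

lemma block_index_eq: "k < d j \<Longrightarrow> block_index d (offset d j + k) = j"
  unfolding block_index_def
proof (rule Least_equality)
  fix j' assume k: "k < d j" and less: "offset d j + k < offset d (Suc j')"
  show "j \<le> j'"
  proof (rule ccontr)
    assume "\<not> j \<le> j'"
    then have "offset d (Suc j') \<le> offset d j" by (intro offset_mono) simp
    with less show False by simp
  qed
qed (simp add: offset_Suc)

lemma offset_decomp:
  assumes "i < offset d n"
  obtains j k where "j < n" "k < d j" "i = offset d j + k"
  using assms
proof (induction n arbitrary: thesis)
  case (Suc n)
  show ?case
  proof (cases "i < offset d n")
    case True
    then show ?thesis using Suc.IH Suc.prems(1) less_Suc_eq by metis
  next
    case False
    then show ?thesis using Suc.prems(2) Suc.prems(1)[of n "i - offset d n"] by (simp add: offset_Suc)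
  qed
qed (simp add: offset_def)

lemma bij_betw_offset:
  "bij_betw (\<lambda>(j, k). offset d j + k) (SIGMA j:{..<n}. {..<d j}) {..<offset d n}"
proof (rule bij_betwI')
  fix p q assume "p \<in> (SIGMA j:{..<n}. {..<d j})" "q \<in> (SIGMA j:{..<n}. {..<d j})"
  then show "((\<lambda>(j, k). offset d j + k) p = (\<lambda>(j, k). offset d j + k) q) = (p = q)"
    using block_index_eq by (cases p, cases q) (metis SigmaE2 add_left_cancel case_prod_conv lessThan_iff)
next
  fix p assume "p \<in> (SIGMA j:{..<n}. {..<d j})"
  then show "(\<lambda>(j, k). offset d j + k) p \<in> {..<offset d n}"
    using offset_less by (cases p) auto
next
  fix i assume "i \<in> {..<offset d n}"
  then obtain j k where "j < n" "k < d j" "i = offset d j + k" using offset_decomp by blast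
  then show "\<exists>p\<in>SIGMA j:{..<n}. {..<d j}. i = (\<lambda>(j, k). offset d j + k) p"
    by (intro bexI[of _ "(j, k)"]) auto
qed

lemma sum_offset: "(\<Sum>i<offset d n. F i) = (\<Sum>j<n. \<Sum>k<d j. F (offset d j + k))"
  for F :: "nat \<Rightarrow> 'a::comm_monoid_add"
  unfolding sum.reindex_bij_betw[OF bij_betw_offset, symmetric]
  by (subst sum.Sigma) (auto intro!: sum.cong)

lemma prod_offset: "(\<Prod>i<offset d n. F i) = (\<Prod>j<n. \<Prod>k<d j. F (offset d j + k))"
  for F :: "nat \<Rightarrow> 'a::comm_monoid_mult"
  unfolding prod.reindex_bij_betw[OF bij_betw_offset, symmetric]
  by (subst prod.Sigma) (auto intro!: prod.cong)

definition join :: "nat \<Rightarrow> (nat \<Rightarrow> nat) \<Rightarrow> (nat \<Rightarrow> point) \<Rightarrow> point" where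
  "join n d w = (\<lambda>i\<in>{..<offset d n}. w (block_index d i) (i - offset d (block_index d i)))"

lemma join_apply: "j < n \<Longrightarrow> k < d j \<Longrightarrow> join n d w (offset d j + k) = w j k"
  unfolding join_def by (simp add: offset_less block_index_eq)

lemma join_topspace: "join n d w \<in> topspace (eucl (offset d n))"
  by (simp add: join_def)

lemma block_eq: "block d j x = (\<lambda>i\<in>{..<d j}. x (offset d j + i))"
  by (simp add: block_def offset_def)

lemma block_join:
  assumes "j < n" "w j \<in> extensional {..<d j}"
  shows "block d j (join n d w) = w j"
proof
  fix k
  show "block d j (join n d w) k = w j k"
    using assms by (cases "k < d j") (auto simp: block_eq join_apply extensional_def)
qed

section \<open>Lebesgue measure as a product over blocks\<close>

abbreviation blocks :: "(nat \<Rightarrow> nat) \<Rightarrow> nat set \<Rightarrow> (nat \<Rightarrow> point) measure" where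
  "blocks d I \<equiv> Pi\<^sub>M I (\<lambda>j. leb (d j))"

lemma product_sigma_finite_blocks: "product_sigma_finite (\<lambda>j. leb (d j))"
  by (intro product_sigma_finite.intro lborel_product.sigma_finite) simp

lemma space_blocks_extensional:
  "w \<in> space (blocks d I) \<Longrightarrow> j \<in> I \<Longrightarrow> w j \<in> extensional {..<d j}"
  by (auto simp: space_PiM PiE_iff)

lemma measurable_join: "join n d \<in> measurable (blocks d {..<n}) (leb (offset d n))"
  unfolding join_def
proof (rule measurable_restrict)
  fix i assume "i \<in> {..<offset d n}"
  then obtain j k where jk: "j < n" "k < d j" "i = offset d j + k" using offset_decomp by blast
  have "(\<lambda>w. w j) \<in> measurable (blocks d {..<n}) (leb (d j))"
    using jk by (intro measurable_component_singleton) auto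
  moreover have "(\<lambda>x. x k) \<in> measurable (leb (d j)) lborel"
    using jk by (intro measurable_component_singleton) auto
  ultimately have "(\<lambda>x. x k) \<circ> (\<lambda>w. w j) \<in> measurable (blocks d {..<n}) lborel"
    by (rule measurable_comp)
  then show "(\<lambda>w. w (block_index d i) (i - offset d (block_index d i))) \<in> measurable (blocks d {..<n}) lborel"
    using jk by (simp add: block_index_eq o_def)
qed

lemma measurable_block: "j < n \<Longrightarrow> block d j \<in> measurable (leb (offset d n)) (leb (d j))"
  unfolding block_eq[abs_def]
  by (intro measurable_restrict measurable_component_singleton) (simp add: offset_less)

text \<open>A measure on the product is determined by its values on boxes. A box pulls back under
  \<open>join\<close> to a product of boxes, and regrouping its side lengths by blocks gives the
  same volume. Through this identification Fubini applies to blocks.\<close>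

lemma distr_join: "distr (blocks d {..<n}) (leb (offset d n)) (join n d) = leb (offset d n)"
proof (rule lborel_product.PiM_eqI)
  interpret product_sigma_finite "\<lambda>j. leb (d j)" by (rule product_sigma_finite_blocks)
  fix A :: "nat \<Rightarrow> real set" assume A: "\<And>i. i \<in> {..<offset d n} \<Longrightarrow> A i \<in> sets lborel"
  let ?B = "\<lambda>j. \<Pi>\<^sub>E k\<in>{..<d j}. A (offset d j + k)"
  have B: "?B j \<in> sets (leb (d j))" if "j \<in> {..<n}" for j
    using that A offset_less by (intro sets_PiM_I_finite) auto
  have "join n d -` Pi\<^sub>E {..<offset d n} A \<inter> space (blocks d {..<n}) = Pi\<^sub>E {..<n} ?B"
  proof (intro set_eqI iffI)
    fix w assume w: "w \<in> join n d -` Pi\<^sub>E {..<offset d n} A \<inter> space (blocks d {..<n})"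
    show "w \<in> Pi\<^sub>E {..<n} ?B"
      unfolding PiE_iff
    proof (intro conjI ballI)
      show "w \<in> extensional {..<n}" using w by (simp add: space_PiM PiE_iff)
      fix j k assume j: "j \<in> {..<n}"
      show "w j \<in> extensional {..<d j}" using w j space_blocks_extensional by blast
      assume k: "k \<in> {..<d j}"
      have "join n d w (offset d j + k) \<in> A (offset d j + k)"
        using w j k offset_less[of j n k d] by (simp add: PiE_iff)
      then show "w j k \<in> A (offset d j + k)" using j k by (simp add: join_apply)
    qed
  next
    fix w assume w: "w \<in> Pi\<^sub>E {..<n} ?B"
    then have wA: "w j k \<in> A (offset d j + k)" if "j < n" "k < d j" for j k
      using that by (simp add: PiE_iff)
    have "join n d w i \<in> A i" if "i < offset d n" for i
      using that wA join_apply by (metis offset_decomp)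
    moreover have "w \<in> space (blocks d {..<n})"
      using w by (simp add: space_PiM PiE_iff)
    ultimately show "w \<in> join n d -` Pi\<^sub>E {..<offset d n} A \<inter> space (blocks d {..<n})"
      by (simp add: PiE_iff) (simp add: join_def)
  qed
  then have "emeasure (distr (blocks d {..<n}) (leb (offset d n)) (join n d)) (Pi\<^sub>E {..<offset d n} A)
      = emeasure (blocks d {..<n}) (Pi\<^sub>E {..<n} ?B)"
    using A by (subst emeasure_distr[OF measurable_join]) (auto intro!: sets_PiM_I_finite)
  also have "\<dots> = (\<Prod>j<n. emeasure (leb (d j)) (?B j))"
    by (rule emeasure_PiM) (use B in auto)
  also have "\<dots> = (\<Prod>j<n. \<Prod>k<d j. emeasure lborel (A (offset d j + k)))"
    using A offset_less by (intro prod.cong refl lborel_product.emeasure_PiM) auto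
  also have "\<dots> = (\<Prod>i<offset d n. emeasure lborel (A i))" by (rule prod_offset[symmetric])
  finally show "emeasure (distr (blocks d {..<n}) (leb (offset d n)) (join n d)) (Pi\<^sub>E {..<offset d n} A)
    = (\<Prod>i\<in>{..<offset d n}. emeasure lborel (A i))" .
qed simp_all

lemma integral_join:
  fixes f :: "point \<Rightarrow> 'b::{banach, second_countable_topology}"
  assumes "f \<in> borel_measurable (leb (offset d n))"
  shows "integral\<^sup>L (leb (offset d n)) f = (\<integral>w. f (join n d w) \<partial>blocks d {..<n})"
  using integral_distr[OF measurable_join assms] by (simp add: distr_join)

lemma integrable_join:
  fixes f :: "point \<Rightarrow> 'b::{banach, second_countable_topology}"
  assumes "f \<in> borel_measurable (leb (offset d n))"
  shows "integrable (leb (offset d n)) f \<longleftrightarrow> integrable (blocks d {..<n}) (\<lambda>w. f (join n d w))"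
  using integrable_distr_eq[OF measurable_join assms] by (simp add: distr_join)

lemma continuous_map_block: "j < n \<Longrightarrow> continuous_map (eucl (offset d n)) (eucl (d j)) (block d j)"
  unfolding block_eq[abs_def] continuous_map_componentwise
  by (auto intro!: continuous_map_product_projection simp: offset_less)

lemma openin_product_domain:
  assumes "\<And>j. j < n \<Longrightarrow> openin (eucl (d j)) (\<Omega> j)"
  shows "openin (eucl (offset d n)) (product_domain n d \<Omega>)"
proof -
  let ?X = "eucl (offset d n)"
  have "openin ?X {x \<in> topspace ?X. \<forall>j<m. block d j x \<in> \<Omega> j}" if "m \<le> n" for m
    using that
  proof (induction m)
    case (Suc m)
    have "openin ?X {x \<in> topspace ?X. block d m x \<in> \<Omega> m}"
      using Suc.prems assms by (intro openin_continuous_map_preimage[OF continuous_map_block]) auto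
    with Suc have "openin ?X ({x \<in> topspace ?X. \<forall>j<m. block d j x \<in> \<Omega> j} \<inter> {x \<in> topspace ?X. block d m x \<in> \<Omega> m})"
      by (intro openin_Int) auto
    also have "{x \<in> topspace ?X. \<forall>j<m. block d j x \<in> \<Omega> j} \<inter> {x \<in> topspace ?X. block d m x \<in> \<Omega> m}
        = {x \<in> topspace ?X. \<forall>j<Suc m. block d j x \<in> \<Omega> j}"
      using less_Suc_eq by blast
    finally show ?case .
  qed (simp only: not_less0 simp_thms Collect_mem_eq openin_topspace)
  then show ?thesis unfolding product_domain_def total_dim_eq_offset by blast
qed

lemma product_integral_block:
  fixes F :: "nat \<Rightarrow> point \<Rightarrow> 'b::{real_normed_field, banach, second_countable_topology}"
  assumes F: "\<And>j. j < n \<Longrightarrow> integrable (leb (d j)) (F j)"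
  shows "integrable (leb (offset d n)) (\<lambda>x. \<Prod>j<n. F j (block d j x))"
    and "(\<integral>x. (\<Prod>j<n. F j (block d j x)) \<partial>leb (offset d n)) = (\<Prod>j<n. integral\<^sup>L (leb (d j)) (F j))"
proof -
  interpret product_sigma_finite "\<lambda>j. leb (d j)" by (rule product_sigma_finite_blocks)
  have m: "(\<lambda>x. \<Prod>j<n. F j (block d j x)) \<in> borel_measurable (leb (offset d n))"
    using F by (intro borel_measurable_prod measurable_compose[OF measurable_block]) auto
  have eq: "(\<Prod>j<n. F j (block d j (join n d w))) = (\<Prod>j<n. F j (w j))" if "w \<in> space (blocks d {..<n})" for w
    using that space_blocks_extensional[of w "{..<n}" d] by (intro prod.cong refl) (simp add: block_join)
  have "integrable (blocks d {..<n}) (\<lambda>w. \<Prod>j<n. F j (w j))"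
    using F by (intro product_integrable_prod) auto
  then show "integrable (leb (offset d n)) (\<lambda>x. \<Prod>j<n. F j (block d j x))"
    unfolding integrable_join[OF m] by (rule Bochner_Integration.integrable_cong[THEN iffD2, rotated 2]) (use eq in auto)
  have "(\<integral>x. (\<Prod>j<n. F j (block d j x)) \<partial>leb (offset d n)) = (\<integral>w. (\<Prod>j<n. F j (w j)) \<partial>blocks d {..<n})"
    unfolding integral_join[OF m] by (rule Bochner_Integration.integral_cong) (use eq in auto)
  also have "\<dots> = (\<Prod>j<n. integral\<^sup>L (leb (d j)) (F j))"
    using F by (intro product_integral_prod) auto
  finally show "(\<integral>x. (\<Prod>j<n. F j (block d j x)) \<partial>leb (offset d n)) = (\<Prod>j<n. integral\<^sup>L (leb (d j)) (F j))" .
qed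

lemma indicator_product_domain:
  assumes "x \<in> topspace (eucl (offset d n))"
  shows "indicator (product_domain n d \<Omega>) x = (\<Prod>j<n. indicator (\<Omega> j) (block d j x) :: real)"
proof (cases "x \<in> product_domain n d \<Omega>")
  case True
  then show ?thesis by (simp add: product_domain_def)
next
  case False
  then obtain j where "j < n" "block d j x \<notin> \<Omega> j"
    using assms by (auto simp: product_domain_def total_dim_eq_offset simp del: topspace_product_topology)
  then have "(\<Prod>j<n. indicator (\<Omega> j) (block d j x) :: real) = 0"
    by (intro prod_zero bexI[of _ j]) auto
  with False show ?thesis by simp
qed

lemma indicator_scale_prod:
  fixes F :: "nat \<Rightarrow> point \<Rightarrow> 'b::real_normed_field"
  assumes "x \<in> topspace (eucl (offset d n))"
  shows "indicator (product_domain n d \<Omega>) x *\<^sub>R (\<Prod>j<n. F j (block d j x))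
    = (\<Prod>j<n. indicator (\<Omega> j) (block d j x) *\<^sub>R F j (block d j x))"
  unfolding indicator_product_domain[OF assms] by (simp add: scaleR_conv_of_real prod.distrib)

locale product_setting =
  fixes n :: nat and d :: "nat \<Rightarrow> nat" and \<Omega> :: "nat \<Rightarrow> point set"
  assumes open_factor: "\<And>j. j < n \<Longrightarrow> openin (eucl (d j)) (\<Omega> j)"
begin

abbreviation "D \<equiv> offset d n"
abbreviation "\<Omega>' \<equiv> product_domain n d \<Omega>"

lemma open_product: "openin (eucl D) \<Omega>'"
  by (rule openin_product_domain[OF open_factor])

lemma integral_prod_block:
  fixes F :: "nat \<Rightarrow> point \<Rightarrow> 'b::{real_normed_field, banach, second_countable_topology}"
  assumes F: "\<And>j. j < n \<Longrightarrow> integrable (leb_on (d j) (\<Omega> j)) (F j)"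
  shows "integrable (leb_on D \<Omega>') (\<lambda>x. \<Prod>j<n. F j (block d j x))"
    and "(\<integral>x. (\<Prod>j<n. F j (block d j x)) \<partial>leb_on D \<Omega>') = (\<Prod>j<n. integral\<^sup>L (leb_on (d j) (\<Omega> j)) (F j))"
proof -
  let ?G = "\<lambda>j x. indicator (\<Omega> j) x *\<^sub>R F j x"
  have G: "integrable (leb (d j)) (?G j)" if "j < n" for j
    using F[OF that] by (simp only: integrable_leb_on[OF open_factor[OF that]])
  note eq = indicator_scale_prod[of _ d n \<Omega> F, folded space_leb]
  show "integrable (leb_on D \<Omega>') (\<lambda>x. \<Prod>j<n. F j (block d j x))"
    unfolding integrable_leb_on[OF open_product]
    using product_integral_block(1)[of n d ?G, OF G]
    by (rule Bochner_Integration.integrable_cong[THEN iffD2, rotated 2]) (use eq in auto)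
  have "(\<integral>x. (\<Prod>j<n. F j (block d j x)) \<partial>leb_on D \<Omega>') = (\<integral>x. (\<Prod>j<n. ?G j (block d j x)) \<partial>leb D)"
    unfolding integral_leb_on[OF open_product]
    by (rule Bochner_Integration.integral_cong) (use eq in auto)
  also have "\<dots> = (\<Prod>j<n. integral\<^sup>L (leb_on (d j) (\<Omega> j)) (F j))"
    using product_integral_block(2)[of n d ?G, OF G]
    by (simp only:) (intro prod.cong refl, simp add: integral_leb_on[OF open_factor])
  finally show "(\<integral>x. (\<Prod>j<n. F j (block d j x)) \<partial>leb_on D \<Omega>')
    = (\<Prod>j<n. integral\<^sup>L (leb_on (d j) (\<Omega> j)) (F j))" .
qed

abbreviation tensor :: "(nat \<Rightarrow> cfun) \<Rightarrow> cfun" where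
  "tensor \<equiv> elem_tensor n d"

lemma tensor_L2:
  assumes f: "\<And>j. j < n \<Longrightarrow> f j \<in> L2 (d j) (\<Omega> j)"
  shows "tensor f \<in> L2 D \<Omega>'"
  unfolding L2_def
proof safe
  have "(\<lambda>x. indicator \<Omega>' x *\<^sub>R tensor f x) \<in> borel_measurable (leb D)
      \<longleftrightarrow> (\<lambda>x. \<Prod>j<n. indicator (\<Omega> j) (block d j x) *\<^sub>R f j (block d j x)) \<in> borel_measurable (leb D)"
    unfolding elem_tensor_def
    by (intro measurable_cong indicator_scale_prod) (simp only: space_leb)
  moreover have "(\<lambda>x. \<Prod>j<n. indicator (\<Omega> j) (block d j x) *\<^sub>R f j (block d j x)) \<in> borel_measurable (leb D)"
  proof (intro borel_measurable_prod)
    fix j assume j: "j \<in> {..<n}"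
    then have "(\<lambda>x. indicator (\<Omega> j) x *\<^sub>R f j x) \<in> borel_measurable (leb (d j))"
      using iffD1[OF borel_measurable_leb_on[OF open_factor] L2_measurable[OF f]] by simp
    from measurable_compose[OF measurable_block[of j n d] this] j
    show "(\<lambda>x. indicator (\<Omega> j) (block d j x) *\<^sub>R f j (block d j x)) \<in> borel_measurable (leb D)" by simp
  qed
  ultimately show "tensor f \<in> borel_measurable (leb_on D \<Omega>')"
    unfolding borel_measurable_leb_on[OF open_product] by simp
  have "integrable (leb_on D \<Omega>') (\<lambda>x. \<Prod>j<n. (\<lambda>y. (cmod (f j y))\<^sup>2) (block d j x))"
    by (rule integral_prod_block(1)) (rule L2_square_integrable[OF f])
  then show "integrable (leb_on D \<Omega>') (\<lambda>x. (cmod (tensor f x))\<^sup>2)"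
    by (simp add: elem_tensor_def prod_power_distrib flip: prod_norm)
qed

lemma tensor_inner:
  assumes f: "\<And>j. j < n \<Longrightarrow> f j \<in> L2 (d j) (\<Omega> j)" and g: "\<And>j. j < n \<Longrightarrow> g j \<in> L2 (d j) (\<Omega> j)"
  shows "L2_inner D \<Omega>' (tensor f) (tensor g) = (\<Prod>j<n. L2_inner (d j) (\<Omega> j) (f j) (g j))"
proof -
  have "L2_inner D \<Omega>' (tensor f) (tensor g)
      = (\<integral>x. (\<Prod>j<n. (\<lambda>y. f j y * cnj (g j y)) (block d j x)) \<partial>leb_on D \<Omega>')"
    by (simp add: L2_inner_def elem_tensor_def prod.distrib)
  also have "\<dots> = (\<Prod>j<n. L2_inner (d j) (\<Omega> j) (f j) (g j))"
    unfolding L2_inner_def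
    by (rule integral_prod_block(2)) (intro L2_integrable_inner f g)
  finally show ?thesis .
qed

end

section \<open>Slices of test functions and weak derivatives of tensors\<close>

definition mi_shift :: "(nat \<Rightarrow> nat) \<Rightarrow> nat \<Rightarrow> (nat \<Rightarrow> nat) \<Rightarrow> nat \<Rightarrow> nat" where
  "mi_shift d j \<alpha> = (\<lambda>i. if offset d j \<le> i \<and> i < offset d (Suc j) then \<alpha> (i - offset d j) else 0)"

text \<open>Composition with \<open>insert_block d j y\<close> forms a slice: all coordinates
  outside block \<open>j\<close> are frozen at their values in \<open>y\<close>.\<close>

definition insert_block :: "(nat \<Rightarrow> nat) \<Rightarrow> nat \<Rightarrow> point \<Rightarrow> point \<Rightarrow> point" where
  "insert_block d j y z = (\<lambda>i. if offset d j \<le> i \<and> i < offset d (Suc j) then z (i - offset d j) else y i)"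

lemma mi_shift_unit: "k < d j \<Longrightarrow> mi_shift d j (mi_unit k) = mi_unit (offset d j + k)"
  by (auto simp: mi_shift_def mi_unit_def fun_eq_iff offset_Suc)

lemma mi_shift_add: "mi_shift d j (\<alpha> + \<beta>) = mi_shift d j \<alpha> + mi_shift d j \<beta>"
  by (auto simp: mi_shift_def fun_eq_iff)

lemma mi_shift_apply:
  assumes "k < d i"
  shows "mi_shift d j \<alpha> (offset d i + k) = (if i = j then \<alpha> k else 0)"
proof (cases "i < j \<or> j < i")
  case True
  then have "offset d (Suc i) \<le> offset d j \<or> offset d (Suc j) \<le> offset d i"
    using offset_mono[of "Suc i" j d] offset_mono[of "Suc j" i d] by auto
  then show ?thesis using True assms by (auto simp: mi_shift_def offset_Suc)
next
  case False
  then show ?thesis using assms by (auto simp: mi_shift_def offset_Suc)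
qed

lemma mi_order_shift:
  assumes "j < n"
  shows "mi_order (offset d n) (mi_shift d j \<alpha>) = mi_order (d j) \<alpha>"
proof -
  have "mi_order (offset d n) (mi_shift d j \<alpha>) = (\<Sum>i<n. \<Sum>k<d i. if i = j then \<alpha> k else 0)"
    unfolding mi_order_def sum_offset by (intro sum.cong refl) (simp add: mi_shift_apply)
  also have "\<dots> = (\<Sum>i<n. if i = j then \<Sum>k<d i. \<alpha> k else 0)" by (intro sum.cong) auto
  also have "\<dots> = mi_order (d j) \<alpha>" using assms by (simp add: mi_order_def)
  finally show ?thesis .
qed

lemma insert_block_update: "k < d j \<Longrightarrow> insert_block d j y (z(k := t)) = (insert_block d j y z)(offset d j + k := t)"
  by (auto simp: insert_block_def fun_eq_iff offset_Suc)

lemma insert_block_apply: "k < d j \<Longrightarrow> insert_block d j y z (offset d j + k) = z k"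
  by (simp add: insert_block_def offset_Suc)

lemma insert_block_topspace:
  assumes "j < n" "y \<in> topspace (eucl (offset d n))"
  shows "insert_block d j y z \<in> topspace (eucl (offset d n))"
  using assms offset_mono[of "Suc j" n d] by (auto simp: insert_block_def PiE_iff extensional_def)

lemma continuous_map_insert_block:
  assumes "j < n" "y \<in> topspace (eucl (offset d n))"
  shows "continuous_map (eucl (d j)) (eucl (offset d n)) (insert_block d j y)"
proof -
  have "continuous_map (eucl (d j)) euclideanreal (\<lambda>z. insert_block d j y z i)" for i
  proof (cases "offset d j \<le> i \<and> i < offset d (Suc j)")
    case True
    then have "i - offset d j < d j" by (auto simp: offset_Suc)
    then show ?thesis
      using True continuous_map_product_projection[of "i - offset d j" "{..<d j}" "\<lambda>_. euclideanreal"]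
      by (simp add: insert_block_def)
  next
    case False
    then have "(\<lambda>z. insert_block d j y z i) = (\<lambda>z. y i)" by (auto simp: insert_block_def)
    then show ?thesis by simp
  qed
  moreover have "insert_block d j y ` topspace (eucl (d j)) \<subseteq> extensional {..<offset d n}"
    using insert_block_topspace[OF assms] by (auto simp: PiE_def)
  ultimately show ?thesis by (simp add: continuous_map_componentwise)
qed

lemma partial_deriv_insert_block:
  assumes "k < d j"
  shows "partial_deriv k (\<phi> \<circ> insert_block d j y) = partial_deriv (offset d j + k) \<phi> \<circ> insert_block d j y"
  unfolding partial_deriv_def using assms by (auto simp: fun_eq_iff insert_block_update insert_block_apply)

lemma foldr_partial_deriv_insert_block:
  "set ks \<subseteq> {..<d j} \<Longrightarrow> foldr partial_deriv ks (\<phi> \<circ> insert_block d j y)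
    = foldr partial_deriv (map (\<lambda>k. offset d j + k) ks) \<phi> \<circ> insert_block d j y"
proof (induction ks)
  case (Cons k ks)
  have k: "k < d j" and ks: "set ks \<subseteq> {..<d j}" using Cons.prems by auto
  have "foldr partial_deriv (k # ks) (\<phi> \<circ> insert_block d j y)
      = partial_deriv k (foldr partial_deriv (map (\<lambda>k. offset d j + k) ks) \<phi> \<circ> insert_block d j y)"
    by (simp only: foldr.simps comp_apply[of _ "foldr _ _"] Cons.IH[OF ks])
  also have "\<dots> = foldr partial_deriv (map (\<lambda>k. offset d j + k) (k # ks)) \<phi> \<circ> insert_block d j y"
    by (simp only: partial_deriv_insert_block[where d = d and j = j, OF k] list.map foldr.simps comp_apply[of _ "foldr _ _"])
  finally show ?case .
qed simp

lemma test_function_insert_block: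
  assumes \<phi>: "\<phi> \<in> test_functions (offset d n) (product_domain n d \<Omega>)"
    and j: "j < n" and y: "y \<in> topspace (eucl (offset d n))"
  shows "\<phi> \<circ> insert_block d j y \<in> test_functions (d j) (\<Omega> j)"
proof -
  let ?D = "offset d n"
  from \<phi> obtain K where K: "smooth ?D \<phi>" "compactin (eucl ?D) K" "K \<subseteq> product_domain n d \<Omega>"
    "\<forall>x\<in>topspace (eucl ?D) - K. \<phi> x = 0" by (rule test_functionE)
  have "smooth (d j) (\<phi> \<circ> insert_block d j y)"
    unfolding smooth_def
  proof (intro allI impI)
    fix ks assume ks: "set ks \<subseteq> {..<d j}"
    let ?ks = "map (\<lambda>k. offset d j + k) ks"
    have "set ?ks \<subseteq> {..<?D}" using ks j offset_less[of j n _ d] by auto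
    with K(1) have *: "continuous_map (eucl ?D) euclidean (foldr partial_deriv ?ks \<phi>)"
      "\<And>x k. x \<in> topspace (eucl ?D) \<Longrightarrow> k < ?D \<Longrightarrow>
        (\<lambda>t. foldr partial_deriv ?ks \<phi> (x(k := t))) differentiable at (x k)"
      unfolding smooth_def by blast+
    show "continuous_map (eucl (d j)) euclidean (foldr partial_deriv ks (\<phi> \<circ> insert_block d j y)) \<and>
      (\<forall>x\<in>topspace (eucl (d j)). \<forall>k<d j.
        (\<lambda>t. foldr partial_deriv ks (\<phi> \<circ> insert_block d j y) (x(k := t))) differentiable at (x k))"
      unfolding foldr_partial_deriv_insert_block[where d = d and j = j, OF ks]
    proof (intro conjI ballI allI impI)
      show "continuous_map (eucl (d j)) euclidean (foldr partial_deriv ?ks \<phi> \<circ> insert_block d j y)"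
        by (rule continuous_map_compose[OF continuous_map_insert_block[OF j y] *(1)])
      fix x k assume k: "k < d j"
      show "(\<lambda>t. (foldr partial_deriv ?ks \<phi> \<circ> insert_block d j y) (x(k := t))) differentiable at (x k)"
        using *(2)[OF insert_block_topspace[OF j y] offset_less[where d = d, OF j k], of x] k
        by (simp add: insert_block_update insert_block_apply)
    qed
  qed
  moreover have "compactin (eucl (d j)) (block d j ` K)"
    by (rule image_compactin[OF K(2) continuous_map_block[OF j]])
  moreover have "block d j ` K \<subseteq> \<Omega> j" using K(3) j by (auto simp: product_domain_def)
  moreover have "(\<phi> \<circ> insert_block d j y) z = 0" if z: "z \<in> topspace (eucl (d j)) - block d j ` K" for z
  proof -
    have "block d j (insert_block d j y z) = z"
      using z by (auto simp: block_eq fun_eq_iff insert_block_apply PiE_iff extensional_def)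
    then have "insert_block d j y z \<notin> K" using z by force
    then show ?thesis using K(4) insert_block_topspace[OF j y] by (simp del: topspace_product_topology)
  qed
  ultimately show ?thesis unfolding test_functions_def by blast
qed

lemma foldr_id: "(\<And>i. i \<in> set xs \<Longrightarrow> g i = id) \<Longrightarrow> foldr g xs \<phi> = \<phi>"
  by (induction xs) auto

lemma multi_deriv_insert_block:
  assumes j: "j < n"
  shows "multi_deriv (d j) \<alpha> (\<phi> \<circ> insert_block d j y) = multi_deriv (offset d n) (mi_shift d j \<alpha>) \<phi> \<circ> insert_block d j y"
proof -
  let ?g = "\<lambda>i. partial_deriv i ^^ mi_shift d j \<alpha> i"
  let ?o = "offset d j"
  have le: "offset d (Suc j) \<le> offset d n" using j by (intro offset_mono) simp
  have "[0..<offset d n] = [0..<?o] @ [?o..<offset d (Suc j)] @ [offset d (Suc j)..<offset d n]"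
    using upt_add_eq_append[of 0 ?o "offset d n - ?o"] le
      upt_add_eq_append[of ?o "offset d (Suc j)" "offset d n - offset d (Suc j)"]
    by (simp add: offset_Suc)
  moreover have "foldr ?g [offset d (Suc j)..<offset d n] \<psi> = \<psi>" for \<psi>
    by (rule foldr_id) (auto simp: mi_shift_def id_def)
  moreover have "foldr ?g [0..<?o] \<psi> = \<psi>" for \<psi>
    by (rule foldr_id) (auto simp: mi_shift_def id_def)
  ultimately have outer: "multi_deriv (offset d n) (mi_shift d j \<alpha>) \<phi> = foldr ?g [?o..<offset d (Suc j)] \<phi>"
    unfolding multi_deriv_def by simp
  have pow: "(partial_deriv k ^^ m) (\<psi> \<circ> insert_block d j y) = (partial_deriv (?o + k) ^^ m) \<psi> \<circ> insert_block d j y"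
    if "k < d j" for k m \<psi>
    using that by (induction m) (auto simp: partial_deriv_insert_block)
  have "foldr (\<lambda>i. partial_deriv i ^^ \<alpha> i) ks (\<phi> \<circ> insert_block d j y)
      = foldr ?g (map (\<lambda>k. ?o + k) ks) \<phi> \<circ> insert_block d j y" if "set ks \<subseteq> {..<d j}" for ks
    using that
  proof (induction ks)
    case (Cons k ks)
    have k: "k < d j" and ks: "set ks \<subseteq> {..<d j}" using Cons.prems by auto
    have "foldr (\<lambda>i. partial_deriv i ^^ \<alpha> i) (k # ks) (\<phi> \<circ> insert_block d j y)
        = (partial_deriv k ^^ \<alpha> k) (foldr ?g (map (\<lambda>k. ?o + k) ks) \<phi> \<circ> insert_block d j y)"
      by (simp only: foldr.simps comp_apply[of _ "foldr _ _"] Cons.IH[OF ks])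
    also have "\<dots> = foldr ?g (map (\<lambda>k. ?o + k) (k # ks)) \<phi> \<circ> insert_block d j y"
      by (simp only: pow[OF k] list.map foldr.simps comp_apply[of _ "foldr _ _"] mi_shift_apply[where d = d and i = j, OF k] if_True refl)
    finally show ?case .
  qed simp
  moreover have "set [0..<d j] \<subseteq> {..<d j}" by auto
  ultimately have "foldr (\<lambda>i. partial_deriv i ^^ \<alpha> i) [0..<d j] (\<phi> \<circ> insert_block d j y)
      = foldr ?g (map (\<lambda>k. ?o + k) [0..<d j]) \<phi> \<circ> insert_block d j y" by blast
  then show ?thesis
    unfolding outer by (simp add: multi_deriv_def offset_Suc map_add_upt add.commute)
qed

lemma join_update:
  assumes "j < n"
  shows "join n d (w(j := z)) = insert_block d j (join n d (w(j := z'))) z"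
proof
  fix i
  show "join n d (w(j := z)) i = insert_block d j (join n d (w(j := z'))) z i"
  proof (cases "i < offset d n")
    case True
    then obtain l k where "l < n" "k < d l" "i = offset d l + k" using offset_decomp by blast
    then show ?thesis
      using mi_shift_apply[of k d l j "\<lambda>_. 1"] assms
      by (auto simp: join_apply insert_block_def mi_shift_def split: if_splits)
  next
    case False
    then show ?thesis using assms offset_mono[of "Suc j" n d] by (auto simp: join_def insert_block_def)
  qed
qed

context product_setting
begin

text \<open>Fubini with block \<open>j\<close> as the inner variable. The other blocks range over
  whole spaces, hence the indicators in the outer product. The value \<open>\<lambda>_. 0\<close>
  given to \<open>join\<close> is a placeholder that \<open>insert_block\<close> overwrites.\<close>

lemma slice_integral:
  assumes j: "j < n" and f: "\<And>i. i < n \<Longrightarrow> f i \<in> L2 (d i) (\<Omega> i)" and \<psi>: "\<psi> \<in> L2 D \<Omega>'"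
  shows "(\<integral>x. tensor f x * \<psi> x \<partial>leb_on D \<Omega>')
    = (\<integral>w. (\<Prod>i\<in>{..<n} - {j}. indicator (\<Omega> i) (w i) *\<^sub>R f i (w i)) *
        (\<integral>z. f j z * \<psi> (insert_block d j (join n d (w(j := \<lambda>_. 0))) z) \<partial>leb_on (d j) (\<Omega> j))
        \<partial>blocks d ({..<n} - {j}))"
proof -
  interpret product_sigma_finite "\<lambda>j. leb (d j)" by (rule product_sigma_finite_blocks)
  let ?I = "{..<n} - {j}"
  let ?F = "\<lambda>x. indicator \<Omega>' x *\<^sub>R (tensor f x * \<psi> x)"
  have ins: "insert j ?I = {..<n}" using j by auto
  have int: "integrable (leb D) ?F"
    using L2_integrable_mult[OF tensor_L2[OF f] \<psi>] unfolding integrable_leb_on[OF open_product] .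
  then have m: "?F \<in> borel_measurable (leb D)" by auto
  have F: "?F (join n d w) = (\<Prod>i<n. indicator (\<Omega> i) (w i) *\<^sub>R f i (w i)) * \<psi> (join n d w)"
    if "\<And>i. i < n \<Longrightarrow> w i \<in> extensional {..<d i}" for w
  proof -
    have "?F (join n d w) = (indicator \<Omega>' (join n d w) *\<^sub>R (\<Prod>i<n. f i (block d i (join n d w)))) * \<psi> (join n d w)"
      by (simp add: elem_tensor_def)
    also have "\<dots> = (\<Prod>i<n. indicator (\<Omega> i) (w i) *\<^sub>R f i (w i)) * \<psi> (join n d w)"
      unfolding indicator_scale_prod[OF join_topspace]
      by (intro arg_cong2[where f = "(*)"] prod.cong refl) (simp add: block_join that)
    finally show ?thesis .
  qed
  have "(\<integral>x. tensor f x * \<psi> x \<partial>leb_on D \<Omega>') = integral\<^sup>L (leb D) ?F"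
    by (rule integral_leb_on[OF open_product])
  also have "\<dots> = (\<integral>w. ?F (join n d w) \<partial>blocks d (insert j ?I))"
    unfolding ins by (rule integral_join[OF m])
  also have "\<dots> = (\<integral>w. (\<integral>z. ?F (join n d (w(j := z))) \<partial>leb (d j)) \<partial>blocks d ?I)"
  proof (rule product_integral_insert)
    show "integrable (blocks d (insert j ?I)) (\<lambda>w. ?F (join n d w))"
      using int unfolding integrable_join[OF m] ins .
  qed simp_all
  also have "\<dots> = (\<integral>w. (\<Prod>i\<in>?I. indicator (\<Omega> i) (w i) *\<^sub>R f i (w i)) *
        (\<integral>z. f j z * \<psi> (insert_block d j (join n d (w(j := \<lambda>_. 0))) z) \<partial>leb_on (d j) (\<Omega> j)) \<partial>blocks d ?I)"
  proof (rule Bochner_Integration.integral_cong[OF refl])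
    fix w assume w: "w \<in> space (blocks d ?I)"
    let ?P = "\<Prod>i\<in>?I. indicator (\<Omega> i) (w i) *\<^sub>R f i (w i)"
    let ?y = "join n d (w(j := \<lambda>_. 0))"
    have "(\<integral>z. ?F (join n d (w(j := z))) \<partial>leb (d j))
        = (\<integral>z. ?P * (indicator (\<Omega> j) z *\<^sub>R (f j z * \<psi> (insert_block d j ?y z))) \<partial>leb (d j))"
    proof (rule Bochner_Integration.integral_cong[OF refl])
      fix z assume z: "z \<in> space (leb (d j))"
      have "?F (join n d (w(j := z))) = (\<Prod>i<n. indicator (\<Omega> i) ((w(j := z)) i) *\<^sub>R f i ((w(j := z)) i))
          * \<psi> (join n d (w(j := z)))"
        using w z by (intro F) (auto simp: space_PiM PiE_iff)
      also have "(\<Prod>i<n. indicator (\<Omega> i) ((w(j := z)) i) *\<^sub>R f i ((w(j := z)) i))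
          = (indicator (\<Omega> j) z *\<^sub>R f j z) * (\<Prod>i\<in>?I. indicator (\<Omega> i) ((w(j := z)) i) *\<^sub>R f i ((w(j := z)) i))"
        using j by (subst prod.remove[of _ j]) auto
      also have "(\<Prod>i\<in>?I. indicator (\<Omega> i) ((w(j := z)) i) *\<^sub>R f i ((w(j := z)) i)) = ?P"
        by (rule prod.cong) auto
      finally have "?F (join n d (w(j := z))) = indicator (\<Omega> j) z *\<^sub>R f j z * ?P * \<psi> (join n d (w(j := z)))" .
      also have "\<dots> = ?P * (indicator (\<Omega> j) z *\<^sub>R (f j z * \<psi> (join n d (w(j := z)))))"
        by (simp add: mult_ac)
      finally show "?F (join n d (w(j := z))) = ?P * (indicator (\<Omega> j) z *\<^sub>R (f j z * \<psi> (insert_block d j ?y z)))"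
        using arg_cong[OF join_update[OF j, of d w z "\<lambda>_. 0"], of \<psi>] by (simp only:)
    qed
    also have "\<dots> = ?P * (\<integral>z. f j z * \<psi> (insert_block d j ?y z) \<partial>leb_on (d j) (\<Omega> j))"
      unfolding integral_leb_on[OF open_factor[OF j]] by (rule integral_mult_right_zero)
    finally show "(\<integral>z. ?F (join n d (w(j := z))) \<partial>leb (d j))
        = ?P * (\<integral>z. f j z * \<psi> (insert_block d j ?y z) \<partial>leb_on (d j) (\<Omega> j))" .
  qed
  finally show ?thesis .
qed

text \<open>For fixed values of the other blocks, the slice of a test function is a test function on
  \<open>\<Omega> j\<close>, so the identity defining \<open>g\<close> applies inside the inner
  integral. Fubini is then read backwards.\<close>

lemma tensor_has_weak_deriv:
  assumes j: "j < n" and f: "\<And>i. i < n \<Longrightarrow> f i \<in> L2 (d i) (\<Omega> i)"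
    and g: "has_weak_deriv (d j) (\<Omega> j) \<alpha> (f j) g"
  shows "has_weak_deriv D \<Omega>' (mi_shift d j \<alpha>) (tensor f) (tensor (f(j := g)))"
  unfolding has_weak_deriv_def
proof (intro conjI ballI)
  have f': "\<And>i. i < n \<Longrightarrow> (f(j := g)) i \<in> L2 (d i) (\<Omega> i)"
    using f has_weak_derivD(2)[OF g] by simp
  show "tensor f \<in> L2 D \<Omega>'" "tensor (f(j := g)) \<in> L2 D \<Omega>'" using f f' by (auto intro: tensor_L2)
  fix \<phi> assume \<phi>: "\<phi> \<in> test_functions D \<Omega>'"
  let ?c = "(-1) ^ mi_order (d j) \<alpha> :: complex"
  let ?y = "\<lambda>w. join n d (w(j := \<lambda>_. 0))"
  let ?P = "\<lambda>f w. \<Prod>i\<in>{..<n} - {j}. indicator (\<Omega> i) (w i) *\<^sub>R f i (w i) :: complex"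
  have "(\<integral>x. tensor f x * multi_deriv D (mi_shift d j \<alpha>) \<phi> x \<partial>leb_on D \<Omega>')
      = (\<integral>w. ?P f w * (\<integral>z. f j z * multi_deriv D (mi_shift d j \<alpha>) \<phi> (insert_block d j (?y w) z) \<partial>leb_on (d j) (\<Omega> j))
          \<partial>blocks d ({..<n} - {j}))"
    by (intro slice_integral j f test_function_L2[OF open_product] test_function_multi_deriv \<phi>)
  also have "\<dots> = (\<integral>w. ?c * (?P f w * (\<integral>z. g z * \<phi> (insert_block d j (?y w) z) \<partial>leb_on (d j) (\<Omega> j)))
          \<partial>blocks d ({..<n} - {j}))"
  proof (rule Bochner_Integration.integral_cong[OF refl])
    fix w
    have t: "\<phi> \<circ> insert_block d j (?y w) \<in> test_functions (d j) (\<Omega> j)"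
      by (rule test_function_insert_block[OF \<phi> j join_topspace])
    show "?P f w * (\<integral>z. f j z * multi_deriv D (mi_shift d j \<alpha>) \<phi> (insert_block d j (?y w) z) \<partial>leb_on (d j) (\<Omega> j))
        = ?c * (?P f w * (\<integral>z. g z * \<phi> (insert_block d j (?y w) z) \<partial>leb_on (d j) (\<Omega> j)))"
      using has_weak_derivD(3)[OF g t] unfolding multi_deriv_insert_block[OF j] by (simp add: mult_ac)
  qed
  also have "\<dots> = ?c * (\<integral>w. ?P f w * (\<integral>z. g z * \<phi> (insert_block d j (?y w) z) \<partial>leb_on (d j) (\<Omega> j))
          \<partial>blocks d ({..<n} - {j}))" by simp
  \<comment> \<open>The product omits the index \<open>j\<close>, so it does not see the update of
    \<open>f\<close> there.\<close>
  also have "(\<lambda>w. ?P f w) = (\<lambda>w. ?P (f(j := g)) w)"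
    by (intro ext prod.cong) auto
  also have "(\<integral>w. ?P (f(j := g)) w * (\<integral>z. g z * \<phi> (insert_block d j (?y w) z) \<partial>leb_on (d j) (\<Omega> j))
          \<partial>blocks d ({..<n} - {j})) = (\<integral>x. tensor (f(j := g)) x * \<phi> x \<partial>leb_on D \<Omega>')"
    by (subst slice_integral[OF j f' test_function_L2[OF open_product \<phi>]]) simp_all
  finally show "(\<integral>x. tensor f x * multi_deriv D (mi_shift d j \<alpha>) \<phi> x \<partial>leb_on D \<Omega>')
    = (-1) ^ mi_order D (mi_shift d j \<alpha>) * (\<integral>x. tensor (f(j := g)) x * \<phi> x \<partial>leb_on D \<Omega>')"
    by (simp only: mi_order_shift[OF j])
qed

lemma tensor_has_weak_deriv_unit:
  assumes "j < n" "k < d j" "\<And>i. i < n \<Longrightarrow> f i \<in> L2 (d i) (\<Omega> i)"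
    and "has_weak_deriv (d j) (\<Omega> j) (mi_unit k) (f j) g"
  shows "has_weak_deriv D \<Omega>' (mi_unit (offset d j + k)) (tensor f) (tensor (f(j := g)))"
  using tensor_has_weak_deriv[OF assms(1,3,4)] by (simp add: mi_shift_unit assms(2))

lemma tensor_has_weak_deriv_cross:
  assumes ij: "i < j" "j < n" and kl: "k < d i" "l < d j" and f: "\<And>i. i < n \<Longrightarrow> f i \<in> L2 (d i) (\<Omega> i)"
    and g: "has_weak_deriv (d i) (\<Omega> i) (mi_unit k) (f i) g"
    and h: "has_weak_deriv (d j) (\<Omega> j) (mi_unit l) (f j) h"
  shows "has_weak_deriv D \<Omega>' (mi_unit (offset d i + k) + mi_unit (offset d j + l)) (tensor f)
    (tensor (f(i := g, j := h)))"
proof (rule has_weak_deriv_compose[OF open_product])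
  have "offset d i + k < offset d (Suc i)" "offset d (Suc i) \<le> offset d j"
    using kl(1) ij offset_mono[of "Suc i" j d] by (auto simp: offset_Suc)
  then show "offset d i + k < offset d j + l" by simp
  show "offset d j + l < D" using ij kl by (simp add: offset_less)
  show "has_weak_deriv D \<Omega>' (mi_unit (offset d i + k)) (tensor f) (tensor (f(i := g)))"
    using ij kl f g by (intro tensor_has_weak_deriv_unit) auto
  show "has_weak_deriv D \<Omega>' (mi_unit (offset d j + l)) (tensor (f(i := g))) (tensor (f(i := g, j := h)))"
    using ij kl f g h by (intro tensor_has_weak_deriv_unit) (auto dest: has_weak_derivD)
qed

end

section \<open>Self-adjoint operators and tensor products\<close>

lemma nonpos_if_le_all_scaled:
  fixes x C :: real
  assumes "\<And>e. e > 0 \<Longrightarrow> x \<le> e * C"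
  shows "x \<le> 0"
proof (rule field_le_epsilon)
  fix e :: real assume "e > 0"
  then have "x \<le> e / (\<bar>C\<bar> + 1) * C" by (intro assms) auto
  also have "\<dots> \<le> e / (\<bar>C\<bar> + 1) * (\<bar>C\<bar> + 1)" using \<open>e > 0\<close> by (intro mult_left_mono) auto
  also have "\<dots> = e" by simp
  finally show "x \<le> 0 + e" by simp
qed

lemma L2_inner_lincomb:
  assumes "\<And>i. i < m \<Longrightarrow> p i \<in> L2 d \<Omega>" "\<And>i. i < m \<Longrightarrow> q i \<in> L2 d \<Omega>"
  shows "L2_inner d \<Omega> (\<Sum>i<m. csmult (c i) (p i)) (\<Sum>k<m. csmult (c k) (q k))
    = (\<Sum>i<m. \<Sum>k<m. c i * cnj (c k) * L2_inner d \<Omega> (p i) (q k))"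
proof -
  have "L2_inner d \<Omega> (\<Sum>i<m. csmult (c i) (p i)) (\<Sum>k<m. csmult (c k) (q k))
      = (\<Sum>i<m. L2_inner d \<Omega> (csmult (c i) (p i)) (\<Sum>k<m. csmult (c k) (q k)))"
    using assms by (intro L2_inner_sum_left L2_sum L2_csmult) auto
  also have "\<dots> = (\<Sum>i<m. \<Sum>k<m. L2_inner d \<Omega> (csmult (c i) (p i)) (csmult (c k) (q k)))"
    using assms by (intro sum.cong refl L2_inner_sum_right L2_csmult) auto
  finally show ?thesis by (simp only: L2_inner_csmult_left L2_inner_csmult_right mult.assoc mult.left_commute)
qed

text \<open>The seventh fact is the inclusion of the adjoint in the operator: it puts a function
  into the domain solely because of how it pairs with the range. The eighth, symmetry, is the
  opposite inclusion.\<close>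

lemma self_adjoint_D:
  assumes "self_adjoint d \<Omega> Do A"
  shows "csubspace Do" "L2_dense d \<Omega> Do" "Do \<subseteq> L2 d \<Omega>" "u \<in> Do \<Longrightarrow> A u \<in> L2 d \<Omega>"
    "u \<in> Do \<Longrightarrow> v \<in> Do \<Longrightarrow> AE x in leb_on d \<Omega>. A (u + v) x = A u x + A v x"
    "u \<in> Do \<Longrightarrow> AE x in leb_on d \<Omega>. A (csmult c u) x = c * A u x"
    "h \<in> L2 d \<Omega> \<Longrightarrow> k \<in> L2 d \<Omega> \<Longrightarrow> (\<And>u. u \<in> Do \<Longrightarrow> L2_inner d \<Omega> (A u) h = L2_inner d \<Omega> u k)
      \<Longrightarrow> h \<in> Do \<and> (AE x in leb_on d \<Omega>. A h x = k x)"
    "u \<in> Do \<Longrightarrow> v \<in> Do \<Longrightarrow> L2_inner d \<Omega> (A u) v = L2_inner d \<Omega> u (A v)"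
proof -
  have dd: "densely_defined_operator d \<Omega> Do A" and gr: "op_graph d \<Omega> Do A = adjoint_graph d \<Omega> Do A"
    using assms unfolding self_adjoint_def by auto
  then show "csubspace Do" "L2_dense d \<Omega> Do" "u \<in> Do \<Longrightarrow> A u \<in> L2 d \<Omega>"
    unfolding densely_defined_operator_def by auto
  then show sub: "Do \<subseteq> L2 d \<Omega>" unfolding L2_dense_def by auto
  have lin: "AE x in leb_on d \<Omega>. A (csmult a f + csmult b g) x = a * A f x + b * A g x"
    if "f \<in> Do" "g \<in> Do" for f g a b
    using dd that unfolding densely_defined_operator_def by blast
  have one: "csmult 1 f = f" for f by (simp add: csmult_def)
  have zero: "csmult c f + csmult 0 f = csmult c f" for c f by (simp add: fun_eq_iff)
  show "u \<in> Do \<Longrightarrow> v \<in> Do \<Longrightarrow> AE x in leb_on d \<Omega>. A (u + v) x = A u x + A v x"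
    using lin[of u v 1 1] by (simp only: one mult_1)
  show "u \<in> Do \<Longrightarrow> AE x in leb_on d \<Omega>. A (csmult c u) x = c * A u x"
    using lin[of u u c 0] by (simp only: zero mult_zero_left add_0_right)
  show "h \<in> Do \<and> (AE x in leb_on d \<Omega>. A h x = k x)"
    if "h \<in> L2 d \<Omega>" "k \<in> L2 d \<Omega>" "\<And>u. u \<in> Do \<Longrightarrow> L2_inner d \<Omega> (A u) h = L2_inner d \<Omega> u k"
  proof -
    have "(h, k) \<in> adjoint_graph d \<Omega> Do A" using that unfolding adjoint_graph_def by blast
    then have "(h, k) \<in> op_graph d \<Omega> Do A" using gr by simp
    then show ?thesis unfolding op_graph_def by simp
  qed
  show "L2_inner d \<Omega> (A u) v = L2_inner d \<Omega> u (A v)" if "u \<in> Do" "v \<in> Do"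
  proof -
    have "A v \<in> L2 d \<Omega>" using dd that unfolding densely_defined_operator_def by blast
    then have "(v, A v) \<in> op_graph d \<Omega> Do A" using that unfolding op_graph_def by simp
    then have "(v, A v) \<in> adjoint_graph d \<Omega> Do A" using gr by simp
    then show ?thesis using that unfolding adjoint_graph_def by simp
  qed
qed

lemma self_adjoint_diff:
  assumes "self_adjoint d \<Omega> Do A" "u \<in> Do" "v \<in> Do"
  shows "u - v \<in> Do" "AE x in leb_on d \<Omega>. A (u - v) x = A u x - A v x"
proof -
  note sa = self_adjoint_D[OF assms(1)]
  show "u - v \<in> Do" using sa(1) assms(2,3) by (rule cfun.subspace_diff)
  have v': "csmult (-1) v \<in> Do" using sa(1) assms(3) by (rule cfun.subspace_scale)
  show "AE x in leb_on d \<Omega>. A (u - v) x = A u x - A v x"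
    unfolding diff_eq_csmult using sa(5)[OF assms(2) v'] sa(6)[OF assms(3), of "-1"]
    by eventually_elim simp
qed

text \<open>Serves twice: for a factor operator on its full domain, and for \<open>T\<close> on the
  span of tensors, where orthogonality is known only against that span.\<close>

lemma dense_range_one_plus:
  assumes sa: "self_adjoint d \<Omega> Do A" and D0: "csubspace D0" "D0 \<subseteq> Do"
    and orth: "\<And>h. h \<in> L2 d \<Omega> \<Longrightarrow> (\<And>u. u \<in> D0 \<Longrightarrow> L2_inner d \<Omega> h (u + A u) = 0) \<Longrightarrow> L2_norm d \<Omega> h = 0"
    and f: "f \<in> L2 d \<Omega>" and e: "e > 0"
  shows "\<exists>u\<in>D0. L2_norm d \<Omega> (f - (u + A u)) < e"
proof -
  note A = self_adjoint_D[OF sa]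
  \<comment> \<open>saturated under equality almost everywhere, since \<open>A\<close> is linear only up to null sets\<close>
  define V where "V = {v \<in> L2 d \<Omega>. \<exists>u\<in>D0. AE x in leb_on d \<Omega>. v x = u x + A u x}"
  have RL: "u + A u \<in> L2 d \<Omega>" if "u \<in> D0" for u using that A(3,4) D0(2) by (intro L2_add) auto
  have RV: "u + A u \<in> V" if "u \<in> D0" for u unfolding V_def using that RL by auto
  have "L2_dense d \<Omega> V"
  proof (rule L2_dense_if_orthogonal_trivial)
    show "csubspace V"
    proof (rule cfun.subspaceI)
      have "AE x in leb_on d \<Omega>. A (csmult 0 0) x = 0 * A 0 x"
        using D0 cfun.subspace_0[OF D0(1)] by (intro A(6)) auto
      moreover have "csmult 0 0 = 0" by (simp add: fun_eq_iff)
      ultimately show "0 \<in> V" unfolding V_def using L2_zero cfun.subspace_0[OF D0(1)]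
        by (intro CollectI conjI bexI[of _ 0]) auto
    next
      fix v w assume "v \<in> V" "w \<in> V"
      then obtain a b where ab: "v \<in> L2 d \<Omega>" "w \<in> L2 d \<Omega>" "a \<in> D0" "b \<in> D0"
        "AE x in leb_on d \<Omega>. v x = a x + A a x" "AE x in leb_on d \<Omega>. w x = b x + A b x"
        unfolding V_def by blast
      have "AE x in leb_on d \<Omega>. A (a + b) x = A a x + A b x" using ab D0 by (intro A(5)) auto
      with ab(5,6) have "AE x in leb_on d \<Omega>. (v + w) x = (a + b) x + A (a + b) x"
        by eventually_elim simp
      then show "v + w \<in> V" unfolding V_def using ab cfun.subspace_add[OF D0(1)] L2_add by blast
    next
      fix c v assume "v \<in> V"
      then obtain a where a: "v \<in> L2 d \<Omega>" "a \<in> D0" "AE x in leb_on d \<Omega>. v x = a x + A a x"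
        unfolding V_def by blast
      have "AE x in leb_on d \<Omega>. A (csmult c a) x = c * A a x" using a D0 by (intro A(6)) auto
      with a(3) have "AE x in leb_on d \<Omega>. csmult c v x = csmult c a x + A (csmult c a) x"
        by eventually_elim (simp add: distrib_left)
      then show "csmult c v \<in> V" unfolding V_def using a cfun.subspace_scale[OF D0(1)] L2_csmult by blast
    qed
    show "V \<subseteq> L2 d \<Omega>" unfolding V_def by blast
  qed (use orth RV in blast)
  then obtain v where v: "v \<in> V" "L2_norm d \<Omega> (f - v) < e"
    using f e unfolding L2_dense_def by blast
  then obtain u where u: "u \<in> D0" "AE x in leb_on d \<Omega>. v x = u x + A u x" "v \<in> L2 d \<Omega>"
    unfolding V_def by blast
  have "AE x in leb_on d \<Omega>. (f - (u + A u)) x = (f - v) x" using u(2) by eventually_elim simp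
  then have "L2_norm d \<Omega> (f - (u + A u)) = L2_norm d \<Omega> (f - v)"
    by (intro L2_norm_cong_AE L2_diff f RL u)
  with v(2) u(1) show ?thesis by (intro bexI[of _ u]) auto
qed

text \<open>A function \<open>h\<close> orthogonal to the range of \<open>1 + A\<close> satisfies
  the adjoint equation \<open>A h = - h\<close>, so self-adjointness puts it into the domain, and
  nonnegativity of \<open>\<langle>A h, h\<rangle> = - \<parallel>h\<parallel>\<^sup>2\<close>
  leaves only \<open>h = 0\<close>.\<close>

lemma dense_range_self_adjoint_nonnegative:
  assumes sa: "self_adjoint d \<Omega> Do A" and nn: "nonnegative d \<Omega> Do A"
  shows "L2_dense d \<Omega> {u + A u | u. u \<in> Do}"
  unfolding L2_dense_def
proof (intro conjI ballI allI impI)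
  note A = self_adjoint_D[OF sa]
  show "{u + A u | u. u \<in> Do} \<subseteq> L2 d \<Omega>" using A(3,4) by (auto intro!: L2_add)
  fix f and e :: real assume "f \<in> L2 d \<Omega>" "e > 0"
  have "\<exists>u\<in>Do. L2_norm d \<Omega> (f - (u + A u)) < e"
  proof (rule dense_range_one_plus[OF sa A(1) order_refl])
    fix h assume h: "h \<in> L2 d \<Omega>" and orth: "\<And>u. u \<in> Do \<Longrightarrow> L2_inner d \<Omega> h (u + A u) = 0"
    have "L2_inner d \<Omega> (A u) h = L2_inner d \<Omega> u (- h)" if u: "u \<in> Do" for u
    proof -
      have "L2_inner d \<Omega> (u + A u) h = 0" using orth[OF u] L2_inner_commute[of d \<Omega> "u + A u" h] by simp
      moreover have "L2_inner d \<Omega> (u + A u) h = L2_inner d \<Omega> u h + L2_inner d \<Omega> (A u) h"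
        using u h A(3,4) by (intro L2_inner_add_left) auto
      ultimately show ?thesis by (simp add: L2_inner_uminus_right add_eq_0_iff)
    qed
    then have hD: "h \<in> Do" and AE: "AE x in leb_on d \<Omega>. A h x = (- h) x"
      using A(7)[OF h L2_uminus[OF h]] by blast+
    have "L2_inner d \<Omega> (A h) h = L2_inner d \<Omega> (- h) h"
      using AE h A(4)[OF hD] by (intro L2_inner_cong_AE L2_uminus) auto
    also have "\<dots> = - of_real ((L2_norm d \<Omega> h)\<^sup>2)" by (simp only: L2_inner_uminus_left L2_inner_self)
    finally have "0 \<le> - (L2_norm d \<Omega> h)\<^sup>2"
      using nn hD unfolding nonnegative_def by (metis Re_complex_of_real uminus_complex.simps(1))
    then show "L2_norm d \<Omega> h = 0" by simp
  qed fact+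
  then show "\<exists>g\<in>{u + A u | u. u \<in> Do}. L2_norm d \<Omega> (f - g) < e" by blast
qed

lemma form_operatorD:
  assumes "form_operator d \<Omega> V Do A"
  shows "self_adjoint d \<Omega> Do A" "nonnegative d \<Omega> Do A" "Do \<subseteq> V"
    "u \<in> Do \<Longrightarrow> v \<in> V \<Longrightarrow> dirichlet_form d \<Omega> u v = L2_inner d \<Omega> (A u) v"
  using assms unfolding form_operator_def by auto

section \<open>Tensors of dense families are total\<close>

context product_setting
begin

lemma tensor_cong: "(\<And>j. j < n \<Longrightarrow> f j = g j) \<Longrightarrow> tensor f = tensor g"
  unfolding elem_tensor_def by (intro ext prod.cong) auto

lemma tensor_update_diff:
  assumes "k < n"
  shows "tensor (v(k := a - b)) = tensor (v(k := a)) - tensor (v(k := b))"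
proof
  fix x
  have "tensor (v(k := c)) x = c (block d k x) * (\<Prod>j\<in>{..<n} - {k}. v j (block d j x))" for c
  proof -
    have "tensor (v(k := c)) x = c (block d k x) * (\<Prod>j\<in>{..<n} - {k}. (v(k := c)) j (block d j x))"
      unfolding elem_tensor_def using assms by (subst prod.remove[of _ k]) auto
    also have "(\<Prod>j\<in>{..<n} - {k}. (v(k := c)) j (block d j x)) = (\<Prod>j\<in>{..<n} - {k}. v j (block d j x))"
      by (rule prod.cong) auto
    finally show ?thesis .
  qed
  then show "tensor (v(k := a - b)) x = (tensor (v(k := a)) - tensor (v(k := b))) x"
    by (simp add: left_diff_distrib)
qed

lemma tensor_norm:
  assumes "\<And>j. j < n \<Longrightarrow> v j \<in> L2 (d j) (\<Omega> j)"
  shows "L2_norm D \<Omega>' (tensor v) = (\<Prod>j<n. L2_norm (d j) (\<Omega> j) (v j))"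
proof -
  have "complex_of_real ((L2_norm D \<Omega>' (tensor v))\<^sup>2) = (\<Prod>j<n. of_real ((L2_norm (d j) (\<Omega> j) (v j))\<^sup>2))"
    unfolding L2_inner_self[symmetric] by (rule tensor_inner) (use assms in auto)
  also have "\<dots> = complex_of_real ((\<Prod>j<n. L2_norm (d j) (\<Omega> j) (v j))\<^sup>2)"
    by (simp only: of_real_prod prod_power_distrib)
  finally have "(L2_norm D \<Omega>' (tensor v))\<^sup>2 = (\<Prod>j<n. L2_norm (d j) (\<Omega> j) (v j))\<^sup>2"
    by (simp only: of_real_eq_iff)
  then show ?thesis by (simp add: prod_nonneg)
qed

text \<open>The slots are enlarged one at a time: induction on \<open>k\<close> lets the first
  \<open>k\<close> slots range over L2 while the others stay in \<open>S\<close>. In the step, slot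
  \<open>k\<close> is approximated from \<open>S k\<close>, and the error is a tensor with one small
  factor. Only approximation in norm enters, which suits the sets of all \<open>u + A j u\<close>,
  linear merely up to null sets.\<close>

lemma orthogonal_to_L2_tensors:
  assumes h: "h \<in> L2 D \<Omega>'" and S: "\<And>j. j < n \<Longrightarrow> L2_dense (d j) (\<Omega> j) (S j)"
    and orth: "\<And>v. (\<And>j. j < n \<Longrightarrow> v j \<in> S j) \<Longrightarrow> L2_inner D \<Omega>' h (tensor v) = 0"
    and v: "\<And>j. j < n \<Longrightarrow> v j \<in> L2 (d j) (\<Omega> j)"
  shows "L2_inner D \<Omega>' h (tensor v) = 0"
proof -
  have SL: "S j \<subseteq> L2 (d j) (\<Omega> j)" if "j < n" for j using S[OF that] unfolding L2_dense_def by blast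
  have "L2_inner D \<Omega>' h (tensor v) = 0"
    if "k \<le> n" "\<And>j. j < k \<Longrightarrow> v j \<in> L2 (d j) (\<Omega> j)" "\<And>j. k \<le> j \<Longrightarrow> j < n \<Longrightarrow> v j \<in> S j" for k v
    using that
  proof (induction k arbitrary: v)
    case (Suc k)
    have k: "k < n" using Suc.prems by simp
    have vL: "v j \<in> L2 (d j) (\<Omega> j)" if "j < n" for j
      using Suc.prems(2,3)[of j] SL[OF that] that by (cases "j < Suc k") auto
    let ?C = "\<Prod>j\<in>{..<n} - {k}. L2_norm (d j) (\<Omega> j) (v j)"
    have "cmod (L2_inner D \<Omega>' h (tensor v)) \<le> e * (?C * L2_norm D \<Omega>' h)" if "e > 0" for e
    proof -
      obtain g where g: "g \<in> S k" "L2_norm (d k) (\<Omega> k) (v k - g) < e"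
        using S[OF k] vL[OF k] \<open>e > 0\<close> unfolding L2_dense_def by blast
      have gL: "g \<in> L2 (d k) (\<Omega> k)" using g SL k by auto
      let ?w = "v(k := v k - g)"
      have wL: "?w j \<in> L2 (d j) (\<Omega> j)" if "j < n" for j
        using that vL gL by (auto intro: L2_diff)
      have gL': "(v(k := g)) j \<in> L2 (d j) (\<Omega> j)" if "j < n" for j
        using that vL gL by auto
      have zero: "L2_inner D \<Omega>' h (tensor (v(k := g))) = 0"
        using Suc.prems g by (intro Suc.IH) (auto simp: less_Suc_eq)
      have "tensor ?w = tensor v - tensor (v(k := g))"
        using tensor_update_diff[OF k, of v "v k" g] by simp
      then have "L2_inner D \<Omega>' h (tensor ?w) = L2_inner D \<Omega>' h (tensor v) - L2_inner D \<Omega>' h (tensor (v(k := g)))"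
        by (simp only: L2_inner_diff_right[OF tensor_L2[of v, OF vL] tensor_L2[OF gL'] h])
      then have eq: "L2_inner D \<Omega>' h (tensor v) = L2_inner D \<Omega>' h (tensor ?w)"
        unfolding zero by simp
      have "(\<Prod>j\<in>{..<n} - {k}. L2_norm (d j) (\<Omega> j) (?w j)) = ?C"
        by (rule prod.cong) auto
      then have "(\<Prod>j<n. L2_norm (d j) (\<Omega> j) (?w j)) = L2_norm (d k) (\<Omega> k) (v k - g) * ?C"
        using k by (subst prod.remove[of _ k]) auto
      then have norm: "L2_norm D \<Omega>' (tensor ?w) = L2_norm (d k) (\<Omega> k) (v k - g) * ?C"
        by (simp only: tensor_norm[of ?w, OF wL])
      have "cmod (L2_inner D \<Omega>' h (tensor v)) \<le> L2_norm D \<Omega>' h * (L2_norm (d k) (\<Omega> k) (v k - g) * ?C)"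
        unfolding eq norm[symmetric] by (rule L2_Cauchy_Schwarz[OF h tensor_L2[of ?w, OF wL]])
      also have "\<dots> \<le> L2_norm D \<Omega>' h * (e * ?C)"
        using g(2) by (intro mult_left_mono mult_right_mono prod_nonneg) auto
      finally show ?thesis by (simp add: mult_ac)
    qed
    then have "cmod (L2_inner D \<Omega>' h (tensor v)) \<le> 0" by (rule nonpos_if_le_all_scaled)
    then show ?case by simp
  qed (use orth in auto)
  from this[of n v] show ?thesis using v by auto
qed

lemma tensor_indicator_open_box:
  assumes "x \<in> topspace (eucl D)"
  shows "tensor (\<lambda>j. indicator (open_box (d j) (\<lambda>k. a (offset d j + k)) (\<lambda>k. b (offset d j + k)))) x
    = indicator (open_box D a b) x"
proof -
  have iff: "x \<in> open_box D a b \<longleftrightarrow>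
    (\<forall>j<n. block d j x \<in> open_box (d j) (\<lambda>k. a (offset d j + k)) (\<lambda>k. b (offset d j + k)))"
    (is "?l \<longleftrightarrow> ?r")
  proof -
    have "?l \<longleftrightarrow> (\<forall>i<D. x i \<in> {a i<..<b i})" using assms by (simp add: open_box_def PiE_iff Ball_def)
    also have "\<dots> \<longleftrightarrow> (\<forall>j<n. \<forall>k<d j. x (offset d j + k) \<in> {a (offset d j + k)<..<b (offset d j + k)})"
      using offset_less offset_decomp by metis
    also have "\<dots> \<longleftrightarrow> ?r" by (simp add: open_box_def PiE_iff block_eq Ball_def)
    finally show ?thesis .
  qed
  show ?thesis
  proof (cases ?thesis)
    case False
    then show ?thesis
    proof (cases "x \<in> open_box D a b")
      case True
      then show ?thesis using iff by (simp add: elem_tensor_def)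
    next
      case False
      then obtain j where "j < n" "block d j x \<notin> open_box (d j) (\<lambda>k. a (offset d j + k)) (\<lambda>k. b (offset d j + k))"
        using iff by blast
      then show ?thesis using False unfolding elem_tensor_def
        by (simp, intro bexI[of _ j]) auto
    qed
  qed
qed

text \<open>The indicator of a box is the tensor of the indicators of its blocks, so integrals of
  \<open>h\<close> over boxes are inner products with tensors of L2 functions, to which
  orthogonality has just been extended.\<close>

lemma L2_zero_if_orthogonal_to_tensors:
  assumes h: "h \<in> L2 D \<Omega>'" and S: "\<And>j. j < n \<Longrightarrow> L2_dense (d j) (\<Omega> j) (S j)"
    and orth: "\<And>v. (\<And>j. j < n \<Longrightarrow> v j \<in> S j) \<Longrightarrow> L2_inner D \<Omega>' h (tensor v) = 0"
  shows "L2_norm D \<Omega>' h = 0"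
proof (rule L2_norm_AE_zero, rule L2_AE_zero_if_box_integrals_zero[OF open_product h])
  fix a b
  let ?v = "\<lambda>j. indicator (open_box (d j) (\<lambda>k. a (offset d j + k)) (\<lambda>k. b (offset d j + k))) :: cfun"
  have "L2_inner D \<Omega>' h (tensor ?v) = 0"
    by (rule orthogonal_to_L2_tensors[OF h S orth]) (auto intro: indicator_open_box_L2 open_factor)
  moreover have "L2_inner D \<Omega>' h (tensor ?v) = (\<integral>x. indicator (open_box D a b) x * h x \<partial>leb_on D \<Omega>')"
    unfolding L2_inner_def
  proof (rule Bochner_Integration.integral_cong[OF refl])
    fix x assume "x \<in> space (leb_on D \<Omega>')"
    then have "x \<in> topspace (eucl D)" using space_leb_on[OF open_product] openin_subset[OF open_product] by blast
    then show "h x * cnj (tensor ?v x) = indicator (open_box D a b) x * h x"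
      by (simp only: tensor_indicator_open_box) (simp add: indicator_def)
  qed
  ultimately show "(\<integral>x. indicator (open_box D a b) x * h x \<partial>leb_on D \<Omega>') = 0" by simp
qed

end

section \<open>The algebraic tensor product of the operator domains\<close>

locale factor_operators = product_setting +
  fixes H :: "nat \<Rightarrow> cfun set" and Dom :: "nat \<Rightarrow> cfun set" and A :: "nat \<Rightarrow> cfun \<Rightarrow> cfun"
  assumes H_sobolev: "\<And>j. j < n \<Longrightarrow> H j \<subseteq> sobolev 1 (d j) (\<Omega> j)"
    and form_A: "\<And>j. j < n \<Longrightarrow> form_operator (d j) (\<Omega> j) (H j) (Dom j) (A j)"
begin

abbreviation "ip j \<equiv> L2_inner (d j) (\<Omega> j)"
abbreviation "Der j k \<equiv> weak_deriv (d j) (\<Omega> j) (mi_unit k)"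

lemmas sa = form_operatorD(1)[OF form_A]

lemma Dom_L2: "j < n \<Longrightarrow> u \<in> Dom j \<Longrightarrow> u \<in> L2 (d j) (\<Omega> j)"
  using self_adjoint_D(3)[OF sa] by blast

lemma A_L2: "j < n \<Longrightarrow> u \<in> Dom j \<Longrightarrow> A j u \<in> L2 (d j) (\<Omega> j)"
  using self_adjoint_D(4)[OF sa] by blast

lemma A_sym: "j < n \<Longrightarrow> u \<in> Dom j \<Longrightarrow> v \<in> Dom j \<Longrightarrow> ip j (A j u) v = ip j u (A j v)"
  using self_adjoint_D(8)[OF sa] by blast

lemma Dom_H: "j < n \<Longrightarrow> u \<in> Dom j \<Longrightarrow> u \<in> H j"
  using form_operatorD(3)[OF form_A] by blast

lemma H_L2: "j < n \<Longrightarrow> u \<in> H j \<Longrightarrow> u \<in> L2 (d j) (\<Omega> j)"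
  using H_sobolev unfolding sobolev_def by blast

lemma H_weak_deriv:
  "j < n \<Longrightarrow> u \<in> H j \<Longrightarrow> k < d j \<Longrightarrow> has_weak_deriv (d j) (\<Omega> j) (mi_unit k) u (Der j k u)"
  using H_sobolev by (intro sobolev_1_has_weak_deriv open_factor) auto

lemma H_deriv_L2: "j < n \<Longrightarrow> u \<in> H j \<Longrightarrow> k < d j \<Longrightarrow> Der j k u \<in> L2 (d j) (\<Omega> j)"
  using H_weak_deriv has_weak_derivD(2) by blast

lemma A_form: "j < n \<Longrightarrow> u \<in> Dom j \<Longrightarrow> v \<in> H j \<Longrightarrow> (\<Sum>k<d j. ip j (Der j k u) (Der j k v)) = ip j (A j u) v"
  using form_operatorD(4)[OF form_A] unfolding dirichlet_form_def by blast

text \<open>The entrywise product of Gram matrices is the sum of the Gram matrices of tensors of the vectors.\<close>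

lemma gram_tensor_nonneg:
  fixes N :: "nat \<Rightarrow> nat"
  assumes P: "\<And>i j k. i < m \<Longrightarrow> j < n \<Longrightarrow> k < N j \<Longrightarrow> P j k i \<in> L2 (d j) (\<Omega> j)"
  shows "0 \<le> Re (\<Sum>i<m. \<Sum>l<m. c i * cnj (c l) * (\<Prod>j<n. \<Sum>k<N j. ip j (P j k i) (P j k l)))"
proof -
  let ?E = "\<Pi>\<^sub>E j\<in>{..<n}. {..<N j}"
  let ?t = "\<lambda>\<kappa> i. tensor (\<lambda>j. P j (\<kappa> j) i)"
  have PL: "P j (\<kappa> j) i \<in> L2 (d j) (\<Omega> j)" if "\<kappa> \<in> ?E" "i < m" "j < n" for \<kappa> i j
    using that P by (simp add: PiE_iff)
  have t: "?t \<kappa> i \<in> L2 D \<Omega>'" if "\<kappa> \<in> ?E" "i < m" for \<kappa> i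
    by (rule tensor_L2) (rule PL[OF that])
  have "(\<Prod>j<n. \<Sum>k<N j. ip j (P j k i) (P j k l)) = (\<Sum>\<kappa>\<in>?E. L2_inner D \<Omega>' (?t \<kappa> i) (?t \<kappa> l))"
    if "i < m" "l < m" for i l
  proof -
    have "(\<Prod>j<n. \<Sum>k<N j. ip j (P j k i) (P j k l)) = (\<Sum>\<kappa>\<in>?E. \<Prod>j<n. ip j (P j (\<kappa> j) i) (P j (\<kappa> j) l))"
      by (rule prod_sum_PiE) auto
    also have "\<dots> = (\<Sum>\<kappa>\<in>?E. L2_inner D \<Omega>' (?t \<kappa> i) (?t \<kappa> l))"
      by (intro sum.cong refl tensor_inner[symmetric]) (use PL that in blast)+
    finally show ?thesis .
  qed
  then have "(\<Sum>i<m. \<Sum>l<m. c i * cnj (c l) * (\<Prod>j<n. \<Sum>k<N j. ip j (P j k i) (P j k l)))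
      = (\<Sum>i<m. \<Sum>l<m. \<Sum>\<kappa>\<in>?E. c i * cnj (c l) * L2_inner D \<Omega>' (?t \<kappa> i) (?t \<kappa> l))"
    by (intro sum.cong refl) (simp add: sum_distrib_left)
  also have "\<dots> = (\<Sum>i<m. \<Sum>\<kappa>\<in>?E. \<Sum>l<m. c i * cnj (c l) * L2_inner D \<Omega>' (?t \<kappa> i) (?t \<kappa> l))"
    by (intro sum.cong refl, rule sum.swap)
  also have "\<dots> = (\<Sum>\<kappa>\<in>?E. \<Sum>i<m. \<Sum>l<m. c i * cnj (c l) * L2_inner D \<Omega>' (?t \<kappa> i) (?t \<kappa> l))"
    by (rule sum.swap)
  also have "\<dots> = (\<Sum>\<kappa>\<in>?E. of_real ((L2_norm D \<Omega>' (\<Sum>i<m. csmult (c i) (?t \<kappa> i)))\<^sup>2))"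
    unfolding L2_inner_self[symmetric]
    by (intro sum.cong refl L2_inner_lincomb[symmetric]) (use t in blast)+
  finally show ?thesis by (simp add: sum_nonneg)
qed

definition apply_on :: "nat set \<Rightarrow> (nat \<Rightarrow> cfun) \<Rightarrow> cfun" where
  "apply_on S u = tensor (\<lambda>j. if j \<in> S then A j (u j) else u j)"

definition Doms :: "(nat \<Rightarrow> cfun) set" where
  "Doms = {u. \<forall>j<n. u j \<in> Dom j}"

lemma apply_on_L2: "u \<in> Doms \<Longrightarrow> apply_on S u \<in> L2 D \<Omega>'"
  unfolding apply_on_def Doms_def by (intro tensor_L2) (auto intro: Dom_L2 A_L2)

lemma apply_on_inner:
  assumes "u \<in> Doms" "v \<in> Doms"
  shows "L2_inner D \<Omega>' (apply_on S u) (apply_on R v)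
    = (\<Prod>j<n. ip j (if j \<in> S then A j (u j) else u j) (if j \<in> R then A j (v j) else v j))"
  unfolding apply_on_def using assms by (intro tensor_inner) (auto simp: Doms_def intro: Dom_L2 A_L2)

text \<open>Where \<open>S\<close> and \<open>R\<close> agree at \<open>j\<close>, factor
  \<open>j\<close> contributes inner products within one family of vectors. Where they differ,
  symmetry and the form identity turn its contribution into a sum over \<open>k\<close> of inner
  products of \<open>k\<close>-th derivatives. \<open>N j\<close> counts the families and
  \<open>P j\<close> lists them, which is the shape required by
  \<open>gram_tensor_nonneg\<close>.\<close>

lemma apply_on_lincomb_nonneg:
  assumes U: "\<And>i. i < m \<Longrightarrow> U i \<in> Doms"
  shows "0 \<le> Re (L2_inner D \<Omega>' (\<Sum>i<m. csmult (c i) (apply_on S (U i))) (\<Sum>l<m. csmult (c l) (apply_on R (U l))))"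
proof -
  define N where "N j = (if (j \<in> S) = (j \<in> R) then 1 else d j)" for j
  define P where "P j k i = (if (j \<in> S) = (j \<in> R) then (if j \<in> S then A j (U i j) else U i j)
    else Der j k (U i j))" for j k i
  have UD: "U i j \<in> Dom j" if "i < m" "j < n" for i j using U that by (auto simp: Doms_def)
  have gram: "ip j (if j \<in> S then A j (U i j) else U i j) (if j \<in> R then A j (U l j) else U l j)
      = (\<Sum>k<N j. ip j (P j k i) (P j k l))" if "i < m" "l < m" "j < n" for i l j
    using that A_form[OF that(3) UD Dom_H[OF _ UD], of i l] A_sym[OF that(3) UD UD, of i l]
    by (auto simp: N_def P_def)
  have "P j k i \<in> L2 (d j) (\<Omega> j)" if "i < m" "j < n" "k < N j" for i j k
    using that UD Dom_L2 A_L2 H_deriv_L2 Dom_H by (auto simp: P_def N_def split: if_splits)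
  then have "0 \<le> Re (\<Sum>i<m. \<Sum>l<m. c i * cnj (c l) * (\<Prod>j<n. \<Sum>k<N j. ip j (P j k i) (P j k l)))"
    by (rule gram_tensor_nonneg)
  also have "(\<Sum>i<m. \<Sum>l<m. c i * cnj (c l) * (\<Prod>j<n. \<Sum>k<N j. ip j (P j k i) (P j k l)))
      = (\<Sum>i<m. \<Sum>l<m. c i * cnj (c l) * L2_inner D \<Omega>' (apply_on S (U i)) (apply_on R (U l)))"
    using U by (intro sum.cong refl arg_cong2[where f = "(*)"]) (simp add: apply_on_inner gram)
  also have "\<dots> = L2_inner D \<Omega>' (\<Sum>i<m. csmult (c i) (apply_on S (U i))) (\<Sum>l<m. csmult (c l) (apply_on R (U l)))"
    by (intro L2_inner_lincomb[symmetric]) (use U apply_on_L2 in blast)+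
  finally show ?thesis .
qed

section \<open>The auxiliary operator and the trivial orthogonal complement\<close>

definition all_subsets_sum :: "(nat \<Rightarrow> cfun) \<Rightarrow> cfun" where
  "all_subsets_sum u = (\<Sum>S\<in>Pow {..<n}. apply_on S u)"

text \<open>
  In the notation of the introduction, \<open>apply_on S u\<close> is \<open>A\<^sub>S u\<close>, \<open>all_subsets_sum u\<close> is \<open>W u\<close> and
  \<open>small_subsets_sum u\<close> is \<open>(T + 1) u\<close>.
\<close>

definition small_subsets :: "nat set set" where
  "small_subsets = insert {} ((\<lambda>j. {j}) ` {..<n})"

definition small_subsets_sum :: "(nat \<Rightarrow> cfun) \<Rightarrow> cfun" where
  "small_subsets_sum u = (\<Sum>S\<in>small_subsets. apply_on S u)"

lemma small_subsets: "finite small_subsets" "small_subsets \<subseteq> Pow {..<n}" "{} \<in> small_subsets"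
  unfolding small_subsets_def by auto

lemma all_subsets_sum_eq_tensor: "all_subsets_sum u = tensor (\<lambda>j. u j + A j (u j))"
proof
  fix x
  have "tensor (\<lambda>j. u j + A j (u j)) x = (\<Prod>j<n. A j (u j) (block d j x) + u j (block d j x))"
    unfolding elem_tensor_def by (simp add: add.commute)
  also have "\<dots> = (\<Sum>S\<in>Pow {..<n}. (\<Prod>j\<in>S. A j (u j) (block d j x)) * (\<Prod>j\<in>{..<n} - S. u j (block d j x)))"
    by (rule prod_add) simp
  also have "\<dots> = (\<Sum>S\<in>Pow {..<n}. apply_on S u x)"
  proof (rule sum.cong[OF refl])
    fix S assume S: "S \<in> Pow {..<n}"
    have "apply_on S u x = (\<Prod>j\<in>S. (if j \<in> S then A j (u j) else u j) (block d j x))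
        * (\<Prod>j\<in>{..<n} - S. (if j \<in> S then A j (u j) else u j) (block d j x))"
      unfolding apply_on_def elem_tensor_def using S
      by (subst mult.commute, intro prod.subset_diff) auto
    also have "\<dots> = (\<Prod>j\<in>S. A j (u j) (block d j x)) * (\<Prod>j\<in>{..<n} - S. u j (block d j x))"
      by (intro arg_cong2[where f = "(*)"] prod.cong) auto
    finally show "(\<Prod>j\<in>S. A j (u j) (block d j x)) * (\<Prod>j\<in>{..<n} - S. u j (block d j x)) = apply_on S u x" by simp
  qed
  finally show "all_subsets_sum u x = tensor (\<lambda>j. u j + A j (u j)) x"
    by (simp add: all_subsets_sum_def)
qed

lemma all_subsets_sum_L2: "u \<in> Doms \<Longrightarrow> all_subsets_sum u \<in> L2 D \<Omega>'"
  unfolding all_subsets_sum_def by (intro L2_sum apply_on_L2)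

lemma small_subsets_sum_L2: "u \<in> Doms \<Longrightarrow> small_subsets_sum u \<in> L2 D \<Omega>'"
  unfolding small_subsets_sum_def by (intro L2_sum apply_on_L2)

lemma all_subsets_sum_sym:
  assumes "u \<in> Doms" "v \<in> Doms"
  shows "L2_inner D \<Omega>' (all_subsets_sum u) (tensor v) = L2_inner D \<Omega>' (tensor u) (all_subsets_sum v)"
proof -
  have t: "tensor w = apply_on {} w" for w by (simp add: apply_on_def)
  have "L2_inner D \<Omega>' (apply_on S u) (apply_on {} v) = L2_inner D \<Omega>' (apply_on {} u) (apply_on S v)" for S
    unfolding apply_on_inner[OF assms] using assms
    by (intro prod.cong refl) (auto simp: Doms_def A_sym)
  then show ?thesis
    unfolding all_subsets_sum_def t using assms
    by (simp add: L2_inner_sum_left L2_inner_sum_right apply_on_L2)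
qed

lemma lincomb_sum_swap:
  "(\<Sum>i<m. csmult (c i) (\<Sum>S\<in>X. f S i)) = (\<Sum>S\<in>X. \<Sum>i<m. csmult (c i) (f S i))"
  by (subst sum.swap) (simp add: cfun.scale_sum_right)

text \<open>All the inner products expand into terms
  \<open>Re (L2_inner D \<Omega>' (a S) (a R))\<close>, and every term is nonnegative. Each
  inequality only drops terms: the first keeps the pair \<open>({}, {})\<close>, the second keeps
  the pairs of small subsets.\<close>

lemma lincomb_bounds:
  fixes c :: "nat \<Rightarrow> complex"
  assumes U: "\<And>i. i < m \<Longrightarrow> U i \<in> Doms"
  defines "u \<equiv> \<Sum>i<m. csmult (c i) (tensor (U i))"
    and "b \<equiv> \<Sum>i<m. csmult (c i) (small_subsets_sum (U i))"
    and "w \<equiv> \<Sum>i<m. csmult (c i) (all_subsets_sum (U i))"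
  shows "(L2_norm D \<Omega>' u)\<^sup>2 \<le> Re (L2_inner D \<Omega>' b w)" "L2_norm D \<Omega>' b \<le> L2_norm D \<Omega>' w"
proof -
  define a where "a S = (\<Sum>i<m. csmult (c i) (apply_on S (U i)))" for S
  have aL: "a S \<in> L2 D \<Omega>'" for S unfolding a_def using U by (intro L2_sum L2_csmult apply_on_L2) auto
  have nn: "0 \<le> Re (L2_inner D \<Omega>' (a S) (a R))" for S R
    unfolding a_def by (rule apply_on_lincomb_nonneg[OF U])
  have u: "u = a {}" unfolding u_def a_def apply_on_def by simp
  have b: "b = (\<Sum>S\<in>small_subsets. a S)"
    unfolding b_def small_subsets_sum_def a_def by (rule lincomb_sum_swap)
  have w: "w = (\<Sum>S\<in>Pow {..<n}. a S)"
    unfolding w_def all_subsets_sum_def a_def by (rule lincomb_sum_swap)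
  have inner: "Re (L2_inner D \<Omega>' (\<Sum>S\<in>X. a S) (\<Sum>S\<in>Y. a S)) = (\<Sum>(S, R)\<in>X \<times> Y. Re (L2_inner D \<Omega>' (a S) (a R)))"
    for X Y
    by (simp add: L2_inner_sum_left L2_inner_sum_right aL L2_sum flip: sum.cartesian_product)
      (rule sum.swap)
  have "Re (L2_inner D \<Omega>' (\<Sum>S\<in>{{}}. a S) (\<Sum>S\<in>{{}}. a S)) \<le> Re (L2_inner D \<Omega>' b w)"
    unfolding b w inner using small_subsets nn by (intro sum_mono2) auto
  then show "(L2_norm D \<Omega>' u)\<^sup>2 \<le> Re (L2_inner D \<Omega>' b w)"
    by (simp add: L2_norm_square_Re u)
  have "(L2_norm D \<Omega>' b)\<^sup>2 \<le> (L2_norm D \<Omega>' w)\<^sup>2"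
    unfolding L2_norm_square_Re b w inner using small_subsets nn by (intro sum_mono2) auto
  then show "L2_norm D \<Omega>' b \<le> L2_norm D \<Omega>' w" by (rule power2_le_imp_le) simp
qed

text \<open>The limit argument is carried out with explicit bounds: for every \<open>e > 0\<close>
  the inner product of \<open>h\<close> with \<open>tensor v\<close> is at most an expression that
  tends to 0 with \<open>e\<close>. Tensors of domain elements are total, so \<open>h\<close>
  vanishes.\<close>

lemma core_orthogonal_trivial:
  assumes h: "h \<in> L2 D \<Omega>'" and orth: "\<And>u. u \<in> Doms \<Longrightarrow> L2_inner D \<Omega>' h (small_subsets_sum u) = 0"
  shows "L2_norm D \<Omega>' h = 0"
proof (rule L2_zero_if_orthogonal_to_tensors[OF h])
  show "L2_dense (d j) (\<Omega> j) (Dom j)" if "j < n" for j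
    by (rule self_adjoint_D(2)[OF sa[OF that]])
  fix v assume "\<And>j. j < n \<Longrightarrow> v j \<in> Dom j"
  then have v: "v \<in> Doms" by (simp add: Doms_def)
  let ?N = "L2_norm D \<Omega>'" and ?ip = "L2_inner D \<Omega>'"
  have tv: "tensor v \<in> L2 D \<Omega>'" using apply_on_L2[OF v, of "{}"] by (simp add: apply_on_def)
  \<comment> \<open>A function orthogonal to this range is orthogonal to all tensors of elements
    from the dense ranges of the \<open>1 + A j\<close>, hence zero.\<close>
  have dense: "\<exists>m c U. (\<forall>i<m::nat. U i \<in> Doms) \<and> ?N (h - (\<Sum>i<m. csmult (c i) (all_subsets_sum (U i)))) < e"
    if e: "e > 0" for e
  proof -
    obtain m :: nat and c g where g: "\<And>i. i < m \<Longrightarrow> g i \<in> all_subsets_sum ` Doms"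
      "?N (h - (\<Sum>i<m. csmult (c i) (g i))) < e"
    proof (rule L2_approx_if_orthogonal_trivial[of "all_subsets_sum ` Doms" D \<Omega>' h e])
      show "all_subsets_sum ` Doms \<subseteq> L2 D \<Omega>'" using all_subsets_sum_L2 by blast
      fix k assume k: "k \<in> L2 D \<Omega>'" "\<And>v. v \<in> all_subsets_sum ` Doms \<Longrightarrow> ?ip k v = 0"
      show "?N k = 0"
      proof (rule L2_zero_if_orthogonal_to_tensors[OF k(1)])
        show "L2_dense (d j) (\<Omega> j) {u + A j u | u. u \<in> Dom j}" if "j < n" for j
          by (rule dense_range_self_adjoint_nonnegative[OF sa[OF that] form_operatorD(2)[OF form_A[OF that]]])
        fix w assume "\<And>j. j < n \<Longrightarrow> w j \<in> {u + A j u | u. u \<in> Dom j}"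
        then have "\<forall>j. \<exists>u. j < n \<longrightarrow> u \<in> Dom j \<and> w j = u + A j u" by blast
        then obtain u where u: "\<And>j. j < n \<Longrightarrow> u j \<in> Dom j \<and> w j = u j + A j (u j)" by metis
        then have "tensor w = all_subsets_sum u" unfolding all_subsets_sum_eq_tensor by (intro tensor_cong) auto
        moreover have "u \<in> Doms" using u by (simp add: Doms_def)
        ultimately show "?ip k (tensor w) = 0" using k(2) by auto
      qed
    qed (use h e in auto)
    then have "\<forall>i. \<exists>u. i < m \<longrightarrow> u \<in> Doms \<and> g i = all_subsets_sum u" by blast
    then obtain U where U: "\<And>i. i < m \<Longrightarrow> U i \<in> Doms \<and> g i = all_subsets_sum (U i)" by metis
    then have "(\<Sum>i<m. csmult (c i) (g i)) = (\<Sum>i<m. csmult (c i) (all_subsets_sum (U i)))"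
      by (intro sum.cong) auto
    with g(2) U show ?thesis by (intro exI[of _ m] exI[of _ c] exI[of _ U]) auto
  qed
  define B where "B = ?N (tensor v) + ?N (all_subsets_sum v)"
  have small: "cmod (?ip h (tensor v)) \<le> e * ?N (tensor v) + sqrt ((?N h + e) * e) * ?N (all_subsets_sum v)"
    if e: "e > 0" for e
  proof -
    obtain m c U where U: "\<And>i. i < (m::nat) \<Longrightarrow> U i \<in> Doms"
      and "?N (h - (\<Sum>i<m. csmult (c i) (all_subsets_sum (U i)))) < e"
      using dense[OF e] by blast
    define u where "u = (\<Sum>i<m. csmult (c i) (tensor (U i)))"
    define b where "b = (\<Sum>i<m. csmult (c i) (small_subsets_sum (U i)))"
    define w where "w = (\<Sum>i<m. csmult (c i) (all_subsets_sum (U i)))"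
    have hw: "?N (h - w) < e" unfolding w_def by fact
    have tU: "tensor (U i) \<in> L2 D \<Omega>'" if "i < m" for i
      using apply_on_L2[OF U[OF that], of "{}"] by (simp add: apply_on_def)
    have L: "u \<in> L2 D \<Omega>'" "b \<in> L2 D \<Omega>'" "w \<in> L2 D \<Omega>'"
      unfolding u_def b_def w_def using U tU
      by (auto intro!: L2_sum L2_csmult all_subsets_sum_L2 small_subsets_sum_L2)
    have hwL: "h - w \<in> L2 D \<Omega>'" using h L by (intro L2_diff)
    have bounds: "(?N u)\<^sup>2 \<le> Re (?ip b w)" "?N b \<le> ?N w"
      unfolding u_def b_def w_def by (rule lincomb_bounds[OF U]; assumption)+
    have "?ip h b = (\<Sum>i<m. cnj (c i) * ?ip h (small_subsets_sum (U i)))"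
      unfolding b_def using U
      by (subst L2_inner_sum_right) (auto intro!: L2_csmult small_subsets_sum_L2 h simp: L2_inner_csmult_right)
    also have "\<dots> = 0" using orth U by simp
    finally have "?ip b h = 0" using L2_inner_commute[of D \<Omega>' b h] by simp
    \<comment> \<open>This exchanges \<open>w\<close> for the small vector \<open>h - w\<close>;
      positivity of the left-hand side now makes \<open>u\<close> small.\<close>
    then have "?ip b w = - ?ip b (h - w)" using L h by (simp add: L2_inner_diff_right)
    then have "(?N u)\<^sup>2 \<le> cmod (?ip b (h - w))"
      using bounds(1) complex_Re_le_cmod[of "- ?ip b (h - w)"] by simp
    also have "\<dots> \<le> ?N b * ?N (h - w)" by (rule L2_Cauchy_Schwarz[OF L(2) hwL])
    also have "\<dots> \<le> (?N h + e) * e"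
    proof (rule mult_mono)
      have "?N w \<le> ?N h + ?N (h - w)" using L2_norm_diff_bound[OF h L(3)] by simp
      then show "?N b \<le> ?N h + e" using bounds(2) hw by simp
    qed (use hw e in \<open>auto intro: add_nonneg_nonneg\<close>)
    finally have Nu: "?N u \<le> sqrt ((?N h + e) * e)" by (rule real_le_rsqrt)
    \<comment> \<open>The operator is moved over to \<open>v\<close> term by term. What remains
      pairs the fixed vector \<open>all_subsets_sum v\<close> with \<open>u\<close>, whose norm is
      already controlled.\<close>
    have "?ip w (tensor v) = (\<Sum>i<m. c i * ?ip (all_subsets_sum (U i)) (tensor v))"
      unfolding w_def using U tv
      by (subst L2_inner_sum_left) (auto intro!: L2_csmult all_subsets_sum_L2 simp: L2_inner_csmult_left)
    also have "\<dots> = (\<Sum>i<m. c i * ?ip (tensor (U i)) (all_subsets_sum v))"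
      using U v by (intro sum.cong refl) (simp add: all_subsets_sum_sym)
    also have "\<dots> = ?ip u (all_subsets_sum v)"
      unfolding u_def using tU v
      by (subst L2_inner_sum_left) (auto intro!: L2_csmult all_subsets_sum_L2 simp: L2_inner_csmult_left)
    finally have "?ip w (tensor v) = ?ip u (all_subsets_sum v)" .
    moreover have "?ip h (tensor v) = ?ip (h - w) (tensor v) + ?ip w (tensor v)"
      using h L tv by (simp add: L2_inner_diff_left)
    ultimately have "cmod (?ip h (tensor v)) \<le> cmod (?ip (h - w) (tensor v)) + cmod (?ip u (all_subsets_sum v))"
      by (simp add: norm_triangle_ineq)
    also have "\<dots> \<le> ?N (h - w) * ?N (tensor v) + ?N u * ?N (all_subsets_sum v)"
      by (intro add_mono L2_Cauchy_Schwarz hwL tv L(1) all_subsets_sum_L2 v)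
    also have "\<dots> \<le> e * ?N (tensor v) + sqrt ((?N h + e) * e) * ?N (all_subsets_sum v)"
      using hw Nu by (intro add_mono mult_right_mono) auto
    finally show ?thesis .
  qed
  have "((\<lambda>e. e * ?N (tensor v) + sqrt ((?N h + e) * e) * ?N (all_subsets_sum v)) \<longlongrightarrow>
      0 * ?N (tensor v) + sqrt ((?N h + 0) * 0) * ?N (all_subsets_sum v)) (at_right 0)"
    by (intro tendsto_intros)
  moreover have "\<forall>\<^sub>F e in at_right 0. cmod (?ip h (tensor v)) \<le> e * ?N (tensor v) + sqrt ((?N h + e) * e) * ?N (all_subsets_sum v)"
    using small by (auto simp: eventually_at_filter)
  ultimately have "cmod (?ip h (tensor v)) \<le> 0"
    by (intro tendsto_lowerbound[of _ _ "at_right (0::real)"]) auto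
  then show "?ip h (tensor v) = 0" by simp
qed

end

section \<open>The Hessian form\<close>

abbreviation second_order :: "nat \<Rightarrow> (nat \<Rightarrow> nat) set" where
  "second_order d \<equiv> {\<alpha>. \<alpha> \<in> multiindices d \<and> mi_order d \<alpha> = 2}"

text \<open>Spelled exactly as in hypothesis and conclusion of the theorem, so that unfolding it is
  all that links them.\<close>

definition hessian_form :: "nat \<Rightarrow> point set \<Rightarrow> cfun \<Rightarrow> cfun \<Rightarrow> complex" where
  "hessian_form d \<Omega> f g = (\<Sum>\<alpha> | \<alpha> \<in> multiindices d \<and> mi_order d \<alpha> = 2.
     1 / of_nat (mi_fact d \<alpha>) * L2_inner d \<Omega> (weak_deriv d \<Omega> \<alpha> f) (weak_deriv d \<Omega> \<alpha> g))"

lemma mi_unit_multiindex: "k < d \<Longrightarrow> mi_unit k \<in> multiindices d"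
  by (auto simp: multiindices_def mi_unit_def)

lemma two_units_second_order: "k < d \<Longrightarrow> l < d \<Longrightarrow> mi_unit k + mi_unit l \<in> second_order d"
  using mi_unit_multiindex[of k d] mi_unit_multiindex[of l d]
  by (simp add: mi_order_add mi_order_unit) (simp add: multiindices_def)

lemma second_orderE:
  assumes "\<alpha> \<in> second_order d"
  obtains k l where "k < d" "l < d" "\<alpha> = mi_unit k + mi_unit l"
proof -
  from assms have \<alpha>: "\<alpha> \<in> multiindices d" "(\<Sum>i<d. \<alpha> i) = 2" by (auto simp: mi_order_def)
  then obtain k where k: "k < d" "\<alpha> k > 0" by (metis gr0I lessThan_iff sum.neutral zero_neq_numeral)
  define \<beta> where "\<beta> i = \<alpha> i - mi_unit k i" for i
  have eq: "\<alpha> = mi_unit k + \<beta>" using k by (auto simp: fun_eq_iff \<beta>_def mi_unit_def)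
  have "mi_order d (mi_unit k + \<beta>) = 2" using assms eq by simp
  then have "mi_order d \<beta> = 1" using k by (simp add: mi_order_add mi_order_unit)
  moreover have "\<beta> \<in> multiindices d" using \<alpha>(1) by (simp add: \<beta>_def multiindices_def)
  ultimately obtain l where "l < d" "\<beta> = mi_unit l" using mi_order_1 by metis
  with k eq that show ?thesis by blast
qed

lemma second_order_eq: "second_order d = (\<lambda>(k, l). mi_unit k + mi_unit l) ` ({..<d} \<times> {..<d})"
proof (intro equalityI subsetI)
  fix \<alpha> assume "\<alpha> \<in> second_order d"
  then obtain k l where "k < d" "l < d" "\<alpha> = mi_unit k + mi_unit l" by (rule second_orderE)
  then show "\<alpha> \<in> (\<lambda>(k, l). mi_unit k + mi_unit l) ` ({..<d} \<times> {..<d})"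
    by (intro image_eqI[of _ _ "(k, l)"]) auto
next
  fix \<alpha> assume "\<alpha> \<in> (\<lambda>(k, l). mi_unit k + mi_unit l) ` ({..<d} \<times> {..<d})"
  then obtain k l where "k < d" "l < d" "\<alpha> = mi_unit k + mi_unit l" by auto
  then show "\<alpha> \<in> second_order d" using two_units_second_order by blast
qed

lemma finite_second_order: "finite (second_order d)"
  unfolding second_order_eq by simp

lemma mi_fact_pos: "mi_fact d \<alpha> > 0"
  unfolding mi_fact_def by (intro prod_pos) simp

lemma two_units_eq_iff:
  "mi_unit a + mi_unit b = mi_unit k + mi_unit l \<longleftrightarrow> a = k \<and> b = l \<or> a = l \<and> b = k"
proof
  assume eq: "mi_unit a + mi_unit b = mi_unit k + mi_unit l"
  have "mi_unit a i + mi_unit b i = mi_unit k i + mi_unit l i" for i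
    using fun_cong[OF eq, of i] unfolding plus_fun_apply .
  from this[of a] this[of b] show "a = k \<and> b = l \<or> a = l \<and> b = k"
    unfolding mi_unit_def by (cases "a = b"; cases "a = k"; cases "a = l"; cases "b = k"; cases "b = l") simp_all
next
  assume "a = k \<and> b = l \<or> a = l \<and> b = k"
  then show "mi_unit a + mi_unit b = mi_unit k + mi_unit l"
    using add.commute[of "mi_unit k" "mi_unit l"] by (elim disjE conjE) (simp_all only:)
qed

lemma mi_fact_two_units:
  assumes "k < d" "l < d"
  shows "mi_fact d (mi_unit k + mi_unit l) = (if k = l then 2 else 1)"
proof -
  have "mi_fact d (mi_unit k + mi_unit l) = (\<Prod>i<d. if i = k then (if k = l then 2 else 1) else 1)"
    unfolding mi_fact_def by (intro prod.cong refl) (auto simp: mi_unit_def)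
  then show ?thesis using assms by simp
qed

text \<open>Off the diagonal two ordered pairs give the same multiindex, of factorial 1; on the
  diagonal a single pair does, with factorial 2. Either way the number of pairs is 2 divided by the
  factorial, which explains the weights and the factor 1/2.\<close>

lemma sum_second_order:
  fixes F :: "(nat \<Rightarrow> nat) \<Rightarrow> complex"
  shows "(\<Sum>\<alpha> | \<alpha> \<in> multiindices d \<and> mi_order d \<alpha> = 2. 1 / of_nat (mi_fact d \<alpha>) * F \<alpha>)
    = 1 / 2 * (\<Sum>k<d. \<Sum>l<d. F (mi_unit k + mi_unit l))"
proof -
  let ?g = "\<lambda>(k, l). mi_unit k + mi_unit l :: nat \<Rightarrow> nat"
  let ?S = "{..<d} \<times> {..<d}"
  have "(\<Sum>k<d. \<Sum>l<d. F (mi_unit k + mi_unit l)) = (\<Sum>p\<in>?S. F (?g p))"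
    by (simp add: sum.cartesian_product case_prod_unfold)
  also have "\<dots> = (\<Sum>\<alpha>\<in>?g ` ?S. \<Sum>p | p \<in> ?S \<and> ?g p = \<alpha>. F (?g p))"
    by (rule sum.image_gen) simp
  also have "\<dots> = (\<Sum>\<alpha>\<in>second_order d. 2 * (1 / of_nat (mi_fact d \<alpha>) * F \<alpha>))"
  proof (rule sum.cong[OF second_order_eq[symmetric]])
    fix \<alpha> assume "\<alpha> \<in> second_order d"
    then obtain k l where kl: "k < d" "l < d" and \<alpha>: "\<alpha> = mi_unit k + mi_unit l" by (rule second_orderE)
    have "{p. p \<in> ?S \<and> ?g p = \<alpha>} = {(k, l), (l, k)}"
      using kl by (auto simp: \<alpha> two_units_eq_iff)
    then have "(\<Sum>p | p \<in> ?S \<and> ?g p = \<alpha>. F (?g p)) = (\<Sum>p\<in>{(k, l), (l, k)}. F (?g p))" by simp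
    also have "\<dots> = 2 * (1 / of_nat (mi_fact d \<alpha>) * F \<alpha>)"
      unfolding \<alpha> mi_fact_two_units[OF kl] by (simp add: add.commute)
    finally show "(\<Sum>p | p \<in> ?S \<and> ?g p = \<alpha>. F (?g p)) = 2 * (1 / of_nat (mi_fact d \<alpha>) * F \<alpha>)" .
  qed
  finally show ?thesis by (simp add: sum_distrib_left)
qed

lemma hessian_form_commute: "hessian_form d \<Omega> g f = cnj (hessian_form d \<Omega> f g)"
  unfolding hessian_form_def cnj_sum
  by (intro sum.cong refl) (simp add: L2_inner_commute[of d \<Omega> "weak_deriv d \<Omega> _ g"])

lemma hessian_form_pairs:
  assumes \<Omega>: "openin (eucl d) \<Omega>"
    and "\<And>k l. k < d \<Longrightarrow> l < d \<Longrightarrow> has_weak_deriv d \<Omega> (mi_unit k + mi_unit l) f (F k l)"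
    and "\<And>k l. k < d \<Longrightarrow> l < d \<Longrightarrow> has_weak_deriv d \<Omega> (mi_unit k + mi_unit l) g (G k l)"
  shows "hessian_form d \<Omega> f g = 1 / 2 * (\<Sum>k<d. \<Sum>l<d. L2_inner d \<Omega> (F k l) (G k l))"
  unfolding hessian_form_def sum_second_order
  using assms by (intro arg_cong2[where f = "(*)"] sum.cong refl inner_weak_deriv) auto

text \<open>\<open>hessian_form\<close> is defined for all functions but is linear only where the
  chosen representatives are genuine second derivatives. This is the subspace on which that holds,
  and it must contain the generators before identities extend to a span.\<close>

definition twice_weakly_differentiable :: "nat \<Rightarrow> point set \<Rightarrow> cfun set" where
  "twice_weakly_differentiable d \<Omega> = {f. \<forall>\<alpha>\<in>second_order d. \<exists>g. has_weak_deriv d \<Omega> \<alpha> f g}"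

lemma twice_weak_deriv:
  assumes "f \<in> twice_weakly_differentiable d \<Omega>" "\<alpha> \<in> second_order d"
  shows "has_weak_deriv d \<Omega> \<alpha> f (weak_deriv d \<Omega> \<alpha> f)"
  using assms has_weak_deriv_weak_deriv unfolding twice_weakly_differentiable_def by blast

lemma csubspace_twice_weakly_differentiable:
  assumes \<Omega>: "openin (eucl d) \<Omega>"
  shows "csubspace (twice_weakly_differentiable d \<Omega>)"
proof (rule cfun.subspaceI)
  have I: "f \<in> twice_weakly_differentiable d \<Omega>"
    if "\<And>\<alpha>. \<alpha> \<in> second_order d \<Longrightarrow> has_weak_deriv d \<Omega> \<alpha> f (g \<alpha>)" for f g
    unfolding twice_weakly_differentiable_def using that by (intro CollectI ballI exI)
  show "0 \<in> twice_weakly_differentiable d \<Omega>"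
    by (rule I[where g = "\<lambda>_. 0"]) (rule has_weak_deriv_zero)
  show "f + g \<in> twice_weakly_differentiable d \<Omega>"
    if "f \<in> twice_weakly_differentiable d \<Omega>" "g \<in> twice_weakly_differentiable d \<Omega>" for f g
    by (rule I) (rule has_weak_deriv_add[OF \<Omega> twice_weak_deriv[OF that(1)] twice_weak_deriv[OF that(2)]])
  show "csmult c f \<in> twice_weakly_differentiable d \<Omega>"
    if "f \<in> twice_weakly_differentiable d \<Omega>" for c f
    by (rule I) (rule has_weak_deriv_csmult[OF twice_weak_deriv[OF that]])
qed

lemma hessian_form_add_left:
  assumes \<Omega>: "openin (eucl d) \<Omega>"
    and f: "f \<in> twice_weakly_differentiable d \<Omega>" "f' \<in> twice_weakly_differentiable d \<Omega>"
    and g: "g \<in> twice_weakly_differentiable d \<Omega>"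
  shows "hessian_form d \<Omega> (f + f') g = hessian_form d \<Omega> f g + hessian_form d \<Omega> f' g"
  unfolding hessian_form_def sum.distrib[symmetric]
proof (intro sum.cong refl)
  fix \<alpha> assume \<alpha>: "\<alpha> \<in> second_order d"
  note w = twice_weak_deriv[OF f(1) \<alpha>] twice_weak_deriv[OF f(2) \<alpha>] twice_weak_deriv[OF g \<alpha>]
  have "L2_inner d \<Omega> (weak_deriv d \<Omega> \<alpha> (f + f')) (weak_deriv d \<Omega> \<alpha> g)
      = L2_inner d \<Omega> (weak_deriv d \<Omega> \<alpha> f + weak_deriv d \<Omega> \<alpha> f') (weak_deriv d \<Omega> \<alpha> g)"
    by (intro inner_weak_deriv[OF \<Omega>] has_weak_deriv_add[OF \<Omega>] w)
  also have "\<dots> = L2_inner d \<Omega> (weak_deriv d \<Omega> \<alpha> f) (weak_deriv d \<Omega> \<alpha> g)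
      + L2_inner d \<Omega> (weak_deriv d \<Omega> \<alpha> f') (weak_deriv d \<Omega> \<alpha> g)"
    by (intro L2_inner_add_left has_weak_derivD(2)[OF w(1)] has_weak_derivD(2)[OF w(2)] has_weak_derivD(2)[OF w(3)])
  finally show "1 / of_nat (mi_fact d \<alpha>) * L2_inner d \<Omega> (weak_deriv d \<Omega> \<alpha> (f + f')) (weak_deriv d \<Omega> \<alpha> g)
    = 1 / of_nat (mi_fact d \<alpha>) * L2_inner d \<Omega> (weak_deriv d \<Omega> \<alpha> f) (weak_deriv d \<Omega> \<alpha> g)
      + 1 / of_nat (mi_fact d \<alpha>) * L2_inner d \<Omega> (weak_deriv d \<Omega> \<alpha> f') (weak_deriv d \<Omega> \<alpha> g)"
    by (simp only: distrib_left)
qed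

lemma hessian_form_csmult_left:
  assumes \<Omega>: "openin (eucl d) \<Omega>"
    and f: "f \<in> twice_weakly_differentiable d \<Omega>" and g: "g \<in> twice_weakly_differentiable d \<Omega>"
  shows "hessian_form d \<Omega> (csmult c f) g = c * hessian_form d \<Omega> f g"
  unfolding hessian_form_def sum_distrib_left
proof (intro sum.cong refl)
  fix \<alpha> assume \<alpha>: "\<alpha> \<in> second_order d"
  note w = twice_weak_deriv[OF f \<alpha>] twice_weak_deriv[OF g \<alpha>]
  have "L2_inner d \<Omega> (weak_deriv d \<Omega> \<alpha> (csmult c f)) (weak_deriv d \<Omega> \<alpha> g)
      = L2_inner d \<Omega> (csmult c (weak_deriv d \<Omega> \<alpha> f)) (weak_deriv d \<Omega> \<alpha> g)"
    by (intro inner_weak_deriv[OF \<Omega>] has_weak_deriv_csmult w)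
  then show "1 / of_nat (mi_fact d \<alpha>) * L2_inner d \<Omega> (weak_deriv d \<Omega> \<alpha> (csmult c f)) (weak_deriv d \<Omega> \<alpha> g)
    = c * (1 / of_nat (mi_fact d \<alpha>) * L2_inner d \<Omega> (weak_deriv d \<Omega> \<alpha> f) (weak_deriv d \<Omega> \<alpha> g))"
    by (simp only: L2_inner_csmult_left mult.left_commute)
qed

locale hessian_setting = factor_operators +
  fixes DomT :: "cfun set" and T :: "cfun \<Rightarrow> cfun"
  assumes form_T: "form_operator D \<Omega>' (tensor_space n d \<Omega> H) DomT T"
    and Dom_sobolev: "\<And>j. j < n \<Longrightarrow> Dom j \<subseteq> sobolev 2 (d j) (\<Omega> j)"
    and hessian_A: "\<And>j u v. j < n \<Longrightarrow> u \<in> Dom j \<Longrightarrow> v \<in> Dom j \<Longrightarrow>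
      hessian_form (d j) (\<Omega> j) u v = 1 / 2 * ip j (A j u) (A j v)"
begin

abbreviation "IP \<equiv> L2_inner D \<Omega>'"
abbreviation "NN \<equiv> L2_norm D \<Omega>'"

lemmas saT = form_operatorD(1)[OF form_T]

lemma DomT_tensor_space: "u \<in> DomT \<Longrightarrow> u \<in> tensor_space n d \<Omega> H"
  using form_operatorD(3)[OF form_T] by blast

lemma DomT_L2: "u \<in> DomT \<Longrightarrow> u \<in> L2 D \<Omega>'"
  using self_adjoint_D(3)[OF saT] by blast

lemma T_L2: "u \<in> DomT \<Longrightarrow> T u \<in> L2 D \<Omega>'"
  using self_adjoint_D(4)[OF saT] by blast

lemma tensor_weak_deriv_H:
  assumes v: "\<And>j. j < n \<Longrightarrow> v j \<in> H j" and "j < n" "k < d j"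
  shows "has_weak_deriv D \<Omega>' (mi_unit (offset d j + k)) (tensor v) (tensor (v(j := Der j k (v j))))"
  using assms by (intro tensor_has_weak_deriv_unit H_weak_deriv H_L2) auto

lemma tensors_sobolev: "{tensor v | v. \<forall>j<n. v j \<in> H j} \<subseteq> sobolev 1 D \<Omega>'"
proof
  fix f assume "f \<in> {tensor v | v. \<forall>j<n. v j \<in> H j}"
  then obtain v where v: "\<And>j. j < n \<Longrightarrow> v j \<in> H j" and f: "f = tensor v" by auto
  have "\<exists>g. has_weak_deriv D \<Omega>' (mi_unit k) (tensor v) g" if "k < D" for k
    using tensor_weak_deriv_H[OF v] offset_decomp[OF that] by metis
  then show "f \<in> sobolev 1 D \<Omega>'"
    unfolding f sobolev_1_iff[OF open_product] using tensor_L2 v H_L2 by blast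
qed

lemma tensor_space_eq: "tensor_space n d \<Omega> H = H1_closure D \<Omega>' (cspan {tensor v | v. \<forall>j<n. v j \<in> H j})"
  unfolding tensor_space_def total_dim_eq_offset ..

lemma span_tensors_sobolev: "cspan {tensor v | v. \<forall>j<n. v j \<in> H j} \<subseteq> sobolev 1 D \<Omega>'"
  by (rule cfun.span_minimal[OF tensors_sobolev csubspace_sobolev_1[OF open_product]])

lemma tensor_in_tensor_space: "(\<And>j. j < n \<Longrightarrow> v j \<in> H j) \<Longrightarrow> tensor v \<in> tensor_space n d \<Omega> H"
  unfolding tensor_space_eq
  using H1_closure_superset[OF open_product span_tensors_sobolev] by (blast intro: cfun.span_base)

lemma tensor_space_sobolev: "tensor_space n d \<Omega> H \<subseteq> sobolev 1 D \<Omega>'"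
  unfolding tensor_space_eq H1_closure_def by blast

section \<open>The operator \<open>T\<close> on tensors\<close>

definition sum_A :: "(nat \<Rightarrow> cfun) \<Rightarrow> cfun" where
  "sum_A u = (\<Sum>j<n. apply_on {j} u)"

lemma sum_A_L2: "u \<in> Doms \<Longrightarrow> sum_A u \<in> L2 D \<Omega>'"
  unfolding sum_A_def by (intro L2_sum apply_on_L2)

lemma small_subsets_sum_eq: "small_subsets_sum u = tensor u + sum_A u"
proof -
  have "small_subsets_sum u = apply_on {} u + (\<Sum>S\<in>(\<lambda>j. {j}) ` {..<n}. apply_on S u)"
    unfolding small_subsets_sum_def small_subsets_def by (subst sum.insert) auto
  also have "(\<Sum>S\<in>(\<lambda>j. {j}) ` {..<n}. apply_on S u) = sum_A u"
    unfolding sum_A_def by (subst sum.reindex) (auto simp: inj_on_def)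
  moreover have "apply_on {} u = tensor u" by (simp add: apply_on_def)
  ultimately show ?thesis by (simp only:)
qed

lemma apply_on_singleton: "apply_on {j} u = tensor (u(j := A j (u j)))"
  unfolding apply_on_def by (intro tensor_cong) auto

lemma tensor_inner_update:
  assumes u: "\<And>j. j < n \<Longrightarrow> u j \<in> L2 (d j) (\<Omega> j)" "\<And>j. j < n \<Longrightarrow> v j \<in> L2 (d j) (\<Omega> j)"
    and i: "i < n" "a \<in> L2 (d i) (\<Omega> i)" "b \<in> L2 (d i) (\<Omega> i)"
  shows "IP (tensor (u(i := a))) (tensor (v(i := b))) = ip i a b * (\<Prod>j\<in>{..<n} - {i}. ip j (u j) (v j))"
proof -
  have "IP (tensor (u(i := a))) (tensor (v(i := b))) = (\<Prod>j<n. ip j ((u(i := a)) j) ((v(i := b)) j))"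
    by (rule tensor_inner) (use u i in auto)
  also have "\<dots> = ip i a b * (\<Prod>j\<in>{..<n} - {i}. ip j ((u(i := a)) j) ((v(i := b)) j))"
    using i by (subst prod.remove[of _ i]) auto
  also have "(\<Prod>j\<in>{..<n} - {i}. ip j ((u(i := a)) j) ((v(i := b)) j)) = (\<Prod>j\<in>{..<n} - {i}. ip j (u j) (v j))"
    by (rule prod.cong) auto
  finally show ?thesis .
qed

lemma tensor_inner_update2:
  assumes u: "\<And>j. j < n \<Longrightarrow> u j \<in> L2 (d j) (\<Omega> j)" "\<And>j. j < n \<Longrightarrow> v j \<in> L2 (d j) (\<Omega> j)"
    and i: "i < n" "a \<in> L2 (d i) (\<Omega> i)" "b \<in> L2 (d i) (\<Omega> i)"
    and j: "j < n" "a' \<in> L2 (d j) (\<Omega> j)" "b' \<in> L2 (d j) (\<Omega> j)" and ij: "i \<noteq> j"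
  shows "IP (tensor (u(i := a, j := a'))) (tensor (v(i := b, j := b')))
    = ip i a b * ip j a' b' * (\<Prod>l\<in>{..<n} - {j} - {i}. ip l (u l) (v l))"
proof -
  have "IP (tensor (u(i := a, j := a'))) (tensor (v(i := b, j := b')))
      = ip j a' b' * (\<Prod>l\<in>{..<n} - {j}. ip l ((u(i := a)) l) ((v(i := b)) l))"
    using u i j by (intro tensor_inner_update) auto
  also have "(\<Prod>l\<in>{..<n} - {j}. ip l ((u(i := a)) l) ((v(i := b)) l))
      = ip i a b * (\<Prod>l\<in>{..<n} - {j} - {i}. ip l ((u(i := a)) l) ((v(i := b)) l))"
    using i ij by (subst prod.remove[of _ i]) auto
  also have "(\<Prod>l\<in>{..<n} - {j} - {i}. ip l ((u(i := a)) l) ((v(i := b)) l)) = (\<Prod>l\<in>{..<n} - {j} - {i}. ip l (u l) (v l))"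
    by (rule prod.cong) auto
  finally show ?thesis by (simp only: mult_ac)
qed

text \<open>A derivative in block \<open>j\<close> touches only factor \<open>j\<close>. Summing
  over the coordinates of that block gives the Dirichlet form of factor \<open>j\<close> times the
  inner products of the others, and the form identity turns it into \<open>A j\<close> acting on
  that factor of \<open>u\<close>.\<close>

lemma dirichlet_form_tensors:
  assumes v: "\<And>j. j < n \<Longrightarrow> v j \<in> H j" and u: "u \<in> Doms"
  shows "dirichlet_form D \<Omega>' (tensor v) (tensor u) = IP (tensor v) (sum_A u)"
proof -
  have uD: "u j \<in> Dom j" if "j < n" for j using u that by (simp add: Doms_def)
  have uH: "u j \<in> H j" if "j < n" for j using Dom_H[OF that uD[OF that]] .
  \<comment> \<open>The gradient of a tensor, listed by coordinate number as
    \<open>dirichlet_form_eq\<close> expects.\<close>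
  define DT where "DT w i = (let j = block_index d i in tensor (w(j := Der j (i - offset d j) (w j))))" for w i
  have DT: "DT w (offset d j + k) = tensor (w(j := Der j k (w j)))" if "k < d j" for w j k
    using that by (simp add: DT_def block_index_eq)
  have hw: "has_weak_deriv D \<Omega>' (mi_unit i) (tensor w) (DT w i)" if i: "i < D" and wH: "\<And>j. j < n \<Longrightarrow> w j \<in> H j" for i w
  proof -
    obtain j k where "j < n" "k < d j" "i = offset d j + k" using offset_decomp[OF i] .
    then show ?thesis using tensor_weak_deriv_H[OF wH] by (simp add: DT)
  qed
  have "dirichlet_form D \<Omega>' (tensor v) (tensor u) = (\<Sum>i<D. IP (DT v i) (DT u i))"
    by (rule dirichlet_form_eq[OF open_product]) (use hw v uH in blast)+
  also have "\<dots> = (\<Sum>j<n. \<Sum>k<d j. IP (DT v (offset d j + k)) (DT u (offset d j + k)))"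
    by (rule sum_offset)
  also have "\<dots> = (\<Sum>j<n. IP (tensor v) (apply_on {j} u))"
  proof (rule sum.cong[OF refl])
    fix j assume "j \<in> {..<n}"
    then have j: "j < n" by simp
    let ?R = "\<Prod>l\<in>{..<n} - {j}. ip l (v l) (u l)"
    have "(\<Sum>k<d j. IP (DT v (offset d j + k)) (DT u (offset d j + k)))
        = (\<Sum>k<d j. ip j (Der j k (v j)) (Der j k (u j)) * ?R)"
    proof (rule sum.cong[OF refl])
      fix k assume "k \<in> {..<d j}"
      then have k: "k < d j" by simp
      show "IP (DT v (offset d j + k)) (DT u (offset d j + k)) = ip j (Der j k (v j)) (Der j k (u j)) * ?R"
        unfolding DT[OF k] using v uH j k by (intro tensor_inner_update H_L2 H_deriv_L2) auto
    qed
    \<comment> \<open>\<open>A_form\<close> has the element of the operator domain on the left,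
      whereas here it stands on the right.\<close>
    also have "\<dots> = cnj (\<Sum>k<d j. ip j (Der j k (u j)) (Der j k (v j))) * ?R"
      by (simp add: sum_distrib_right L2_inner_commute[of _ _ "Der j _ (v j)"])
    also have "\<dots> = ip j (v j) (A j (u j)) * ?R"
      unfolding A_form[OF j uD[OF j] v[OF j]] by (simp add: L2_inner_commute[of _ _ "v j"])
    also have "\<dots> = IP (tensor (v(j := v j))) (tensor (u(j := A j (u j))))"
      using v uH uD j by (intro tensor_inner_update[symmetric] H_L2 A_L2) auto
    finally show "(\<Sum>k<d j. IP (DT v (offset d j + k)) (DT u (offset d j + k))) = IP (tensor v) (apply_on {j} u)"
      by (simp only: fun_upd_triv apply_on_singleton)
  qed
  also have "\<dots> = IP (tensor v) (sum_A u)"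
    unfolding sum_A_def by (rule L2_inner_sum_right[symmetric]) (use v H_L2 u in \<open>auto intro: apply_on_L2 tensor_L2\<close>)
  finally show ?thesis .
qed

lemma dirichlet_form_add_left:
  assumes "f \<in> sobolev 1 D \<Omega>'" "f' \<in> sobolev 1 D \<Omega>'" "g \<in> sobolev 1 D \<Omega>'"
  shows "dirichlet_form D \<Omega>' (f + f') g = dirichlet_form D \<Omega>' f g + dirichlet_form D \<Omega>' f' g"
proof -
  let ?w = "\<lambda>f k. weak_deriv D \<Omega>' (mi_unit k) f"
  note w = sobolev_1_has_weak_deriv[OF open_product]
  have "dirichlet_form D \<Omega>' (f + f') g = (\<Sum>k<D. IP (?w f k + ?w f' k) (?w g k))"
    by (rule dirichlet_form_eq[OF open_product]) (intro has_weak_deriv_add[OF open_product] w assms; assumption)+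
  also have "\<dots> = (\<Sum>k<D. IP (?w f k) (?w g k) + IP (?w f' k) (?w g k))"
    by (intro sum.cong refl L2_inner_add_left) (use assms w has_weak_derivD(2) in blast)+
  finally show ?thesis by (simp add: dirichlet_form_def sum.distrib)
qed

lemma dirichlet_form_csmult_left:
  assumes "f \<in> sobolev 1 D \<Omega>'" "g \<in> sobolev 1 D \<Omega>'"
  shows "dirichlet_form D \<Omega>' (csmult c f) g = c * dirichlet_form D \<Omega>' f g"
proof -
  let ?w = "\<lambda>f k. weak_deriv D \<Omega>' (mi_unit k) f"
  note w = sobolev_1_has_weak_deriv[OF open_product]
  have "dirichlet_form D \<Omega>' (csmult c f) g = (\<Sum>k<D. IP (csmult c (?w f k)) (?w g k))"
    by (rule dirichlet_form_eq[OF open_product]) (intro has_weak_deriv_csmult w assms; assumption)+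
  then show ?thesis by (simp only: dirichlet_form_def sum_distrib_left L2_inner_csmult_left)
qed

text \<open>Linearity extends the identity from tensors to their span. Both sides are continuous in
  \<open>v\<close> for the H1 norm, with the constant \<open>C\<close> below, so it passes to the
  closure, which is the form domain of \<open>T\<close>.\<close>

lemma dirichlet_form_tensor_space:
  assumes v: "v \<in> tensor_space n d \<Omega> H" and u: "u \<in> Doms"
  shows "dirichlet_form D \<Omega>' v (tensor u) = IP v (sum_A u)"
proof -
  have tu: "tensor u \<in> sobolev 1 D \<Omega>'"
    using tensor_in_tensor_space tensor_space_sobolev Dom_H u by (force simp: Doms_def)
  note Au = sum_A_L2[OF u]
  have sub: "sobolev 1 D \<Omega>' \<subseteq> L2 D \<Omega>'" unfolding sobolev_def by blast
  let ?V = "{f \<in> sobolev 1 D \<Omega>'. dirichlet_form D \<Omega>' f (tensor u) = IP f (sum_A u)}"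
  have span: "cspan {tensor v | v. \<forall>j<n. v j \<in> H j} \<subseteq> ?V"
  proof (rule cfun.span_minimal)
    show "{tensor v | v. \<forall>j<n. v j \<in> H j} \<subseteq> ?V"
      using tensors_sobolev dirichlet_form_tensors u by blast
    note S = csubspace_sobolev_1[OF open_product]
    have "dirichlet_form D \<Omega>' (csmult 0 0) (tensor u) = 0 * dirichlet_form D \<Omega>' 0 (tensor u)"
      using cfun.subspace_0[OF S] tu by (rule dirichlet_form_csmult_left)
    moreover have "csmult 0 0 = 0" by (simp add: fun_eq_iff)
    ultimately have "dirichlet_form D \<Omega>' 0 (tensor u) = 0" by simp
    then show "csubspace ?V"
      using cfun.subspace_0[OF S] cfun.subspace_add[OF S] cfun.subspace_scale[OF S] sub Au tu
      by (intro cfun.subspaceI) (auto simp: dirichlet_form_add_left dirichlet_form_csmult_left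
          L2_inner_add_left L2_inner_csmult_left subsetD simp del: csmult_apply)
  qed
  have vS: "v \<in> sobolev 1 D \<Omega>'" using v tensor_space_sobolev by blast
  let ?w = "\<lambda>f k. weak_deriv D \<Omega>' (mi_unit k) f"
  note w = sobolev_1_has_weak_deriv[OF open_product]
  note wL = has_weak_derivD(2)[OF w]
  define C where "C = (\<Sum>k<D. NN (?w (tensor u) k)) + NN (sum_A u)"
  have "cmod (dirichlet_form D \<Omega>' v (tensor u) - IP v (sum_A u)) \<le> e * C" if e: "e > 0" for e
  proof -
    obtain g where g: "g \<in> cspan {tensor v | v. \<forall>j<n. v j \<in> H j}" "H1_norm D \<Omega>' (v - g) < e"
      using v e unfolding tensor_space_eq H1_closure_def by blast
    have gS: "g \<in> sobolev 1 D \<Omega>'" and gV: "dirichlet_form D \<Omega>' g (tensor u) = IP g (sum_A u)"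
      using g(1) span by blast+
    have eq1: "dirichlet_form D \<Omega>' v (tensor u) - dirichlet_form D \<Omega>' g (tensor u)
        = (\<Sum>k<D. IP (?w v k - ?w g k) (?w (tensor u) k))"
      unfolding dirichlet_form_def sum_subtractf[symmetric]
      by (intro sum.cong refl L2_inner_diff_left[symmetric] wL vS gS tu) auto
    have "cmod (\<Sum>k<D. IP (?w v k - ?w g k) (?w (tensor u) k)) \<le> (\<Sum>k<D. e * NN (?w (tensor u) k))"
    proof (rule sum_norm_le)
      fix k assume "k \<in> {..<D}"
      then have k: "k < D" by simp
      have "cmod (IP (?w v k - ?w g k) (?w (tensor u) k)) \<le> NN (?w v k - ?w g k) * NN (?w (tensor u) k)"
        by (intro L2_Cauchy_Schwarz L2_diff wL vS gS tu k)
      also have "\<dots> \<le> e * NN (?w (tensor u) k)"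
        using weak_deriv_diff_le_H1_norm[OF open_product vS gS k] g(2) by (intro mult_right_mono) auto
      finally show "cmod (IP (?w v k - ?w g k) (?w (tensor u) k)) \<le> e * NN (?w (tensor u) k)" .
    qed
    then have 1: "cmod (dirichlet_form D \<Omega>' v (tensor u) - dirichlet_form D \<Omega>' g (tensor u))
      \<le> e * (\<Sum>k<D. NN (?w (tensor u) k))" unfolding eq1 sum_distrib_left .
    have eq2: "IP v (sum_A u) - IP g (sum_A u) = IP (v - g) (sum_A u)"
      using vS gS sub Au by (intro L2_inner_diff_left[symmetric]) auto
    have "cmod (IP (v - g) (sum_A u)) \<le> NN (v - g) * NN (sum_A u)"
      using vS gS sub Au by (intro L2_Cauchy_Schwarz L2_diff) auto
    also have "\<dots> \<le> e * NN (sum_A u)"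
      using L2_norm_le_H1_norm[of D \<Omega>' "v - g"] g(2) by (intro mult_right_mono) auto
    finally have 2: "cmod (IP v (sum_A u) - IP g (sum_A u)) \<le> e * NN (sum_A u)" unfolding eq2 .
    have "dirichlet_form D \<Omega>' v (tensor u) - IP v (sum_A u)
        = (dirichlet_form D \<Omega>' v (tensor u) - dirichlet_form D \<Omega>' g (tensor u)) - (IP v (sum_A u) - IP g (sum_A u))"
      using gV by simp
    then have "cmod (dirichlet_form D \<Omega>' v (tensor u) - IP v (sum_A u))
        \<le> cmod (dirichlet_form D \<Omega>' v (tensor u) - dirichlet_form D \<Omega>' g (tensor u)) + cmod (IP v (sum_A u) - IP g (sum_A u))"
      by (simp only: norm_triangle_ineq4)
    then show ?thesis using 1 2 by (simp add: C_def distrib_left)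
  qed
  then have "cmod (dirichlet_form D \<Omega>' v (tensor u) - IP v (sum_A u)) \<le> 0" by (rule nonpos_if_le_all_scaled)
  then show ?thesis by simp
qed

text \<open>For every \<open>v\<close> in the domain of \<open>T\<close>,
  \<open>\<langle>T v, u\<rangle>\<close> is the form at \<open>v\<close> and \<open>u\<close>,
  hence \<open>\<langle>v, sum_A u\<rangle>\<close>. This says that the tensor lies in the domain of
  the adjoint with value \<open>sum_A u\<close>, and the adjoint is \<open>T\<close>.\<close>

lemma T_tensor:
  assumes u: "u \<in> Doms"
  shows "tensor u \<in> DomT" "AE x in leb_on D \<Omega>'. T (tensor u) x = sum_A u x"
proof -
  have uH: "tensor u \<in> tensor_space n d \<Omega> H" using u Dom_H by (intro tensor_in_tensor_space) (auto simp: Doms_def)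
  have "tensor u \<in> L2 D \<Omega>'" using uH tensor_space_sobolev unfolding sobolev_def by blast
  moreover have "IP (T v) (tensor u) = IP v (sum_A u)" if v: "v \<in> DomT" for v
    using form_operatorD(4)[OF form_T v uH] dirichlet_form_tensor_space[OF DomT_tensor_space[OF v] u] by simp
  ultimately have "tensor u \<in> DomT \<and> (AE x in leb_on D \<Omega>'. T (tensor u) x = sum_A u x)"
    by (intro self_adjoint_D(7)[OF saT] sum_A_L2 u)
  then show "tensor u \<in> DomT" "AE x in leb_on D \<Omega>'. T (tensor u) x = sum_A u x" by auto
qed


section \<open>Second derivatives of tensors\<close>

lemma Dom_second_deriv:
  assumes "j < n" "u \<in> Dom j" "k < d j" "l < d j"
  shows "has_weak_deriv (d j) (\<Omega> j) (mi_unit k + mi_unit l) u (weak_deriv (d j) (\<Omega> j) (mi_unit k + mi_unit l) u)"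
proof -
  have "u \<in> sobolev 2 (d j) (\<Omega> j)" using Dom_sobolev assms by blast
  moreover have "mi_unit k + mi_unit l \<in> second_order (d j)" by (rule two_units_second_order[OF assms(3,4)])
  ultimately have "\<exists>g. has_weak_deriv (d j) (\<Omega> j) (mi_unit k + mi_unit l) u g"
    unfolding sobolev_def by simp
  then show ?thesis using has_weak_deriv_weak_deriv by blast
qed

lemma Dom_second_deriv_L2:
  assumes "j < n" "u \<in> Dom j" "k < d j" "l < d j"
  shows "weak_deriv (d j) (\<Omega> j) (mi_unit k + mi_unit l) u \<in> L2 (d j) (\<Omega> j)"
  using has_weak_derivD(2)[OF Dom_second_deriv[OF assms]] .

text \<open>Explicit representative of the derivative in coordinate \<open>k\<close> of block
  \<open>i\<close> and coordinate \<open>l\<close> of block \<open>j\<close>. Only for equal blocks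
  does a second derivative of a factor occur.\<close>

definition D2 :: "(nat \<Rightarrow> cfun) \<Rightarrow> nat \<Rightarrow> nat \<Rightarrow> nat \<Rightarrow> nat \<Rightarrow> cfun" where
  "D2 u i k j l = (if i = j
    then tensor (u(i := weak_deriv (d i) (\<Omega> i) (mi_unit k + mi_unit l) (u i)))
    else tensor (u(i := Der i k (u i), j := Der j l (u j))))"

lemma tensor_second_deriv:
  assumes u: "u \<in> Doms" and i: "i < n" "k < d i" and j: "j < n" "l < d j"
  shows "has_weak_deriv D \<Omega>' (mi_unit (offset d i + k) + mi_unit (offset d j + l)) (tensor u) (D2 u i k j l)"
proof -
  have uD: "u j \<in> Dom j" if "j < n" for j using u that by (simp add: Doms_def)
  have uL: "u j \<in> L2 (d j) (\<Omega> j)" if "j < n" for j using Dom_L2[OF that uD[OF that]] .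
  have uW: "has_weak_deriv (d j) (\<Omega> j) (mi_unit k) (u j) (Der j k (u j))" if "j < n" "k < d j" for j k
    by (rule H_weak_deriv[OF that(1) Dom_H[OF that(1) uD[OF that(1)]] that(2)])
  consider "i = j" | "i < j" | "j < i" by linarith
  then show ?thesis
  proof cases
    case 1
    have "has_weak_deriv D \<Omega>' (mi_shift d i (mi_unit k + mi_unit l)) (tensor u)
      (tensor (u(i := weak_deriv (d i) (\<Omega> i) (mi_unit k + mi_unit l) (u i))))"
      using i j 1 uL by (intro tensor_has_weak_deriv Dom_second_deriv uD) auto
    then show ?thesis using 1 i j by (simp add: D2_def mi_shift_add mi_shift_unit)
  next
    case 2
    have "has_weak_deriv D \<Omega>' (mi_unit (offset d i + k) + mi_unit (offset d j + l)) (tensor u)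
      (tensor (u(i := Der i k (u i), j := Der j l (u j))))"
      by (rule tensor_has_weak_deriv_cross[OF 2 j(1) i(2) j(2) uL uW[OF i] uW[OF j]])
    then show ?thesis using 2 by (simp add: D2_def)
  next
    \<comment> \<open>Weak derivatives were composed only with the smaller coordinate first, so
      \<open>i\<close> and \<open>j\<close> trade places; the updates and the sum of the
      multiindices commute.\<close>
    case 3
    have "has_weak_deriv D \<Omega>' (mi_unit (offset d j + l) + mi_unit (offset d i + k)) (tensor u)
      (tensor (u(j := Der j l (u j), i := Der i k (u i))))"
      by (rule tensor_has_weak_deriv_cross[OF 3 i(1) j(2) i(2) uL uW[OF j] uW[OF i]])
    moreover have "u(j := Der j l (u j), i := Der i k (u i)) = u(i := Der i k (u i), j := Der j l (u j))"
      using 3 by (intro fun_upd_twist) simp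
    moreover have "mi_unit (offset d j + l) + mi_unit (offset d i + k) = mi_unit (offset d i + k) + mi_unit (offset d j + l)"
      by (rule add.commute)
    moreover have "i \<noteq> j" using 3 by simp
    ultimately show ?thesis by (simp only: D2_def if_False)
  qed
qed

text \<open>Within one factor the double sum is twice the Hessian form, which the hypothesis on that
  factor evaluates. Across two factors it splits into a product of two Dirichlet forms; in the
  second one, symmetry moves \<open>A j\<close> to the right, so that \<open>A i\<close> acts on
  \<open>u\<close> and \<open>A j\<close> on \<open>v\<close>.\<close>

lemma sum_D2_inner:
  assumes u: "u \<in> Doms" and v: "v \<in> Doms" and i: "i < n" and j: "j < n"
  shows "(\<Sum>k<d i. \<Sum>l<d j. IP (D2 u i k j l) (D2 v i k j l)) = IP (apply_on {i} u) (apply_on {j} v)"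
proof -
  have uD: "u j \<in> Dom j" "v j \<in> Dom j" if "j < n" for j using u v that by (simp_all add: Doms_def)
  have uL: "u j \<in> L2 (d j) (\<Omega> j)" "v j \<in> L2 (d j) (\<Omega> j)" if "j < n" for j
    using Dom_L2[OF that uD(1)[OF that]] Dom_L2[OF that uD(2)[OF that]] by auto
  have uH: "u j \<in> H j" "v j \<in> H j" if "j < n" for j using Dom_H[OF that] uD[OF that] by auto
  show ?thesis
  proof (cases "i = j")
    case True
    let ?R = "\<Prod>l\<in>{..<n} - {i}. ip l (u l) (v l)"
    let ?w = "\<lambda>k l. weak_deriv (d i) (\<Omega> i) (mi_unit k + mi_unit l)"
    have "(\<Sum>k<d i. \<Sum>l<d j. IP (D2 u i k j l) (D2 v i k j l))
        = (\<Sum>k<d i. \<Sum>l<d i. ip i (?w k l (u i)) (?w k l (v i)) * ?R)"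
      unfolding True[symmetric]
    proof (intro sum.cong refl)
      fix k l assume "k \<in> {..<d i}" "l \<in> {..<d i}"
      then show "IP (D2 u i k i l) (D2 v i k i l) = ip i (?w k l (u i)) (?w k l (v i)) * ?R"
        unfolding D2_def if_P[OF refl] using i
        by (intro tensor_inner_update uL Dom_second_deriv_L2 uD) auto
    qed
    also have "\<dots> = (\<Sum>k<d i. \<Sum>l<d i. ip i (?w k l (u i)) (?w k l (v i))) * ?R"
      by (simp only: sum_distrib_right)
    also have "(\<Sum>k<d i. \<Sum>l<d i. ip i (?w k l (u i)) (?w k l (v i))) = 2 * hessian_form (d i) (\<Omega> i) (u i) (v i)"
      unfolding hessian_form_def sum_second_order by simp
    also have "\<dots> = ip i (A i (u i)) (A i (v i))"
      using hessian_A[OF i uD(1)[OF i] uD(2)[OF i]] by (simp add: mult.commute)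
    also have "ip i (A i (u i)) (A i (v i)) * ?R = IP (apply_on {i} u) (apply_on {i} v)"
      unfolding apply_on_singleton using i by (intro tensor_inner_update[symmetric] uL A_L2 uD) auto
    finally show ?thesis unfolding True .
  next
    case False
    let ?R = "\<Prod>l\<in>{..<n} - {j} - {i}. ip l (u l) (v l)"
    have "(\<Sum>k<d i. \<Sum>l<d j. IP (D2 u i k j l) (D2 v i k j l))
        = (\<Sum>k<d i. \<Sum>l<d j. (ip i (Der i k (u i)) (Der i k (v i)) * ip j (Der j l (u j)) (Der j l (v j))) * ?R)"
    proof (intro sum.cong refl)
      fix k l assume "k \<in> {..<d i}" "l \<in> {..<d j}"
      then show "IP (D2 u i k j l) (D2 v i k j l)
          = (ip i (Der i k (u i)) (Der i k (v i)) * ip j (Der j l (u j)) (Der j l (v j))) * ?R"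
        unfolding D2_def if_not_P[OF False] using i j False
        by (intro tensor_inner_update2 uL H_deriv_L2 uH) auto
    qed
    also have "\<dots> = ((\<Sum>k<d i. ip i (Der i k (u i)) (Der i k (v i))) * (\<Sum>l<d j. ip j (Der j l (u j)) (Der j l (v j)))) * ?R"
      by (subst sum_product) (simp only: sum_distrib_right)
    also have "\<dots> = ip i (A i (u i)) (v i) * ip j (u j) (A j (v j)) * ?R"
      by (simp only: A_form[OF i uD(1)[OF i] uH(2)[OF i]] A_form[OF j uD(1)[OF j] uH(2)[OF j]]
          A_sym[OF j uD(1)[OF j] uD(2)[OF j]])
    \<comment> \<open>The updates by \<open>u j\<close> and \<open>v i\<close> change nothing; they
      give the product the shape of \<open>tensor_inner_update2\<close>.\<close>
    also have "\<dots> = IP (tensor (u(i := A i (u i), j := u j))) (tensor (v(i := v i, j := A j (v j))))"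
      using i j False by (intro tensor_inner_update2[symmetric] uL A_L2 uD) auto
    also have "u(i := A i (u i), j := u j) = u(i := A i (u i))" using False by auto
    also have "v(i := v i, j := A j (v j)) = v(j := A j (v j))" by auto
    finally show ?thesis by (simp only: apply_on_singleton)
  qed
qed

lemma hessian_form_tensors:
  assumes u: "u \<in> Doms" and v: "v \<in> Doms"
  shows "hessian_form D \<Omega>' (tensor u) (tensor v) = 1 / 2 * IP (T (tensor u)) (T (tensor v))"
proof -
  define F where "F w p q = D2 w (block_index d p) (p - offset d (block_index d p))
    (block_index d q) (q - offset d (block_index d q))" for w p q
  have F: "F w (offset d i + k) (offset d j + l) = D2 w i k j l" if "k < d i" "l < d j" for w i j k l
    using that by (simp add: F_def block_index_eq)
  have hw: "has_weak_deriv D \<Omega>' (mi_unit p + mi_unit q) (tensor w) (F w p q)"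
    if p: "p < D" and q: "q < D" and w: "w \<in> Doms" for p q w
  proof -
    obtain i k where i: "i < n" "k < d i" "p = offset d i + k" using offset_decomp[OF p] .
    obtain j l where j: "j < n" "l < d j" "q = offset d j + l" using offset_decomp[OF q] .
    show ?thesis unfolding i(3) j(3) F[OF i(2) j(2)] by (rule tensor_second_deriv[OF w i(1,2) j(1,2)])
  qed
  have "hessian_form D \<Omega>' (tensor u) (tensor v) = 1 / 2 * (\<Sum>p<D. \<Sum>q<D. IP (F u p q) (F v p q))"
    by (rule hessian_form_pairs[OF open_product hw[OF _ _ u] hw[OF _ _ v]])
  also have "(\<Sum>p<D. \<Sum>q<D. IP (F u p q) (F v p q))
      = (\<Sum>i<n. \<Sum>k<d i. \<Sum>j<n. \<Sum>l<d j. IP (D2 u i k j l) (D2 v i k j l))"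
    unfolding sum_offset by (intro sum.cong refl) (simp add: F)
  also have "\<dots> = (\<Sum>i<n. \<Sum>j<n. \<Sum>k<d i. \<Sum>l<d j. IP (D2 u i k j l) (D2 v i k j l))"
    by (rule sum.cong[OF refl], rule sum.swap)
  also have "\<dots> = (\<Sum>i<n. \<Sum>j<n. IP (apply_on {i} u) (apply_on {j} v))"
    using u v by (intro sum.cong refl sum_D2_inner) auto
  also have "\<dots> = IP (sum_A u) (sum_A v)"
    unfolding sum_A_def using u v
    by (simp add: L2_inner_sum_left L2_inner_sum_right apply_on_L2 L2_sum) (rule sum.swap)
  also have "\<dots> = IP (T (tensor u)) (T (tensor v))"
    using T_tensor[OF u] T_tensor[OF v] u v
    by (intro L2_inner_cong_AE) (auto intro: T_L2 sum_A_L2)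
  finally show ?thesis .
qed

section \<open>The core and the passage to the limit\<close>

definition core :: "cfun set" where
  "core = cspan (tensor ` Doms)"

lemma csubspace_core: "csubspace core"
  unfolding core_def by (rule cfun.subspace_span)

lemma core_DomT: "core \<subseteq> DomT"
  unfolding core_def using T_tensor(1)
  by (intro cfun.span_minimal self_adjoint_D(1)[OF saT]) auto

lemma tensor_twice: 
  assumes "u \<in> Doms"
  shows "tensor u \<in> twice_weakly_differentiable D \<Omega>'"
  unfolding twice_weakly_differentiable_def
proof (intro CollectI ballI)
  fix \<alpha> assume "\<alpha> \<in> second_order D"
  then obtain p q where pq: "p < D" "q < D" "\<alpha> = mi_unit p + mi_unit q" by (rule second_orderE)
  obtain i k where i: "i < n" "k < d i" "p = offset d i + k" using offset_decomp[OF pq(1)] .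
  obtain j l where j: "j < n" "l < d j" "q = offset d j + l" using offset_decomp[OF pq(2)] .
  have "has_weak_deriv D \<Omega>' \<alpha> (tensor u) (D2 u i k j l)"
    using tensor_second_deriv[OF assms i(1,2) j(1,2)] by (simp only: pq(3) i(3) j(3))
  then show "\<exists>g. has_weak_deriv D \<Omega>' \<alpha> (tensor u) g"
    by (rule exI[of _ "D2 u i k j l"])
qed

lemma core_twice: "core \<subseteq> twice_weakly_differentiable D \<Omega>'"
  unfolding core_def
  by (rule cfun.span_minimal[OF image_subsetI[OF tensor_twice] csubspace_twice_weakly_differentiable[OF open_product]])

text \<open>Linearity in the left argument is used in two rounds: with a tensor on the right, and
  then, after conjugate symmetry has exchanged the arguments, with an arbitrary core element on the
  right.\<close>

lemma hessian_form_core: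
  assumes "f \<in> core" "g \<in> core"
  shows "hessian_form D \<Omega>' f g = 1 / 2 * IP (T f) (T g)"
proof -
  let ?W = "twice_weakly_differentiable D \<Omega>'"
  let ?P = "\<lambda>g f. f \<in> ?W \<and> f \<in> DomT \<and> hessian_form D \<Omega>' f g = 1 / 2 * IP (T f) (T g)"
  note W = csubspace_twice_weakly_differentiable[OF open_product]
  note TT = self_adjoint_D[OF saT]
  have sub: "csubspace {f. ?P g f}" if g: "g \<in> ?W" "g \<in> DomT" for g
  proof (rule cfun.subspaceI)
    have add: "IP (T (f + f')) (T g) = IP (T f) (T g) + IP (T f') (T g)" if "f \<in> DomT" "f' \<in> DomT" for f f'
    proof -
      have "IP (T (f + f')) (T g) = IP (T f + T f') (T g)"
        using TT(5)[OF that] that g cfun.subspace_add[OF TT(1) that]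
        by (intro L2_inner_cong_AE T_L2 L2_add) auto
      then show ?thesis using that g by (simp add: L2_inner_add_left T_L2)
    qed
    have scale: "IP (T (csmult c f)) (T g) = c * IP (T f) (T g)" if "f \<in> DomT" for f c
    proof -
      have "IP (T (csmult c f)) (T g) = IP (csmult c (T f)) (T g)"
        using TT(6)[OF that] that g cfun.subspace_scale[OF TT(1) that]
        by (intro L2_inner_cong_AE T_L2 L2_csmult) auto
      then show ?thesis by (simp only: L2_inner_csmult_left)
    qed
    show "f + f' \<in> {f. ?P g f}" if "f \<in> {f. ?P g f}" "f' \<in> {f. ?P g f}" for f f'
      using that g cfun.subspace_add[OF W, of f f'] cfun.subspace_add[OF TT(1), of f f']
      by (simp only: mem_Collect_eq hessian_form_add_left[OF open_product] add distrib_left)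
    show sc: "csmult c f \<in> {f. ?P g f}" if "f \<in> {f. ?P g f}" for c f
      using that g cfun.subspace_scale[OF W, of f c] cfun.subspace_scale[OF TT(1), of f c]
      by (simp only: mem_Collect_eq hessian_form_csmult_left[OF open_product] scale mult.left_commute)
    \<comment> \<open>\<open>T 0\<close> is known to vanish only almost everywhere, so the zero
      element is treated through homogeneity with factor 0.\<close>
    have z: "csmult 0 0 = 0" by (simp add: fun_eq_iff)
    have zW: "0 \<in> ?W" and zT: "0 \<in> DomT" using cfun.subspace_0[OF W] cfun.subspace_0[OF TT(1)] by auto
    have "hessian_form D \<Omega>' 0 g = 0" "IP (T 0) (T g) = 0"
      using hessian_form_csmult_left[OF open_product zW g(1), of 0] scale[OF zT, of 0] by (simp_all only: z mult_zero_left)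
    then show "0 \<in> {f. ?P g f}" using zW zT by simp
  qed
  have sym: "hessian_form D \<Omega>' g f = 1 / 2 * IP (T g) (T f)" if "hessian_form D \<Omega>' f g = 1 / 2 * IP (T f) (T g)" for f g
    unfolding hessian_form_commute[of D \<Omega>' g f] that L2_inner_commute[of D \<Omega>' "T g" "T f"] by simp
  have left: "core \<subseteq> {f. ?P (tensor v) f}" if v: "v \<in> Doms" for v
    unfolding core_def
  proof (rule cfun.span_minimal)
    show "tensor ` Doms \<subseteq> {f. ?P (tensor v) f}"
      using tensor_twice T_tensor(1) hessian_form_tensors[OF _ v] by (intro image_subsetI CollectI conjI)
    show "csubspace {f. ?P (tensor v) f}" by (rule sub[OF tensor_twice[OF v] T_tensor(1)[OF v]])
  qed
  have fW: "f \<in> ?W" "f \<in> DomT" using assms(1) core_twice core_DomT by auto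
  have "core \<subseteq> {g. ?P f g}"
    unfolding core_def
  proof (rule cfun.span_minimal)
    show "csubspace {g. ?P f g}" by (rule sub[OF fW])
    have "hessian_form D \<Omega>' (tensor v) f = 1 / 2 * IP (T (tensor v)) (T f)" if "v \<in> Doms" for v
    proof (rule sym)
      from subsetD[OF left[OF that] assms(1)]
      show "hessian_form D \<Omega>' f (tensor v) = 1 / 2 * IP (T f) (T (tensor v))" by (elim CollectE conjE)
    qed
    then show "tensor ` Doms \<subseteq> {g. ?P f g}"
      using tensor_twice T_tensor(1) by (intro image_subsetI CollectI conjI)
  qed
  from subsetD[OF this assms(2)]
  have "hessian_form D \<Omega>' g f = 1 / 2 * IP (T g) (T f)" by (elim CollectE conjE)
  then show ?thesis by (rule sym)
qed

text \<open>Since \<open>1 + T\<close> maps the core onto a dense set, \<open>f + T f\<close> can be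
  approximated. Nonnegativity of \<open>T\<close> gives \<open>(NN r)\<^sup>2 + (NN (T r))\<^sup>2
  \<le> (NN (r + T r))\<^sup>2\<close>, so the error \<open>r = f - u\<close> is small together with
  \<open>T r\<close>.\<close>

lemma core_approx:
  assumes f: "f \<in> DomT" and e: "e > 0"
  obtains u where "u \<in> core" "NN (u - f) < e" "NN (T u - T f) < e"
proof -
  note TT = self_adjoint_D[OF saT]
  have "\<exists>u\<in>core. NN ((f + T f) - (u + T u)) < e"
  proof (rule dense_range_one_plus[OF saT csubspace_core core_DomT])
    show "f + T f \<in> L2 D \<Omega>'" using f by (intro L2_add DomT_L2 T_L2)
    fix h assume h: "h \<in> L2 D \<Omega>'" and orth: "\<And>u. u \<in> core \<Longrightarrow> IP h (u + T u) = 0"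
    show "NN h = 0"
    proof (rule core_orthogonal_trivial[OF h])
      fix u assume u: "u \<in> Doms"
      note t = T_tensor[OF u]
      have "IP h (small_subsets_sum u) = IP h (tensor u + T (tensor u))"
      proof (rule L2_inner_cong_AE)
        show "AE x in leb_on D \<Omega>'. small_subsets_sum u x = (tensor u + T (tensor u)) x"
          unfolding small_subsets_sum_eq using t(2) by eventually_elim simp
      qed (use h u t small_subsets_sum_L2 DomT_L2 T_L2 in \<open>auto intro: L2_add\<close>)
      also have "\<dots> = 0" using u by (intro orth) (auto simp: core_def intro: cfun.span_base)
      finally show "IP h (small_subsets_sum u) = 0" .
    qed
  qed fact
  then obtain u where u: "u \<in> core" "NN ((f + T f) - (u + T u)) < e" by blast
  have uT: "u \<in> DomT" using u core_DomT by blast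
  define r where "r = f - u"
  have r: "r \<in> DomT" "AE x in leb_on D \<Omega>'. T r x = T f x - T u x"
    unfolding r_def by (rule self_adjoint_diff[OF saT f uT])+
  have rL: "r \<in> L2 D \<Omega>'" "T r \<in> L2 D \<Omega>'" using r DomT_L2 T_L2 by auto
  have fuL: "f \<in> L2 D \<Omega>'" "T f \<in> L2 D \<Omega>'" "u \<in> L2 D \<Omega>'" "T u \<in> L2 D \<Omega>'"
    using f uT DomT_L2 T_L2 by auto
  have "AE x in leb_on D \<Omega>'. (r + T r) x = ((f + T f) - (u + T u)) x"
    using r(2) by eventually_elim (simp add: r_def)
  then have "NN (r + T r) = NN ((f + T f) - (u + T u))"
    by (rule L2_norm_cong_AE) (intro L2_add L2_diff rL fuL)+
  then have small: "NN (r + T r) < e" using u(2) by simp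
  have "0 \<le> Re (IP (T r) r)"
    using form_operatorD(2)[OF form_T] r(1) unfolding nonnegative_def by blast
  then have "0 \<le> Re (IP r (T r))" using L2_inner_commute[of D \<Omega>' r "T r"] by simp
  then have sq: "(NN r)\<^sup>2 + (NN (T r))\<^sup>2 \<le> (NN (r + T r))\<^sup>2"
    using L2_norm_square_add[OF rL] by simp
  have "(NN r)\<^sup>2 \<le> (NN (r + T r))\<^sup>2" "(NN (T r))\<^sup>2 \<le> (NN (r + T r))\<^sup>2"
    using sq zero_le_power2[of "NN r"] zero_le_power2[of "NN (T r)"] by linarith+
  then have "NN r \<le> NN (r + T r)" "NN (T r) \<le> NN (r + T r)"
    by (auto dest: power2_le_imp_le[OF _ L2_norm_ge_0])
  moreover have "NN (u - f) = NN r" unfolding r_def by (rule L2_norm_minus_commute)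
  moreover have "NN (T r) = NN (T f - T u)"
    using r(2) by (intro L2_norm_cong_AE L2_diff rL fuL) simp
  ultimately show ?thesis
    using that[OF u(1)] small L2_norm_minus_commute[of D \<Omega>' "T u" "T f"] by simp
qed

text \<open>At equal arguments the identity is about a sum of nonnegative terms, each of which is at
  most the total. The factorial clears the weight; the factor 1/2 is given away.\<close>

lemma hessian_norm_core:
  assumes "f \<in> core" "\<alpha> \<in> second_order D"
  shows "(NN (weak_deriv D \<Omega>' \<alpha> f))\<^sup>2 \<le> of_nat (mi_fact D \<alpha>) * (NN (T f))\<^sup>2"
proof -
  let ?t = "\<lambda>\<beta>. 1 / of_nat (mi_fact D \<beta>) * (NN (weak_deriv D \<Omega>' \<beta> f))\<^sup>2 :: real"
  have "complex_of_real (\<Sum>\<beta>\<in>second_order D. ?t \<beta>) = hessian_form D \<Omega>' f f"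
    unfolding hessian_form_def by (simp add: L2_inner_self)
  also have "\<dots> = complex_of_real (1 / 2 * (NN (T f))\<^sup>2)"
    unfolding hessian_form_core[OF assms(1,1)] L2_inner_self by simp
  finally have "(\<Sum>\<beta>\<in>second_order D. ?t \<beta>) = 1 / 2 * (NN (T f))\<^sup>2" by (simp only: of_real_eq_iff)
  moreover have "?t \<alpha> \<le> (\<Sum>\<beta>\<in>second_order D. ?t \<beta>)"
    by (intro member_le_sum finite_second_order assms(2)) auto
  ultimately have "?t \<alpha> \<le> 1 / 2 * (NN (T f))\<^sup>2" by (simp only:)
  also have "\<dots> \<le> (NN (T f))\<^sup>2" by simp
  finally show ?thesis using mi_fact_pos[of D \<alpha>] by (simp add: divide_simps mult.commute)
qed

text \<open>Differences of core elements stay in the core, so convergence of \<open>T (u m)\<close>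
  makes every second derivative of \<open>u m\<close> Cauchy. Completeness provides a limit and
  closedness identifies it as a derivative of \<open>f\<close>. One sequence serves all
  multiindices.\<close>

lemma DomT_limit:
  assumes f: "f \<in> DomT"
  obtains u where "\<forall>m. u m \<in> core" "(\<lambda>m. NN (T (u m) - T f)) \<longlonglongrightarrow> 0"
    "\<forall>\<alpha>\<in>second_order D. has_weak_deriv D \<Omega>' \<alpha> f (weak_deriv D \<Omega>' \<alpha> f)"
    "\<forall>\<alpha>\<in>second_order D. (\<lambda>m. NN (weak_deriv D \<Omega>' \<alpha> (u m) - weak_deriv D \<Omega>' \<alpha> f)) \<longlonglongrightarrow> 0"
proof -
  have "\<exists>u. u \<in> core \<and> NN (u - f) < inverse (real (Suc m)) \<and> NN (T u - T f) < inverse (real (Suc m))" for m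
    using core_approx[OF f, of "inverse (real (Suc m))"] by (metis inverse_positive_iff_positive of_nat_0_less_iff zero_less_Suc)
  then obtain u where u: "\<And>m. u m \<in> core" "\<And>m. NN (u m - f) < inverse (real (Suc m))"
    "\<And>m. NN (T (u m) - T f) < inverse (real (Suc m))" by metis
  have squeeze: "X \<longlonglongrightarrow> 0" if "\<And>m. 0 \<le> X m" "\<And>m. X m < inverse (real (Suc m))" for X
    by (rule real_tendsto_sandwich[OF _ _ tendsto_const LIMSEQ_inverse_real_of_nat])
      (intro always_eventually allI that less_imp_le[OF that(2)])+
  have lim: "(\<lambda>m. NN (u m - f)) \<longlonglongrightarrow> 0" "(\<lambda>m. NN (T (u m) - T f)) \<longlonglongrightarrow> 0"
    using u(2,3) by (auto intro!: squeeze)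
  have uT: "u m \<in> DomT" for m using u(1) core_DomT by blast
  note TuL = T_L2[OF uT] and TfL = T_L2[OF f]
  have uW: "has_weak_deriv D \<Omega>' \<alpha> (u m) (weak_deriv D \<Omega>' \<alpha> (u m))" if "\<alpha> \<in> second_order D" for \<alpha> m
    using twice_weak_deriv[OF _ that] u(1) core_twice by blast
  have "has_weak_deriv D \<Omega>' \<alpha> f (weak_deriv D \<Omega>' \<alpha> f) \<and>
      (\<lambda>m. NN (weak_deriv D \<Omega>' \<alpha> (u m) - weak_deriv D \<Omega>' \<alpha> f)) \<longlonglongrightarrow> 0"
    if \<alpha>: "\<alpha> \<in> second_order D" for \<alpha>
  proof -
    let ?w = "weak_deriv D \<Omega>' \<alpha>"
    note wL = has_weak_derivD(2)[OF uW[OF \<alpha>]]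
    define K where "K = real (mi_fact D \<alpha>)"
    have K: "K > 0" unfolding K_def using mi_fact_pos[of D \<alpha>] by simp
    have Cau: "NN (?w (u m) - ?w (u l)) \<le> sqrt K * (NN (T (u m) - T f) + NN (T (u l) - T f))" for m l
    proof -
      have c: "u m - u l \<in> core" using u(1) by (intro cfun.subspace_diff csubspace_core)
      note dT = self_adjoint_diff[OF saT uT uT, of m l]
      have "NN (?w (u m) - ?w (u l)) = NN (?w (u m - u l))"
        by (rule norm_weak_deriv[OF open_product, symmetric]) (intro has_weak_deriv_diff[OF open_product] uW \<alpha>)
      also have "\<dots> \<le> sqrt (K * (NN (T (u m - u l)))\<^sup>2)"
        unfolding K_def by (rule real_le_rsqrt) (rule hessian_norm_core[OF c \<alpha>])
      also have "\<dots> = sqrt K * NN (T (u m - u l))" by (simp add: real_sqrt_mult)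
      also have "NN (T (u m - u l)) = NN (T (u m) - T (u l))"
        using dT uT by (intro L2_norm_cong_AE T_L2 L2_diff) auto
      also have "sqrt K * \<dots> \<le> sqrt K * (NN (T (u m) - T f) + NN (T (u l) - T f))"
        using L2_triangle_diff[OF TuL[of m] TuL[of l] TfL] L2_norm_minus_commute[of D \<Omega>' "T f" "T (u l)"] K
        by (intro mult_left_mono) auto
      finally show ?thesis .
    qed
    obtain g where g: "g \<in> L2 D \<Omega>'" "(\<lambda>m. NN (?w (u m) - g)) \<longlonglongrightarrow> 0"
    proof (rule L2_complete[of "\<lambda>m. ?w (u m)"])
      fix e :: real assume e: "e > 0"
      have "(\<lambda>m. sqrt K * NN (T (u m) - T f)) \<longlonglongrightarrow> sqrt K * 0"
        by (intro tendsto_mult tendsto_const lim)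
      then obtain m0 where m0: "\<And>m. m \<ge> m0 \<Longrightarrow> norm (sqrt K * NN (T (u m) - T f) - 0) < e / 2"
        using LIMSEQ_D[of _ 0 "e / 2"] e by fastforce
      show "\<exists>N. \<forall>m\<ge>N. \<forall>l\<ge>N. NN (?w (u m) - ?w (u l)) < e"
      proof (intro exI allI impI)
        fix m l assume "m \<ge> m0" "l \<ge> m0"
        then show "NN (?w (u m) - ?w (u l)) < e"
          using Cau[of m l] m0[of m] m0[of l] K by (simp add: distrib_left abs_mult)
      qed
    qed (use wL in auto)
    have fg: "has_weak_deriv D \<Omega>' \<alpha> f g"
      by (rule has_weak_deriv_limit[OF open_product uW[OF \<alpha>] DomT_L2[OF f] g(1) lim(1) g(2)])
    then have fw: "has_weak_deriv D \<Omega>' \<alpha> f (?w f)" by (rule has_weak_deriv_weak_deriv)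
    \<comment> \<open>The limit \<open>g\<close> and the representative chosen by
      \<open>weak_deriv\<close> agree almost everywhere, so the convergence may be stated for the
      latter.\<close>
    have "NN (?w (u m) - ?w f) = NN (?w (u m) - g)" for m
    proof (rule L2_norm_cong_AE)
      show "AE x in leb_on D \<Omega>'. (?w (u m) - ?w f) x = (?w (u m) - g) x"
        using weak_deriv_AE_eq[OF open_product fg] by eventually_elim simp
    qed (intro L2_diff wL g has_weak_derivD(2)[OF fw])+
    then show ?thesis using fw g(2) by simp
  qed
  then show ?thesis by (intro that[of u] allI u(1) lim(2)) blast+
qed

text \<open>Existence of the derivatives of order two was obtained along the approximating sequence;
  lower orders come from the form domain lying in H1. The identity passes to the limit because inner
  products are jointly continuous, with one sequence for each argument.\<close>

lemma DomT_second_order: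
  "DomT \<subseteq> sobolev 2 D \<Omega>'"
  "f \<in> DomT \<Longrightarrow> g \<in> DomT \<Longrightarrow> hessian_form D \<Omega>' f g = 1 / 2 * IP (T f) (T g)"
proof -
  show "DomT \<subseteq> sobolev 2 D \<Omega>'"
  proof
    fix f assume f: "f \<in> DomT"
    then have f1: "f \<in> sobolev 1 D \<Omega>'" using DomT_tensor_space tensor_space_sobolev by blast
    have "\<exists>g. has_weak_deriv D \<Omega>' \<alpha> f g" if \<alpha>: "\<alpha> \<in> multiindices D" "mi_order D \<alpha> \<le> 2" for \<alpha>
    proof (cases "mi_order D \<alpha> = 2")
      case True
      have "\<forall>\<alpha>\<in>second_order D. has_weak_deriv D \<Omega>' \<alpha> f (weak_deriv D \<Omega>' \<alpha> f)"
        by (rule DomT_limit[OF f])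
      then show ?thesis using \<alpha>(1) True by blast
    next
      case False
      then show ?thesis using f1 \<alpha> unfolding sobolev_def by auto
    qed
    then show "f \<in> sobolev 2 D \<Omega>'" using f1 unfolding sobolev_def by blast
  qed
  assume f: "f \<in> DomT" and g: "g \<in> DomT"
  obtain u where u: "\<forall>m. u m \<in> core" "(\<lambda>m. NN (T (u m) - T f)) \<longlonglongrightarrow> 0"
    "\<forall>\<alpha>\<in>second_order D. has_weak_deriv D \<Omega>' \<alpha> f (weak_deriv D \<Omega>' \<alpha> f)"
    "\<forall>\<alpha>\<in>second_order D. (\<lambda>m. NN (weak_deriv D \<Omega>' \<alpha> (u m) - weak_deriv D \<Omega>' \<alpha> f)) \<longlonglongrightarrow> 0"
    by (rule DomT_limit[OF f])
  obtain v where v: "\<forall>m. v m \<in> core" "(\<lambda>m. NN (T (v m) - T g)) \<longlonglongrightarrow> 0"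
    "\<forall>\<alpha>\<in>second_order D. has_weak_deriv D \<Omega>' \<alpha> g (weak_deriv D \<Omega>' \<alpha> g)"
    "\<forall>\<alpha>\<in>second_order D. (\<lambda>m. NN (weak_deriv D \<Omega>' \<alpha> (v m) - weak_deriv D \<Omega>' \<alpha> g)) \<longlonglongrightarrow> 0"
    by (rule DomT_limit[OF g])
  have cW: "weak_deriv D \<Omega>' \<alpha> w \<in> L2 D \<Omega>'" if "\<alpha> \<in> second_order D" "w \<in> core" for \<alpha> w
    using has_weak_derivD(2)[OF twice_weak_deriv[OF _ that(1)]] that(2) core_twice by blast
  note u = u(1)[rule_format] u(2) u(3,4)[rule_format]
  note v = v(1)[rule_format] v(2) v(3,4)[rule_format]
  have "(\<lambda>m. hessian_form D \<Omega>' (u m) (v m)) \<longlonglongrightarrow> hessian_form D \<Omega>' f g"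
    unfolding hessian_form_def
    by (intro tendsto_sum tendsto_mult tendsto_const L2_inner_tendsto u(4) v(4) cW u(1) v(1)
        has_weak_derivD(2)[OF u(3)] has_weak_derivD(2)[OF v(3)])
  moreover have "(\<lambda>m. 1 / 2 * IP (T (u m)) (T (v m))) \<longlonglongrightarrow> 1 / 2 * IP (T f) (T g)"
    using u(1) v(1) core_DomT f g u(2) v(2)
    by (intro tendsto_mult tendsto_const L2_inner_tendsto T_L2) auto
  ultimately show "hessian_form D \<Omega>' f g = 1 / 2 * IP (T f) (T g)"
    unfolding hessian_form_core[OF u(1) v(1)] by (rule LIMSEQ_unique)
qed

end

theorem proposition4p1:
  fixes n :: nat and d :: "nat \<Rightarrow> nat" and \<Omega> :: "nat \<Rightarrow> point set" and H :: "nat \<Rightarrow> cfun set"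
    and Dom\<Delta> :: "nat \<Rightarrow> cfun set" and \<Delta> :: "nat \<Rightarrow> cfun \<Rightarrow> cfun"
    and DomT :: "cfun set" and T :: "cfun \<Rightarrow> cfun"
  defines "d' \<equiv> total_dim n d" and "\<Omega>' \<equiv> product_domain n d \<Omega>"
  assumes "n \<ge> 2"
    and "\<And>j. j < n \<Longrightarrow> d j \<ge> 1"
    and "\<And>j. j < n \<Longrightarrow> openin (eucl (d j)) (\<Omega> j)"
    and "\<And>j. j < n \<Longrightarrow> closed_H1_subspace (d j) (\<Omega> j) (H j)"
    and "\<And>j. j < n \<Longrightarrow> L2_dense (d j) (\<Omega> j) (H j)"
    and "\<And>j. j < n \<Longrightarrow> laplacian (d j) (\<Omega> j) (H j) (Dom\<Delta> j) (\<Delta> j)"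
    and "form_operator d' \<Omega>' (tensor_space n d \<Omega> H) DomT T"
    and "\<And>j. j < n \<Longrightarrow> Dom\<Delta> j \<subseteq> sobolev 2 (d j) (\<Omega> j)"
    and "\<And>j u v. j < n \<Longrightarrow> u \<in> Dom\<Delta> j \<Longrightarrow> v \<in> Dom\<Delta> j \<Longrightarrow>
      (\<Sum>\<alpha> | \<alpha> \<in> multiindices (d j) \<and> mi_order (d j) \<alpha> = 2.
         1 / of_nat (mi_fact (d j) \<alpha>) *
         L2_inner (d j) (\<Omega> j) (weak_deriv (d j) (\<Omega> j) \<alpha> u) (weak_deriv (d j) (\<Omega> j) \<alpha> v))
      = 1 / 2 * L2_inner (d j) (\<Omega> j) (\<Delta> j u) (\<Delta> j v)"
  shows "DomT \<subseteq> sobolev 2 d' \<Omega>' \<and>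
    (\<forall>f\<in>DomT. \<forall>g\<in>DomT.
      (\<Sum>\<alpha> | \<alpha> \<in> multiindices d' \<and> mi_order d' \<alpha> = 2.
         1 / of_nat (mi_fact d' \<alpha>) *
         L2_inner d' \<Omega>' (weak_deriv d' \<Omega>' \<alpha> f) (weak_deriv d' \<Omega>' \<alpha> g))
      = 1 / 2 * L2_inner d' \<Omega>' (T f) (T g))"
proof -
  have eq: "d' = offset d n" by (simp add: d'_def total_dim_eq_offset)
  interpret hessian_setting n d \<Omega> H Dom\<Delta> "\<lambda>j u. - \<Delta> j u" DomT T
  proof
    fix j assume j: "j < n"
    show "openin (eucl (d j)) (\<Omega> j)" by (rule assms(5)[OF j])
    show "H j \<subseteq> sobolev 1 (d j) (\<Omega> j)" using assms(6)[OF j] unfolding closed_H1_subspace_def by blast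
    show "form_operator (d j) (\<Omega> j) (H j) (Dom\<Delta> j) (\<lambda>u. - \<Delta> j u)"
      using assms(8)[OF j] unfolding laplacian_def .
    show "Dom\<Delta> j \<subseteq> sobolev 2 (d j) (\<Omega> j)" by (rule assms(10)[OF j])
    fix u v assume "u \<in> Dom\<Delta> j" "v \<in> Dom\<Delta> j"
    from assms(11)[OF j this]
    \<comment> \<open>The two signs in \<open>- \<Delta> j\<close> cancel in the inner
      product.\<close>
    show "hessian_form (d j) (\<Omega> j) u v = 1 / 2 * L2_inner (d j) (\<Omega> j) (- \<Delta> j u) (- \<Delta> j v)"
      unfolding hessian_form_def L2_inner_uminus_left L2_inner_uminus_right minus_minus .
  next
    show "form_operator (offset d n) (product_domain n d \<Omega>) (tensor_space n d \<Omega> H) DomT T"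
      using assms(9) unfolding eq \<Omega>'_def .
  qed
  show ?thesis
    unfolding eq \<Omega>'_def using DomT_second_order unfolding hessian_form_def by blast
qed

end
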